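(* Let $p\in[1,\infty)$ and let $d=d(n)$ be an arbitrary sequence of positive integers such that $d(n)\to\infty$ as $n\to\infty$. Let $\xi$ be a centered, nontrivial real random variable with $\mathbf{E}|\xi|^{2p}<\infty$, and put $\sigma^2=\mathbf{E}\xi^2$. For each $d$, let $X_1^{(d)},X_2^{(d)},\ldots$ be independent identically distributed random vectors in $\mathbb{R}^d$ such that $X_1^{(d)}=d^{-1/p}(\xi_1,\ldots,\xi_d)$, where $\xi_1,\ldots,\xi_d$ are uncorrelated random variables each having the same distribution as $\xi$. Let $S_0^{(d)}=0$, $S_k^{(d)}=X_1^{(d)}+\cdots+X_k^{(d)}$ for $k\ge 1$, and $\mathcal{Z}_n^{(d)}=\{S_0^{(d)},\ldots,S_n^{(d)}\}\subset\mathbb{R}^d$. Then, as $n\to\infty$ with $d=d(n)$, the random metric space $(n^{-1/2}\mathcal{Z}_n^{(d)},\|\cdot\|_p)$ converges in probability, with respect to the Gromov--Hausdorff distance, to the deterministic metric space consisting of $[0,1]$ with the metric $(t,s)\mapsto \sqrt{|t-s|}\,\sigma M_p^{1/p}$; that is, the Gromov--Hausdorff distance between these two metric spaces converges to $0$ in probability.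
   Context: $\|x\|_p=(\sum_i|x_i|^p)^{1/p}$ is the $\ell_p$-norm on $\mathbb{R}^d$; the finite set $n^{-1/2}\mathcal{Z}_n^{(d)}=\{n^{-1/2}S_0^{(d)},\ldots,n^{-1/2}S_n^{(d)}\}$ carries the metric induced by this norm. $M_p=\mathbf{E}|N|^p$, with $N$ standard normal, is the $p$-th absolute moment of the standard normal distribution. The components $\xi_1,\ldots,\xi_d$ of a single step are only assumed uncorrelated (not necessarily independent); different steps are independent. "Centered" means mean zero and "nontrivial" means not almost surely equal to $0$. The Gromov--Hausdorff distance between metric spaces $\mathbb{X}=(X,\rho_X)$ and $\mathbb{Y}=(Y,\rho_Y)$ is $d_{GH}(\mathbb{X},\mathbb{Y})=\inf d_H(i(X),j(Y))$, where the infimum is over all metric spaces $(Z,d)$ and all isometric embeddings $i:X\hookrightarrow Z$, $j:Y\hookrightarrow Z$, and $d_H$ is the Hausdorff distance in $Z$: $d_H(F,H)=\inf\{\varepsilon>0: F\subset H^\varepsilon,\ H\subset F^\varepsilon\}$ with $F^\varepsilon=\{x: d(x,F)<\varepsilon\}$. *)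

theory Defs
  imports "HOL-Probability.Probability"
begin

text \<open>
  Gromov--Hausdorff distance. Distances between sets take values in \<^typ>\<open>ereal\<close>, so that
  infima over empty sets are \<open>\<infinity>\<close> rather than unspecified reals.
\<close>

definition dist_to_set :: "('a \<Rightarrow> 'a \<Rightarrow> real) \<Rightarrow> 'a \<Rightarrow> 'a set \<Rightarrow> ereal" where
  "dist_to_set d x F = (INF y\<in>F. ereal (d x y))"

definition nbhd_of_set :: "'a set \<Rightarrow> ('a \<Rightarrow> 'a \<Rightarrow> real) \<Rightarrow> real \<Rightarrow> 'a set \<Rightarrow> 'a set" where
  "nbhd_of_set Z d \<epsilon> F = {x \<in> Z. dist_to_set d x F < ereal \<epsilon>}"

definition hausdorff_dist :: "'a set \<Rightarrow> ('a \<Rightarrow> 'a \<Rightarrow> real) \<Rightarrow> 'a set \<Rightarrow> 'a set \<Rightarrow> ereal" where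
  "hausdorff_dist Z d F H =
     Inf {ereal \<epsilon> |\<epsilon>. \<epsilon> > 0 \<and> F \<subseteq> nbhd_of_set Z d \<epsilon> H \<and> H \<subseteq> nbhd_of_set Z d \<epsilon> F}"

definition isometric_embedding ::
  "'a set \<Rightarrow> ('a \<Rightarrow> 'a \<Rightarrow> real) \<Rightarrow> 'b set \<Rightarrow> ('b \<Rightarrow> 'b \<Rightarrow> real) \<Rightarrow> ('a \<Rightarrow> 'b) \<Rightarrow> bool" where
  "isometric_embedding X dX Z d f \<longleftrightarrow>
     f ` X \<subseteq> Z \<and> (\<forall>x\<in>X. \<forall>y\<in>X. d (f x) (f y) = dX x y)"

text \<open>
  The ambient metric space ranges over all metric spaces whose carrier is a subset of the type
  \<^typ>\<open>'a + 'b\<close>. This is no restriction: only the images of the two embeddings matter, and their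
  union always injects into this type; see \<open>gromov_hausdorff_dist_le\<close> below, where the ambient
  space has an arbitrary type.
\<close>

definition gromov_hausdorff_dist ::
  "'a set \<Rightarrow> ('a \<Rightarrow> 'a \<Rightarrow> real) \<Rightarrow> 'b set \<Rightarrow> ('b \<Rightarrow> 'b \<Rightarrow> real) \<Rightarrow> ereal" where
  "gromov_hausdorff_dist X dX Y dY =
     Inf {hausdorff_dist Z d (i ` X) (j ` Y) |
            (Z :: ('a + 'b) set) d i j.
            Metric_space Z d \<and> isometric_embedding X dX Z d i \<and> isometric_embedding Y dY Z d j}"

lemma gromov_hausdorff_dist_le:
  fixes Z :: "'c set" and i :: "'a \<Rightarrow> 'c" and j :: "'b \<Rightarrow> 'c"
  assumes Z: "Metric_space Z d"
    and i: "isometric_embedding X dX Z d i" and j: "isometric_embedding Y dY Z d j"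
  shows "gromov_hausdorff_dist X dX Y dY \<le> hausdorff_dist Z d (i ` X) (j ` Y)"
proof -
  interpret Z: Metric_space Z d by (rule Z)
  let ?g = "case_sum i j"
  define h :: "'c \<Rightarrow> 'a + 'b" where "h = inv_into (Inl ` X \<union> Inr ` Y) ?g"
  define Z' where "Z' = h ` (i ` X \<union> j ` Y)"
  define d' where "d' = (\<lambda>u v. d (?g u) (?g v))"
  have img: "?g ` (Inl ` X \<union> Inr ` Y) = i ` X \<union> j ` Y"
    by (force simp: image_Un image_image)
  have gh: "?g (h z) = z" if "z \<in> i ` X \<union> j ` Y" for z
    unfolding h_def by (rule f_inv_into_f) (use that img in blast)
  have sub: "i ` X \<union> j ` Y \<subseteq> Z"
    using i j by (auto simp: isometric_embedding_def)
  have gZ: "?g u \<in> Z \<and> h (?g u) = u" if "u \<in> Z'" for u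
    using that gh sub unfolding Z'_def by auto
  have Z': "Metric_space Z' d'"
  proof
    show "0 \<le> d' x y" for x y by (simp add: d'_def)
    show "d' x y = d' y x" for x y by (simp add: d'_def Z.commute)
    show "d' x y = 0 \<longleftrightarrow> x = y" if "x \<in> Z'" "y \<in> Z'" for x y
      using gZ[OF that(1)] gZ[OF that(2)] unfolding d'_def by (metis Z.zero)
    show "d' x z \<le> d' x y + d' y z" if "x \<in> Z'" "y \<in> Z'" "z \<in> Z'" for x y z
      using that gZ unfolding d'_def by (blast intro: Z.triangle)
  qed
  have i': "isometric_embedding X dX Z' d' (h \<circ> i)" and j': "isometric_embedding Y dY Z' d' (h \<circ> j)"
    using i j gh by (auto simp: isometric_embedding_def Z'_def d'_def)
  have dts: "dist_to_set d' (h x) (h ` F) = dist_to_set d x F"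
    if "x \<in> i ` X \<union> j ` Y" "F \<subseteq> i ` X \<union> j ` Y" for x F
    using that gh unfolding dist_to_set_def d'_def image_image by (intro INF_cong) auto
  have nb: "h ` F \<subseteq> nbhd_of_set Z' d' \<epsilon> (h ` H) \<longleftrightarrow> F \<subseteq> nbhd_of_set Z d \<epsilon> H"
    if "F \<subseteq> i ` X \<union> j ` Y" "H \<subseteq> i ` X \<union> j ` Y" for F H \<epsilon>
  proof -
    have "h x \<in> nbhd_of_set Z' d' \<epsilon> (h ` H) \<longleftrightarrow> x \<in> nbhd_of_set Z d \<epsilon> H" if "x \<in> F" for x
    proof -
      have x: "x \<in> i ` X \<union> j ` Y" using that \<open>F \<subseteq> _\<close> by blast
      have "h x \<in> Z'" "x \<in> Z" using x sub by (auto simp: Z'_def)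
      then show ?thesis using dts[OF x \<open>H \<subseteq> _\<close>] by (simp add: nbhd_of_set_def)
    qed
    then show ?thesis by blast
  qed
  have "hausdorff_dist Z' d' (h ` i ` X) (h ` j ` Y) = hausdorff_dist Z d (i ` X) (j ` Y)"
    unfolding hausdorff_dist_def by (subst (1 2) nb) auto
  then have "hausdorff_dist Z d (i ` X) (j ` Y)
      = hausdorff_dist Z' d' ((h \<circ> i) ` X) ((h \<circ> j) ` Y)"
    by (simp add: image_comp)
  then show ?thesis
    unfolding gromov_hausdorff_dist_def using Z' i' j' by (intro Inf_lower) blast
qed

text \<open>
  Vectors in \<open>\<real>\<^sup>d\<close> are the extensional functions on \<open>{..<d}\<close>, that is, the points of
  \<open>PiM {..<d} (\<lambda>_. borel)\<close>; the dimension has to vary with \<open>n\<close>.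
\<close>

abbreviation borel_vec :: "nat \<Rightarrow> (nat \<Rightarrow> real) measure" where
  "borel_vec d \<equiv> PiM {..<d} (\<lambda>_. borel)"

definition lp_norm :: "real \<Rightarrow> nat \<Rightarrow> (nat \<Rightarrow> real) \<Rightarrow> real" where
  "lp_norm p d x = (\<Sum>i<d. \<bar>x i\<bar> powr p) powr (1 / p)"

definition lp_dist :: "real \<Rightarrow> nat \<Rightarrow> (nat \<Rightarrow> real) \<Rightarrow> (nat \<Rightarrow> real) \<Rightarrow> real" where
  "lp_dist p d x y = lp_norm p d (\<lambda>i. x i - y i)"

definition partial_sum :: "nat \<Rightarrow> (nat \<Rightarrow> 'w \<Rightarrow> nat \<Rightarrow> real) \<Rightarrow> nat \<Rightarrow> 'w \<Rightarrow> nat \<Rightarrow> real" where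
  "partial_sum d X k \<omega> = (\<lambda>i\<in>{..<d}. \<Sum>l=1..k. X l \<omega> i)"

definition scaled_walk_range :: "nat \<Rightarrow> (nat \<Rightarrow> 'w \<Rightarrow> nat \<Rightarrow> real) \<Rightarrow> nat \<Rightarrow> 'w \<Rightarrow> (nat \<Rightarrow> real) set" where
  "scaled_walk_range d X n \<omega> =
     (\<lambda>k. \<lambda>i\<in>{..<d}. real n powr (-1/2) * partial_sum d X k \<omega> i) ` {0..n}"

definition abs_normal_moment :: "real \<Rightarrow> real" where
  "abs_normal_moment p = (\<integral>x. \<bar>x\<bar> powr p \<partial>std_normal_distribution)"

definition covariance :: "'w measure \<Rightarrow> ('w \<Rightarrow> real) \<Rightarrow> ('w \<Rightarrow> real) \<Rightarrow> real" where
  "covariance M X Y =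
     (\<integral>\<omega>. (X \<omega> - (\<integral>\<omega>'. X \<omega>' \<partial>M)) * (Y \<omega> - (\<integral>\<omega>'. Y \<omega>' \<partial>M)) \<partial>M)"

text \<open>
  Convergence to 0 in probability of nonnegative \<open>Y n\<close>, each defined on its own probability
  space \<open>M n\<close>. Measurability is included because \<^const>\<open>measure\<close> is 0 on non-measurable sets.
\<close>

definition tendsto_0_in_prob :: "(nat \<Rightarrow> 'w measure) \<Rightarrow> (nat \<Rightarrow> 'w \<Rightarrow> ereal) \<Rightarrow> bool" where
  "tendsto_0_in_prob M Y \<longleftrightarrow>
     (\<forall>n. Y n \<in> borel_measurable (M n)) \<and>
     (\<forall>\<epsilon>>0. (\<lambda>n. measure (M n) {\<omega> \<in> space (M n). Y n \<omega> > ereal \<epsilon>}) \<longlonglongrightarrow> 0)"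

end

theory Submission
  imports Defs "HOL-Real_Asymp.Real_Asymp"
begin

text \<open>
  Write \<open>X\<^sub>l = d\<^bsup>-1/p\<^esup> (\<xi>\<^bsub>l,1\<^esub>, \<dots>, \<xi>\<^bsub>l,d\<^esub>)\<close> and \<open>T\<^sub>i = k\<^bsup>-1/2\<^esup> \<Sum>\<^sub>l \<xi>\<^bsub>l,i\<^esub>\<close>, the sum running over a block of \<open>k\<close> consecutive
  steps. Then \<open>\<parallel>\<Sum>\<^sub>l X\<^sub>l\<parallel>\<^sub>p\<^sup>p = k\<^bsup>p/2\<^esup> W\<close>, where \<open>W\<close> is the average of \<open>\<bar>T\<^sub>i\<bar>\<^sup>p\<close> over \<open>i\<close>, and the
  point is a law of large numbers for \<open>W\<close>. For \<open>i \<noteq> j\<close> the difference \<open>T\<^sub>i - T\<^sub>j\<close> is a normalised sum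
  of independent centred variables of variance \<open>2\<sigma>\<^sup>2\<close>, because the coordinates are uncorrelated; hence
  \<open>\<bold>E exp (\<i>t(T\<^sub>i - T\<^sub>j))\<close> is close to the squared modulus of the normal characteristic function, and
  the average of \<open>exp (\<i>tT\<^sub>i)\<close> converges in \<open>L\<^sup>2\<close>. So only one-dimensional characteristic functions are
  needed, although the joint law of the coordinates is unknown. Since \<open>\<bar>x\<bar>\<^sup>p\<close> is a polynomial in
  \<open>cos (\<pi>x/A)\<close> up to \<open>\<epsilon> + \<bar>x\<bar>\<^bsup>2p\<^esup>/A\<^sup>p\<close> and the \<open>2p\<close>-th moments of \<open>T\<^sub>i\<close> are bounded, \<open>W\<close> converges in
  \<open>L\<^sup>1\<close>, uniformly over all blocks. Ottaviani's inequality extends this from a finite grid of times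
  to all pairs of times, and the correspondence between \<open>S\<^sub>k\<close> and the times near \<open>k/n\<close> bounds the
  Gromov--Hausdorff distance.
\<close>

section \<open>Gromov--Hausdorff distance and correspondences\<close>

text \<open>The law of large numbers for \<open>W\<close> concerns long blocks only, whereas two
  times of the walk can be close. Short blocks are harmless for another reason: a block of
  \<open>k\<close> steps enters the scaled p-th power with the factor (k/n)^(p/2), and
  \<open>W\<close> is bounded in L^1. This yields one deviation bound for all \<open>k\<close> up to
  \<open>n\<close>. It must be uniform in the starting point too, because Ottaviani's inequality
  asks for a bound on every final piece of a block.

  The passage from p-th powers to norms rests on |u - v|^p being at most |u^p - v^p|, so that L^1
  closeness of the powers and Markov's inequality suffice.

  Measurability of the distance is part of the claim, although the distance is an infimum over all
  ambient spaces. It comes from passing to correspondences in both directions: a correspondence with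
  some slack survives a small motion of the finitely many points, so the sublevel sets are open in
  the space of configurations.\<close>

lemma hausdorff_dist_le:
  assumes "r > 0"
    and "\<And>x. x \<in> F \<Longrightarrow> x \<in> Z \<and> (\<exists>y\<in>H. d x y < r)" "\<And>y. y \<in> H \<Longrightarrow> y \<in> Z \<and> (\<exists>x\<in>F. d y x < r)"
  shows "hausdorff_dist Z d F H \<le> ereal r"
  unfolding hausdorff_dist_def
  using assms by (intro Inf_lower) (force simp: nbhd_of_set_def dist_to_set_def INF_less_iff)

text \<open>The two spaces are glued by a bridge of length \<open>r\<close> between the members of
  each related pair. The distortion bound \<open>2 * r\<close> is what keeps these bridges from
  creating shortcuts inside either space.\<close>

lemma gromov_hausdorff_dist_le_correspondence:
  fixes R :: "('a \<times> 'b) set"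
  assumes X: "Metric_space X dX" and Y: "Metric_space Y dY"
    and fst: "fst ` R = X" and snd: "snd ` R = Y" and "X \<noteq> {}"
    and r: "r > 0"
    and dis: "\<And>x y x' y'. (x, y) \<in> R \<Longrightarrow> (x', y') \<in> R \<Longrightarrow> \<bar>dX x x' - dY y y'\<bar> \<le> 2 * r"
  shows "gromov_hausdorff_dist X dX Y dY \<le> ereal r"
proof (rule ereal_le_epsilon2)
  \<comment> \<open>Related points end up at distance at most \<open>r\<close>, but neighbourhoods
    are defined by a strict inequality; hence the detour through \<open>r + e\<close>.\<close>
  fix e :: real assume e: "e > 0"
  interpret X: Metric_space X dX by (rule X)
  interpret Y: Metric_space Y dY by (rule Y)
  \<comment> \<open>The cheapest route from \<open>x\<close> to \<open>y\<close> through a related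
    pair, not counting the bridge. The bridge length \<open>r\<close> is added in \<open>d\<close>
    and keeps the two copies apart even where \<open>g\<close> is 0.\<close>
  define g where "g x y = (INF (u, v)\<in>R. dX x u + dY v y)" for x y
  define Z where "Z = (Inl ` X \<union> Inr ` Y :: ('a + 'b) set)"
  define d where "d a b = (case a of
      Inl x \<Rightarrow> (case b of Inl x' \<Rightarrow> dX x x' | Inr y \<Rightarrow> g x y + r)
    | Inr y \<Rightarrow> (case b of Inl x \<Rightarrow> g x y + r | Inr y' \<Rightarrow> dY y y'))" for a b
  have R_ne: "R \<noteq> {}" using fst \<open>X \<noteq> {}\<close> by auto
  have RX: "u \<in> X" and RY: "v \<in> Y" if "(u, v) \<in> R" for u v
    using that fst snd by force+
  have bdd: "bdd_below ((\<lambda>(u, v). dX x u + dY v y) ` R)" for x y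
    by (rule bdd_belowI[of _ 0]) (auto intro!: add_nonneg_nonneg)
  have g_le: "g x y \<le> dX x u + dY v y" if "(u, v) \<in> R" for x y u v
    unfolding g_def using cINF_lower[OF bdd that, of x y] by simp
  have g_ge: "c \<le> g x y" if "\<And>u v. (u, v) \<in> R \<Longrightarrow> c \<le> dX x u + dY v y" for c x y
    unfolding g_def using R_ne that by (intro cINF_greatest) auto
  have g_nonneg: "0 \<le> g x y" for x y
    by (rule g_ge) simp
  have g_X: "g x y \<le> dX x x' + g x' y" if "x \<in> X" "x' \<in> X" for x x' y
  proof -
    have "g x y - dX x x' \<le> g x' y"
    proof (rule g_ge)
      fix u v assume uv: "(u, v) \<in> R"
      show "g x y - dX x x' \<le> dX x' u + dY v y"
        using g_le[OF uv, of x y] X.triangle[OF that RX[OF uv]] by simp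
    qed
    then show ?thesis by simp
  qed
  have g_Y: "g x y \<le> g x y' + dY y' y" if "y \<in> Y" "y' \<in> Y" for x y y'
  proof -
    have "g x y - dY y' y \<le> g x y'"
    proof (rule g_ge)
      fix u v assume uv: "(u, v) \<in> R"
      show "g x y - dY y' y \<le> dX x u + dY v y'"
        using g_le[OF uv, of x y] Y.triangle[OF RY[OF uv] that(2,1)] by simp
    qed
    then show ?thesis by simp
  qed
  \<comment> \<open>Here the distortion bound is spent: a detour through the other space crosses two
    bridges, of total length \<open>2 * r\<close>.\<close>
  have XX: "dX x x' \<le> g x y + r + (g x' y + r)" if "x \<in> X" "x' \<in> X" "y \<in> Y" for x x' y
  proof -
    have "dX x x' - g x' y - 2 * r \<le> g x y"
    proof (rule g_ge)
      fix u v assume uv: "(u, v) \<in> R"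
      have "dX x x' - 2 * r - dX x u - dY v y \<le> g x' y"
      proof (rule g_ge)
        fix u' v' assume uv': "(u', v') \<in> R"
        show "dX x x' - 2 * r - dX x u - dY v y \<le> dX x' u' + dY v' y"
          using X.triangle[OF that(1) RX[OF uv] that(2)] X.triangle[OF RX[OF uv] RX[OF uv'] that(2)]
            Y.triangle[OF RY[OF uv] that(3) RY[OF uv']] dis[OF uv uv']
            X.commute[of u' x'] Y.commute[of y v'] by linarith
      qed
      then show "dX x x' - g x' y - 2 * r \<le> dX x u + dY v y" by simp
    qed
    then show ?thesis by simp
  qed
  have YY: "dY y y' \<le> g x y + r + (g x y' + r)" if "y \<in> Y" "y' \<in> Y" "x \<in> X" for x y y'
  proof -
    have "dY y y' - g x y' - 2 * r \<le> g x y"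
    proof (rule g_ge)
      fix u v assume uv: "(u, v) \<in> R"
      have "dY y y' - 2 * r - dX x u - dY v y \<le> g x y'"
      proof (rule g_ge)
        fix u' v' assume uv': "(u', v') \<in> R"
        show "dY y y' - 2 * r - dX x u - dY v y \<le> dX x u' + dY v' y'"
          using Y.triangle[OF that(1) RY[OF uv] that(2)] Y.triangle[OF RY[OF uv] RY[OF uv'] that(2)]
            X.triangle[OF RX[OF uv] that(3) RX[OF uv']] dis[OF uv uv']
            Y.commute[of v y] X.commute[of u x] by linarith
      qed
      then show "dY y y' - g x y' - 2 * r \<le> dX x u + dY v y" by simp
    qed
    then show ?thesis by simp
  qed
  have Z: "Metric_space Z d"
  proof
    show "0 \<le> d a b" for a b
      using r g_nonneg by (auto simp: d_def add_nonneg_nonneg split: sum.splits)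
    show "d a b = d b a" for a b
      by (auto simp: d_def X.commute Y.commute split: sum.splits)
    have "g x y + r \<noteq> 0" for x y using g_nonneg[of x y] r by simp
    then show "d a b = 0 \<longleftrightarrow> a = b" if "a \<in> Z" "b \<in> Z" for a b
      using that by (auto simp: Z_def d_def)
    show "d a c \<le> d a b + d b c" if "a \<in> Z" "b \<in> Z" "c \<in> Z" for a b c
      using that X.triangle Y.triangle XX YY g_X g_Y X.commute Y.commute
      unfolding Z_def by (auto simp: d_def) (smt (verit))+
  qed
  have "gromov_hausdorff_dist X dX Y dY \<le> hausdorff_dist Z d (Inl ` X) (Inr ` Y)"
    by (rule gromov_hausdorff_dist_le[OF Z])
      (auto simp: isometric_embedding_def Z_def d_def)
  also have "\<dots> \<le> ereal (r + e)"
  proof (rule hausdorff_dist_le)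
    have g0: "g u v \<le> 0" if "(u, v) \<in> R" for u v
      using g_le[OF that, of u v] RX[OF that] RY[OF that] by simp
    show "a \<in> Z \<and> (\<exists>b\<in>Inr ` Y. d a b < r + e)" if a: "a \<in> Inl ` X" for a
    proof -
      obtain u v where "(u, v) \<in> R" "a = Inl u" using a fst by force
      then show ?thesis using g0[of u v] RX RY e by (force simp: Z_def d_def)
    qed
    show "a \<in> Z \<and> (\<exists>b\<in>Inl ` X. d a b < r + e)" if a: "a \<in> Inr ` Y" for a
    proof -
      obtain u v where "(u, v) \<in> R" "a = Inr v" using a snd by force
      then show ?thesis using g0[of u v] RX RY e by (force simp: Z_def d_def)
    qed
  qed (use r e in simp)
  finally show "gromov_hausdorff_dist X dX Y dY \<le> ereal r + ereal e" by simp
qed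

text \<open>The converse direction: in an ambient space with Hausdorff distance below
  \<open>t\<close>, relate the points whose images are closer than \<open>e\<close>. That
  \<open>e\<close> stays strictly below \<open>t\<close> provides the slack for the openness
  argument.\<close>

lemma gromov_hausdorff_dist_less_correspondence:
  fixes X :: "'a set" and Y :: "'b set"
  assumes "gromov_hausdorff_dist X dX Y dY < ereal t"
  obtains R e where "e > 0" "e < t" "fst ` R = X" "snd ` R = Y"
    "\<And>x y x' y'. (x, y) \<in> R \<Longrightarrow> (x', y') \<in> R \<Longrightarrow> \<bar>dX x x' - dY y y'\<bar> \<le> 2 * e"
proof -
  obtain Z :: "('a + 'b) set" and d i j where Z: "Metric_space Z d"
    and i: "isometric_embedding X dX Z d i" and j: "isometric_embedding Y dY Z d j"
    and lt: "hausdorff_dist Z d (i ` X) (j ` Y) < ereal t"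
    using assms unfolding gromov_hausdorff_dist_def Inf_less_iff by blast
  interpret Z: Metric_space Z d by (rule Z)
  obtain e where e: "e > 0" "e < t"
    and sub: "i ` X \<subseteq> nbhd_of_set Z d e (j ` Y)" "j ` Y \<subseteq> nbhd_of_set Z d e (i ` X)"
    using lt unfolding hausdorff_dist_def Inf_less_iff by force
  define R where "R = {(x, y) \<in> X \<times> Y. d (i x) (j y) < e}"
  have iZ: "i x \<in> Z" if "x \<in> X" for x using i that by (auto simp: isometric_embedding_def)
  have jZ: "j y \<in> Z" if "y \<in> Y" for y using j that by (auto simp: isometric_embedding_def)
  have "\<exists>y\<in>Y. d (i x) (j y) < e" if "x \<in> X" for x
    using sub(1) that by (fastforce simp: nbhd_of_set_def dist_to_set_def INF_less_iff)
  then have 1: "fst ` R = X" by (force simp: R_def)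
  have "\<exists>x\<in>X. d (i x) (j y) < e" if "y \<in> Y" for y
  proof -
    have "j y \<in> nbhd_of_set Z d e (i ` X)" using sub(2) that by blast
    then show ?thesis
      by (auto simp: nbhd_of_set_def dist_to_set_def INF_less_iff Z.commute)
  qed
  then have 2: "snd ` R = Y" by (force simp: R_def)
  have "\<bar>dX x x' - dY y y'\<bar> \<le> 2 * e" if "(x, y) \<in> R" "(x', y') \<in> R" for x y x' y'
  proof -
    have xy: "x \<in> X" "x' \<in> X" "y \<in> Y" "y' \<in> Y" "d (i x) (j y) < e" "d (i x') (j y') < e"
      using that by (auto simp: R_def)
    have "d (i x) (i x') = dX x x'" "d (j y) (j y') = dY y y'"
      using i j xy by (auto simp: isometric_embedding_def)
    then show ?thesis
      using Z.triangle[of "i x" "j y" "i x'"] Z.triangle[of "j y" "j y'" "i x'"]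
        Z.triangle[of "j y" "i x" "j y'"] Z.triangle[of "i x" "i x'" "j y'"]
        Z.commute xy iZ jZ by (smt (verit))
  qed
  then show thesis using that e 1 2 by blast
qed

section \<open>Finite configurations in the sequence spaces\<close>

lemma lp_norm_nonneg [simp]: "0 \<le> lp_norm p d x"
  by (simp add: lp_norm_def)

lemma lp_norm_powr: "0 < p \<Longrightarrow> lp_norm p d x powr p = (\<Sum>i<d. \<bar>x i\<bar> powr p)"
  by (simp add: lp_norm_def powr_powr sum_nonneg)

lemma lp_norm_cong: "(\<And>i. i < d \<Longrightarrow> x i = y i) \<Longrightarrow> lp_norm p d x = lp_norm p d y"
  by (simp add: lp_norm_def)

lemma lp_norm_minus: "lp_norm p d (\<lambda>i. - x i) = lp_norm p d x"
  by (simp add: lp_norm_def)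

lemma lp_norm_minus_commute: "lp_norm p d (\<lambda>i. x i - y i) = lp_norm p d (\<lambda>i. y i - x i)"
  by (simp add: lp_norm_def abs_minus_commute)

lemma lp_norm_mult: "0 < p \<Longrightarrow> lp_norm p d (\<lambda>i. c * x i) = \<bar>c\<bar> * lp_norm p d x"
  by (simp add: lp_norm_def abs_mult powr_mult powr_powr sum_nonneg flip: sum_distrib_left)

lemma lp_norm_eq_0_iff: "0 < p \<Longrightarrow> lp_norm p d x = 0 \<longleftrightarrow> (\<forall>i<d. x i = 0)"
  by (auto simp: lp_norm_def sum_nonneg_eq_0_iff)

lemma convex_on_powr: "1 \<le> (p::real) \<Longrightarrow> convex_on {0..} (\<lambda>x. x powr p)"
proof (rule convex_onI)
  fix t x y :: real
  assume p: "1 \<le> p" and t: "0 < t" "t < 1" and xy: "x \<in> {0..}" "y \<in> {0..}"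
  have *: "(c * z) powr p \<le> c * z powr p" if "0 < c" "c < 1" "0 \<le> z" for c z :: real
  proof -
    have "c powr p \<le> c powr 1" using p that by (intro powr_mono') auto
    then show ?thesis using that by (simp add: powr_mult mult_right_mono)
  qed
  show "((1 - t) *\<^sub>R x + t *\<^sub>R y) powr p \<le> (1 - t) * x powr p + t * y powr p"
  proof (cases "x = 0 \<or> y = 0")
    case True
    then show ?thesis using *[of t y] *[of "1 - t" x] t xy p by auto
  next
    case False
    then show ?thesis
      using convex_onD[OF powr_convex[OF p], of t x y] t xy by auto
  qed
qed simp

text \<open>Minkowski's inequality directly from convexity of the p-th power: (x + y)/(a + b) is the
  convex combination of the normalised vectors x/a and y/b with weights a/(a + b) and b/(a +
  b).\<close>

lemma lp_norm_triangle:
  assumes "1 \<le> p"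
  shows "lp_norm p d (\<lambda>i. x i + y i) \<le> lp_norm p d x + lp_norm p d y"
proof (cases "lp_norm p d x = 0 \<or> lp_norm p d y = 0")
  case True
  then have "(\<forall>i<d. x i = 0) \<or> (\<forall>i<d. y i = 0)"
    using assms by (simp add: lp_norm_eq_0_iff)
  then show ?thesis
    using lp_norm_cong[of d "\<lambda>i. x i + y i" y p] lp_norm_cong[of d "\<lambda>i. x i + y i" x p]
      lp_norm_nonneg[of p d x] lp_norm_nonneg[of p d y] by auto
next
  case False
  define a b where "a = lp_norm p d x" and "b = lp_norm p d y"
  have ab: "a > 0" "b > 0" using False lp_norm_nonneg[of p d x] lp_norm_nonneg[of p d y]
    unfolding a_def b_def by linarith+
  have *: "\<bar>x i + y i\<bar> powr p \<le> (a + b) powr p *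
      (a / (a + b) * (\<bar>x i\<bar> powr p / a powr p) + b / (a + b) * (\<bar>y i\<bar> powr p / b powr p))" for i
  proof -
    have "\<bar>x i + y i\<bar> powr p \<le> (\<bar>x i\<bar> + \<bar>y i\<bar>) powr p"
      using assms by (intro powr_mono2) auto
    also have "\<bar>x i\<bar> + \<bar>y i\<bar> = (a + b) * (a / (a + b) * (\<bar>x i\<bar> / a) + b / (a + b) * (\<bar>y i\<bar> / b))"
      using ab by (simp add: distrib_left)
    also have "\<dots> powr p = (a + b) powr p * (a / (a + b) * (\<bar>x i\<bar> / a) + b / (a + b) * (\<bar>y i\<bar> / b)) powr p"
      using ab by (simp add: powr_mult)
    also have "(a / (a + b) * (\<bar>x i\<bar> / a) + b / (a + b) * (\<bar>y i\<bar> / b)) powr p \<le>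
        a / (a + b) * (\<bar>x i\<bar> / a) powr p + b / (a + b) * (\<bar>y i\<bar> / b) powr p"
      using convex_onD[OF convex_on_powr[OF assms], of "b / (a + b)" "\<bar>x i\<bar> / a" "\<bar>y i\<bar> / b"] ab
      by (simp add: field_simps)
    finally show ?thesis
      using ab by (simp add: powr_divide mult_left_mono)
  qed
  have "(\<Sum>i<d. \<bar>x i + y i\<bar> powr p) \<le> (\<Sum>i<d. (a + b) powr p *
      (a / (a + b) * (\<bar>x i\<bar> powr p / a powr p) + b / (a + b) * (\<bar>y i\<bar> powr p / b powr p)))"
    by (intro sum_mono *)
  also have "\<dots> = (a + b) powr p * (a / (a + b) * ((\<Sum>i<d. \<bar>x i\<bar> powr p) / a powr p)
      + b / (a + b) * ((\<Sum>i<d. \<bar>y i\<bar> powr p) / b powr p))"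
    by (simp only: sum_distrib_left[symmetric] sum_divide_distrib[symmetric] sum.distrib)
  also have "\<dots> = (a + b) powr p * (a / (a + b) * (a powr p / a powr p) + b / (a + b) * (b powr p / b powr p))"
    using assms unfolding a_def b_def by (simp add: lp_norm_powr)
  also have "\<dots> = (a + b) powr p"
    using ab by (simp add: add_divide_distrib[symmetric])
  finally have "(\<Sum>i<d. \<bar>x i + y i\<bar> powr p) powr (1 / p) \<le> ((a + b) powr p) powr (1 / p)"
    using assms by (intro powr_mono2) (auto intro: sum_nonneg)
  also have "\<dots> = a + b" using assms ab by (simp add: powr_powr)
  finally show ?thesis by (simp add: lp_norm_def a_def b_def)
qed

lemma lp_dist_nonneg [simp]: "0 \<le> lp_dist p d x y"
  by (simp add: lp_dist_def)

lemma lp_dist_commute: "lp_dist p d x y = lp_dist p d y x"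
  unfolding lp_dist_def by (rule lp_norm_minus_commute)

lemma lp_dist_triangle:
  assumes "1 \<le> p"
  shows "lp_dist p d x z \<le> lp_dist p d x y + lp_dist p d y z"
  using lp_norm_triangle[OF assms, of d "\<lambda>i. x i - y i" "\<lambda>i. y i - z i"] by (simp add: lp_dist_def)

lemma Metric_space_lp_dist:
  assumes "1 \<le> p" "S \<subseteq> extensional {..<d}"
  shows "Metric_space S (lp_dist p d)"
proof
  show "lp_dist p d x y = 0 \<longleftrightarrow> x = y" if "x \<in> S" "y \<in> S" for x y
    using that assms by (auto simp: lp_dist_def lp_norm_eq_0_iff intro: extensionalityI)
  show "lp_dist p d x y = lp_dist p d y x" for x y
    by (rule lp_dist_commute)
  show "lp_dist p d x z \<le> lp_dist p d x y + lp_dist p d y z" for x y z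
    by (rule lp_dist_triangle[OF assms(1)])
qed simp

lemma continuous_on_lp_dist_coordinate:
  assumes "0 < p"
  shows "continuous_on UNIV (\<lambda>v::nat \<Rightarrow> nat \<Rightarrow> real. lp_dist p d (v k) w)"
proof -
  have "continuous_on UNIV (\<lambda>v::nat \<Rightarrow> nat \<Rightarrow> real. v k i)" for i
    by (rule continuous_on_product_then_coordinatewise[OF continuous_on_product_coordinates])
  then show ?thesis
    unfolding lp_dist_def lp_norm_def using assms
    by (intro continuous_on_powr' continuous_intros) (auto intro: sum_nonneg)
qed

text \<open>Moving every point by less than \<open>\<eta>\<close> changes each distance by less than
  \<open>2 * \<eta>\<close>, so a correspondence with distortion at most \<open>2 * e\<close>
  becomes one with distortion at most \<open>2 * (e + \<eta>)\<close>, and \<open>e + \<eta>\<close>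
  is still below \<open>t\<close>. A configuration is a point of a product space, whatever the
  dimension, so that openness refers to the product topology.\<close>

lemma open_gromov_hausdorff_dist_less:
  assumes p: "1 \<le> p" and Y: "Metric_space Y dY"
  shows "open {v :: nat \<Rightarrow> nat \<Rightarrow> real.
    gromov_hausdorff_dist ((\<lambda>k. restrict (v k) {..<d}) ` {0..n}) (lp_dist p d) Y dY < ereal t}"
    (is "open ?U")
proof (rule Topological_Spaces.openI)
  fix v assume "v \<in> ?U"
  then obtain R e where e: "e > 0" "e < t"
    and R: "fst ` R = (\<lambda>k. restrict (v k) {..<d}) ` {0..n}" "snd ` R = Y"
    and dis: "\<And>x y x' y'. (x, y) \<in> R \<Longrightarrow> (x', y') \<in> R \<Longrightarrow> \<bar>lp_dist p d x x' - dY y y'\<bar> \<le> 2 * e"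
    by (auto elim: gromov_hausdorff_dist_less_correspondence)
  define \<eta> where "\<eta> = (t - e) / 2"
  have \<eta>: "\<eta> > 0" using e by (simp add: \<eta>_def)
  define V where "V = (\<Inter>k\<in>{0..n}. {w :: nat \<Rightarrow> nat \<Rightarrow> real. lp_dist p d (w k) (v k) < \<eta>})"
  have "open V"
    unfolding V_def using p
    by (intro open_INT ballI open_Collect_less continuous_on_lp_dist_coordinate continuous_on_const) auto
  moreover have "v \<in> V"
    using \<eta> p by (auto simp: V_def lp_dist_def lp_norm_def)
  moreover have "w \<in> ?U" if "w \<in> V" for w
  proof -
    define r where "r u k = restrict (u k) {..<d}" for u :: "nat \<Rightarrow> nat \<Rightarrow> real" and k
    \<comment> \<open>The new correspondence is transported by the index \<open>k\<close> and not by
      the point, since coinciding points of \<open>v\<close> may separate in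
      \<open>w\<close>.\<close>
    define R' where "R' = {(r w k, y) | k y. k \<le> n \<and> (r v k, y) \<in> R}"
    have near: "lp_dist p d (r w k) (r v k) < \<eta>" if "k \<le> n" for k
    proof -
      have "lp_dist p d (r w k) (r v k) = lp_dist p d (w k) (v k)"
        unfolding lp_dist_def r_def by (rule lp_norm_cong) simp
      then show ?thesis using \<open>w \<in> V\<close> that by (simp add: V_def)
    qed
    have R1: "\<exists>y. (r v k, y) \<in> R" if "k \<le> n" for k
    proof -
      have "r v k \<in> fst ` R" using R(1) that by (auto simp: r_def)
      then show ?thesis by force
    qed
    have R2: "\<exists>k\<le>n. x = r v k" if "(x, y) \<in> R" for x y
    proof -
      have "x \<in> fst ` R" using that by force
      then show ?thesis using R(1) by (auto simp: r_def)
    qed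
    have "gromov_hausdorff_dist (r w ` {0..n}) (lp_dist p d) Y dY \<le> ereal (e + \<eta>)"
    proof (rule gromov_hausdorff_dist_le_correspondence[where R = R'])
      show "Metric_space (r w ` {0..n}) (lp_dist p d)"
        by (rule Metric_space_lp_dist[OF p]) (auto simp: r_def)
      show "fst ` R' = r w ` {0..n}"
        using R1 unfolding R'_def by (force simp: image_iff)
      have "snd ` R' = snd ` R"
      proof (intro equalityI subsetI)
        fix y assume "y \<in> snd ` R"
        then obtain x where xy: "(x, y) \<in> R" by force
        then obtain k where "k \<le> n" "x = r v k" using R2 by blast
        then have "(r w k, y) \<in> R'" using xy unfolding R'_def by blast
        then show "y \<in> snd ` R'" by force
      next
        fix y assume "y \<in> snd ` R'"
        then obtain k where "(r v k, y) \<in> R" unfolding R'_def by auto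
        then show "y \<in> snd ` R" by force
      qed
      then show "snd ` R' = Y" using R(2) by simp
      show "\<bar>lp_dist p d x x' - dY y y'\<bar> \<le> 2 * (e + \<eta>)" if xy: "(x, y) \<in> R'" "(x', y') \<in> R'" for x y x' y'
      proof -
        have R'D: "\<exists>k\<le>n. x = r w k \<and> (r v k, y) \<in> R" if "(x, y) \<in> R'" for x y
          using that by (auto simp: R'_def)
        obtain k k' where k: "k \<le> n" "k' \<le> n" "x = r w k" "x' = r w k'" "(r v k, y) \<in> R" "(r v k', y') \<in> R"
          using R'D[OF xy(1)] R'D[OF xy(2)] by blast
        show ?thesis
          using dis[OF k(5,6)] near[OF k(1)] near[OF k(2)]
            lp_dist_triangle[OF p, of d x x' "r v k"] lp_dist_triangle[OF p, of d "r v k" x' "r v k'"]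
            lp_dist_triangle[OF p, of d "r v k" "r v k'" x] lp_dist_triangle[OF p, of d x "r v k'" x']
            lp_dist_commute[of p d "r v k" x] lp_dist_commute[of p d "r v k'" x]
            lp_dist_commute[of p d "r v k'" x']
          unfolding k(3,4) abs_le_iff by argo
      qed
    qed (use Y e \<eta> in auto)
    also have "\<dots> < ereal t" using e by (simp add: \<eta>_def field_simps)
    finally show ?thesis by (simp add: r_def)
  qed
  ultimately show "\<exists>T. open T \<and> v \<in> T \<and> T \<subseteq> ?U" by blast
qed

text \<open>Openness of the real sublevel sets passes to extended levels by unions. A map into a
  countable product of lines is Borel as soon as its coordinates are, so only coordinatewise
  measurability of the configuration remains to be checked.\<close>

lemma borel_measurable_gromov_hausdorff_dist:
  assumes p: "1 \<le> p" and Y: "Metric_space Y dY"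
    and v: "\<And>(k::nat) i. (\<lambda>\<omega>. v \<omega> k i) \<in> borel_measurable M"
  shows "(\<lambda>\<omega>. gromov_hausdorff_dist ((\<lambda>k. restrict (v \<omega> k) {..<d}) ` {0..n}) (lp_dist p d) Y dY)
    \<in> borel_measurable M"
proof -
  let ?G = "\<lambda>v::nat \<Rightarrow> nat \<Rightarrow> real. gromov_hausdorff_dist ((\<lambda>k. restrict (v k) {..<d}) ` {0..n}) (lp_dist p d) Y dY"
  have "?G \<in> borel_measurable borel"
  proof (rule borel_measurableI_less)
    fix y :: ereal
    have "{v. ?G v < y} = (\<Union>z\<in>{z. ereal z < y}. {v. ?G v < ereal z})"
      by (auto dest: ereal_dense2 intro: less_trans)
    also have "open \<dots>"
      by (intro open_UN ballI open_gromov_hausdorff_dist_less p Y)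
    finally show "{v \<in> space borel. ?G v < y} \<in> sets borel" by simp
  qed
  moreover have "v \<in> borel_measurable M"
    by (intro measurable_coordinatewise_then_product v)
  ultimately show ?thesis
    by (rule measurable_compose[rotated])
qed

section \<open>Elementary inequalities\<close>

text \<open>The linear term appears with its sign, so that it vanishes in expectation when
  \<open>x\<close> is centred and independent of \<open>s\<close>. By homogeneity the claim reduces
  to \<open>s = 1\<close> with \<open>u = x / s\<close>; small \<open>u\<close> is a Taylor
  estimate, and for large \<open>u\<close> everything is dominated by |u|^r.\<close>

lemma powr_add_le_Taylor2:
  fixes r :: real
  assumes r: "2 \<le> r"
  obtains C where "C > 0"
    "\<And>s x :: real. \<bar>s + x\<bar> powr r \<le>
      \<bar>s\<bar> powr r + r * (\<bar>s\<bar> powr (r - 1) * sgn s) * x + C * (\<bar>s\<bar> powr (r - 2) * x\<^sup>2 + \<bar>x\<bar> powr r)"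
proof -
  \<comment> \<open>The summands serve, in this order, the case \<open>s = 0\<close>, the range |u|
    at most 1/2, and the range |u| above 1/2.\<close>
  define C where "C = 1 + r\<^sup>2 * exp r + 3 powr r + r * 2 powr r"
  have C: "C \<ge> 1" "C \<ge> r\<^sup>2 * exp r" "C \<ge> 3 powr r + r * 2 powr r"
    using r by (auto simp: C_def)
  have unit: "\<bar>1 + u\<bar> powr r \<le> 1 + r * u + C * (u\<^sup>2 + \<bar>u\<bar> powr r)" for u :: real
  proof (cases "\<bar>u\<bar> \<le> 1 / 2")
    case True
    obtain t where t: "\<bar>t\<bar> \<le> \<bar>r * u\<bar>"
      and exp: "exp (r * u) = (\<Sum>m<2. (r * u) ^ m / fact m) + exp t / fact 2 * (r * u)\<^sup>2"
      using Maclaurin_exp_le[of "r * u" 2] by blast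
    have tr: "t \<le> r"
    proof -
      have "\<bar>r * u\<bar> \<le> r * 1" unfolding abs_mult using True r by (intro mult_mono) auto
      then show ?thesis using t by linarith
    qed
    have "\<bar>1 + u\<bar> powr r = exp (r * ln (1 + u))"
      using True by (simp add: powr_def)
    also have "\<dots> \<le> exp (r * u)"
      using True r ln_add_one_self_le_self2[of u] by (simp add: mult_left_mono)
    also have "\<dots> = 1 + r * u + exp t / 2 * (r\<^sup>2 * u\<^sup>2)"
      unfolding exp by (simp add: numeral_2_eq_2 power_mult_distrib)
    also have "exp t / 2 * (r\<^sup>2 * u\<^sup>2) \<le> exp r * (r\<^sup>2 * u\<^sup>2)"
    proof (rule mult_right_mono)
      have "exp t \<le> exp r" "0 < exp r" using tr by auto
      then show "exp t / 2 \<le> exp r" by linarith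
    qed simp
    also have "exp r * (r\<^sup>2 * u\<^sup>2) \<le> C * u\<^sup>2"
      using mult_right_mono[OF C(2), of "u\<^sup>2"] by (simp add: mult_ac)
    also have "C * u\<^sup>2 \<le> C * (u\<^sup>2 + \<bar>u\<bar> powr r)"
      using C(1) by (intro mult_left_mono) auto
    finally show ?thesis by simp
  next
    case False
    have "\<bar>1 + u\<bar> powr r \<le> (3 * \<bar>u\<bar>) powr r"
      using False r by (intro powr_mono2) auto
    also have "\<dots> = 3 powr r * \<bar>u\<bar> powr r" by (simp add: powr_mult)
    finally have 1: "\<bar>1 + u\<bar> powr r \<le> 3 powr r * \<bar>u\<bar> powr r" .
    have "1 \<le> (2 * \<bar>u\<bar>) powr (r - 1)"
      using False r by (intro ge_one_powr_ge_zero) auto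
    then have "\<bar>u\<bar> * 1 \<le> \<bar>u\<bar> * (2 * \<bar>u\<bar>) powr (r - 1)" by (intro mult_left_mono) auto
    also have "\<dots> \<le> 2 * \<bar>u\<bar> * (2 * \<bar>u\<bar>) powr (r - 1)" by simp
    also have "\<dots> = (2 * \<bar>u\<bar>) powr r"
      using False by (subst powr_diff) auto
    also have "\<dots> = 2 powr r * \<bar>u\<bar> powr r" by (simp add: powr_mult)
    finally have "r * \<bar>u\<bar> \<le> r * (2 powr r * \<bar>u\<bar> powr r)" using r by (intro mult_left_mono) auto
    moreover have "- (r * u) \<le> r * \<bar>u\<bar>" using r abs_ge_minus_self[of "r * u"] by (simp add: abs_mult)
    ultimately have "\<bar>1 + u\<bar> powr r - r * u \<le> (3 powr r + r * 2 powr r) * \<bar>u\<bar> powr r"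
      using 1 by (simp add: distrib_right)
    also have "\<dots> \<le> C * \<bar>u\<bar> powr r" using C(3) by (intro mult_right_mono) auto
    also have "\<dots> \<le> C * (u\<^sup>2 + \<bar>u\<bar> powr r)" using C(1) by (intro mult_left_mono) auto
    finally show ?thesis by simp
  qed
  show thesis
  proof (rule that)
    show "C > 0" using C by simp
    show "\<bar>s + x\<bar> powr r \<le>
      \<bar>s\<bar> powr r + r * (\<bar>s\<bar> powr (r - 1) * sgn s) * x + C * (\<bar>s\<bar> powr (r - 2) * x\<^sup>2 + \<bar>x\<bar> powr r)"
      for s x :: real
    proof (cases "s = 0")
      case True
      then show ?thesis using mult_right_mono[OF C(1), of "\<bar>x\<bar> powr r"] by simp
    next
      case False
      have "\<bar>s + x\<bar> powr r = \<bar>s\<bar> powr r * \<bar>1 + x / s\<bar> powr r"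
        using False by (simp add: powr_mult[symmetric] abs_mult[symmetric] distrib_left)
      also have "\<dots> \<le> \<bar>s\<bar> powr r * (1 + r * (x / s) + C * ((x / s)\<^sup>2 + \<bar>x / s\<bar> powr r))"
        by (intro mult_left_mono unit) auto
      also have "\<dots> = \<bar>s\<bar> powr r + r * (\<bar>s\<bar> powr r / s) * x
          + C * (\<bar>s\<bar> powr r / s\<^sup>2 * x\<^sup>2 + \<bar>s\<bar> powr r * \<bar>x / s\<bar> powr r)"
        by (simp add: algebra_simps power_divide)
      also have "\<bar>s\<bar> powr r / s = \<bar>s\<bar> powr (r - 1) * sgn s"
        using False by (subst powr_diff) (auto simp: sgn_if)
      also have "\<bar>s\<bar> powr r / s\<^sup>2 = \<bar>s\<bar> powr (r - 2)"
        using False by (subst powr_diff) (auto simp: powr_numeral)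
      also have "\<bar>s\<bar> powr r * \<bar>x / s\<bar> powr r = \<bar>x\<bar> powr r"
        using False by (simp add: powr_divide)
      finally show ?thesis .
    qed
  qed
qed

text \<open>Below the threshold \<open>c\<close> the first summand suffices; above it, the factor
  x^(-2) is at most c^(-2). The threshold is free and is later adapted to the number of
  summands.\<close>

lemma powr_minus_two_le:
  fixes x c r :: real
  assumes "2 \<le> r" "0 < c" "0 \<le> x"
  shows "x powr (r - 2) \<le> c powr (r - 2) + x powr r / c\<^sup>2"
proof (cases "x \<le> c")
  case True
  then show ?thesis
    using assms powr_mono2[of "r - 2" x c] by (simp add: add_increasing2)
next
  case False
  have "x powr (r - 2) = x powr r / x\<^sup>2"
    using False assms by (subst powr_diff) (auto simp: powr_numeral)
  also have "\<dots> \<le> x powr r / c\<^sup>2"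
    using False assms by (intro divide_left_mono power_mono) auto
  finally show ?thesis by (simp add: add_increasing)
qed

text \<open>Superadditivity of the p-th power on the half-line. It turns closeness of p-th powers
  into closeness of norms without a lower bound on the norms, where a derivative of the p-th root
  would blow up.\<close>

lemma powr_abs_diff_le:
  fixes u v p :: real
  assumes "1 \<le> p" "0 \<le> u" "0 \<le> v"
  shows "\<bar>u - v\<bar> powr p \<le> \<bar>u powr p - v powr p\<bar>"
proof -
  have *: "(u - v) powr p \<le> u powr p - v powr p" if "0 \<le> v" "v \<le> u" for u v :: real
  proof (cases "u = 0")
    case False
    then have u: "u > 0" using that by simp
    have "((u - v) / u) powr p + (v / u) powr p \<le> ((u - v) / u) powr 1 + (v / u) powr 1"
      using assms(1) that u by (intro add_mono powr_mono') auto
    also have "\<dots> = 1" using that u by (simp add: diff_divide_distrib)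
    finally have "(u - v) powr p / u powr p + v powr p / u powr p \<le> 1"
      using that u by (simp add: powr_divide)
    then show ?thesis using u by (simp add: field_simps)
  qed (use that in simp)
  show ?thesis
  proof (cases "v \<le> u")
    case True
    then show ?thesis using *[of v u] assms powr_mono2[of p v u] by simp
  next
    case False
    then show ?thesis using *[of u v] assms powr_mono2[of p u v] by simp
  qed
qed

text \<open>|a - b| is at most twice the larger of |a| and |b|, and the truncated cube is monotone
  in the modulus. The right side separates \<open>a\<close> from \<open>b\<close>, so in expectation
  it depends on the marginal laws only.\<close>

lemma min_square_cube_diff_le:
  fixes a b t :: real
  shows "min (6 * (a - b)\<^sup>2) (\<bar>t\<bar> * \<bar>a - b\<bar> ^ 3) \<le>
    min (6 * (2 * a)\<^sup>2) (\<bar>t\<bar> * \<bar>2 * a\<bar> ^ 3) + min (6 * (2 * b)\<^sup>2) (\<bar>t\<bar> * \<bar>2 * b\<bar> ^ 3)"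
proof -
  define h where "h y = min (6 * y\<^sup>2) (\<bar>t\<bar> * \<bar>y\<bar> ^ 3)" for y
  have mono: "h y \<le> h z" if "\<bar>y\<bar> \<le> \<bar>z\<bar>" for y z
  proof -
    have "y\<^sup>2 \<le> z\<^sup>2" "\<bar>y\<bar> ^ 3 \<le> \<bar>z\<bar> ^ 3"
      using that by (simp_all add: abs_le_square_iff[symmetric] power_mono)
    then show ?thesis unfolding h_def by (intro min.mono mult_left_mono) auto
  qed
  have nonneg: "0 \<le> h y" for y by (simp add: h_def)
  have "\<bar>a - b\<bar> \<le> \<bar>2 * a\<bar> \<or> \<bar>a - b\<bar> \<le> \<bar>2 * b\<bar>" by linarith
  then have "h (a - b) \<le> h (2 * a) + h (2 * b)"
    using mono nonneg by (metis add_increasing add_increasing2)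
  then show ?thesis by (simp add: h_def)
qed

lemma abs_exp_minus_Taylor2:
  fixes x :: real
  assumes "0 \<le> x"
  shows "\<bar>exp (- x) - (1 - x)\<bar> \<le> x\<^sup>2 / 2"
proof -
  obtain t where exp: "exp (- x) = (\<Sum>m<3. (- x) ^ m / fact m) + exp t / fact 3 * (- x) ^ 3"
    using Maclaurin_exp_le[of "- x" 3] by blast
  have "exp t / fact 3 * (- x) ^ 3 \<le> 0"
    using assms by (intro mult_nonneg_nonpos) auto
  then have "exp (- x) \<le> 1 - x + x\<^sup>2 / 2"
    unfolding exp by (simp add: numeral_3_eq_3 power2_eq_square)
  moreover have "exp (- x) \<ge> 1 - x" using exp_ge_add_one_self[of "- x"] by simp
  ultimately show ?thesis by simp
qed

text \<open>\<open>H (cos (pi / A * x))\<close> is the p-th power of the distance from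
  \<open>x\<close> to the multiples of \<open>2 * A\<close>. It agrees with |x|^p for |x| at most
  \<open>A\<close>; beyond, both functions lie between 0 and |x|^p, which is at most |x|^(2p) / A^p
  there. The polynomial comes from the Weierstrass theorem applied to \<open>H\<close>.\<close>

lemma powr_cosine_approximation:
  fixes p A e :: real
  assumes p: "0 < p" and A: "0 < A" and e: "0 < e"
  obtains a :: "nat \<Rightarrow> real" and m :: nat where
    "\<And>x. \<bar>\<bar>x\<bar> powr p - (\<Sum>i\<le>m. a i * cos (pi / A * x) ^ i)\<bar> \<le> e + \<bar>x\<bar> powr (2 * p) / A powr p"
proof -
  define H where "H y = (A / pi * arccos y) powr p" for y
  have "continuous_on {-1..1} H"
    unfolding H_def using p A
    by (intro continuous_on_powr' continuous_intros continuous_on_arccos')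
      (auto intro!: divide_nonneg_nonneg mult_nonneg_nonneg arccos_lbound)
  then obtain g where "real_polynomial_function g" and g: "\<And>y. y \<in> {-1..1} \<Longrightarrow> \<bar>H y - g y\<bar> < e"
    using Stone_Weierstrass_real_polynomial_function[of "{-1..1::real}" H e] e by auto
  then obtain a m where g_eq: "g = (\<lambda>y. \<Sum>i\<le>m. a i * y ^ i)"
    unfolding real_polynomial_function_iff_sum by blast
  show thesis
  proof (rule that)
    fix x
    have close: "\<bar>H (cos (pi / A * x)) - g (cos (pi / A * x))\<bar> \<le> e"
      by (rule less_imp_le, rule g) auto
    have "\<bar>\<bar>x\<bar> powr p - H (cos (pi / A * x))\<bar> \<le> \<bar>x\<bar> powr (2 * p) / A powr p"
    proof (cases "\<bar>x\<bar> \<le> A")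
      case True
      have "cos (pi / A * x) = cos (pi / A * \<bar>x\<bar>)"
        by (metis abs_real_def cos_minus mult_minus_right)
      moreover have "arccos (cos (pi / A * \<bar>x\<bar>)) = pi / A * \<bar>x\<bar>"
        using True A by (intro arccos_cos) (auto simp: field_simps)
      ultimately show ?thesis using A by (simp add: H_def)
    next
      case False
      have "0 \<le> H (cos (pi / A * x))" "H (cos (pi / A * x)) \<le> A powr p"
      proof -
        have "A / pi * arccos (cos (pi / A * x)) \<le> A / pi * pi"
          using A by (intro mult_left_mono arccos_ubound) auto
        then show "H (cos (pi / A * x)) \<le> A powr p"
          unfolding H_def using A p by (intro powr_mono2) (auto intro!: divide_nonneg_nonneg mult_nonneg_nonneg arccos_lbound)
      qed (simp add: H_def)
      moreover have "A powr p \<le> \<bar>x\<bar> powr p"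
        using False A p by (intro powr_mono2) auto
      moreover have "\<bar>x\<bar> powr p \<le> \<bar>x\<bar> powr (2 * p) / A powr p"
      proof -
        have "\<bar>x\<bar> powr p * A powr p \<le> \<bar>x\<bar> powr p * \<bar>x\<bar> powr p"
          using False A p by (intro mult_left_mono powr_mono2) auto
        also have "\<dots> = \<bar>x\<bar> powr (2 * p)" by (simp flip: powr_add)
        finally show ?thesis using A by (simp add: field_simps)
      qed
      ultimately show ?thesis by linarith
    qed
    then show "\<bar>\<bar>x\<bar> powr p - (\<Sum>i\<le>m. a i * cos (pi / A * x) ^ i)\<bar> \<le> e + \<bar>x\<bar> powr (2 * p) / A powr p"
      using close unfolding g_eq by linarith
  qed
qed

section \<open>Sums of independent random variables\<close>

lemma (in finite_measure) integrable_powr_le: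
  fixes f :: "'a \<Rightarrow> real"
  assumes [measurable]: "f \<in> borel_measurable M"
    and int: "integrable M (\<lambda>x. \<bar>f x\<bar> powr r)" and q: "0 \<le> q" "q \<le> r"
  shows "integrable M (\<lambda>x. \<bar>f x\<bar> powr q)"
proof (rule Bochner_Integration.integrable_bound)
  show "integrable M (\<lambda>x. 1 + \<bar>f x\<bar> powr r)" using int by simp
  have "\<bar>f x\<bar> powr q \<le> 1 + \<bar>f x\<bar> powr r" for x
  proof (cases "\<bar>f x\<bar> \<le> 1")
    case True
    then have "\<bar>f x\<bar> powr q \<le> 1" using q powr_le1 by simp
    then show ?thesis by (simp add: add_increasing2)
  next
    case False
    then have "\<bar>f x\<bar> powr q \<le> \<bar>f x\<bar> powr r" using q by (intro powr_mono) auto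
    then show ?thesis by simp
  qed
  then show "AE x in M. norm (\<bar>f x\<bar> powr q) \<le> norm (1 + \<bar>f x\<bar> powr r)"
    by (simp add: abs_of_nonneg add_nonneg_nonneg)
qed simp

lemma abs_powr_two: "\<bar>x::real\<bar> powr 2 = x\<^sup>2"
  by (cases "x = 0") (auto simp: powr_numeral)

lemma (in finite_measure)
  fixes f :: "'a \<Rightarrow> real"
  assumes [measurable]: "f \<in> borel_measurable M"
    and int: "integrable M (\<lambda>x. \<bar>f x\<bar> powr r)" and r: "2 \<le> r"
  shows integrable_of_powr: "integrable M f"
    and integrable_square_of_powr: "integrable M (\<lambda>x. (f x)\<^sup>2)"
proof -
  have "integrable M (\<lambda>x. \<bar>f x\<bar> powr 1)"
    by (rule integrable_powr_le[OF _ int]) (use r in auto)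
  then have "integrable M (\<lambda>x. \<bar>f x\<bar>)" by simp
  then show "integrable M f" by (subst (asm) integrable_abs_iff) auto
  have "integrable M (\<lambda>x. \<bar>f x\<bar> powr 2)"
    by (rule integrable_powr_le[OF _ int]) (use r in auto)
  then show "integrable M (\<lambda>x. (f x)\<^sup>2)" by (simp add: abs_powr_two)
qed

text \<open>Independence and centring kill the linear term of the Taylor bound and factorise the
  quadratic one, so one more summand costs only a multiple of the moment of order
  \<open>r - 2\<close> of \<open>S\<close>. The constant \<open>C\<close> comes in through the
  hypothesis \<open>Taylor\<close> because it must be the same on all probability spaces.\<close>

lemma (in prob_space)
  fixes S x :: "'a \<Rightarrow> real"
  assumes Taylor: "\<And>s x :: real. \<bar>s + x\<bar> powr r \<le>
      \<bar>s\<bar> powr r + r * (\<bar>s\<bar> powr (r - 1) * sgn s) * x + C * (\<bar>s\<bar> powr (r - 2) * x\<^sup>2 + \<bar>x\<bar> powr r)"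
    and r: "2 \<le> r" and indep: "indep_var borel x borel S"
    and S: "integrable M (\<lambda>\<omega>. \<bar>S \<omega>\<bar> powr r)" and x: "integrable M (\<lambda>\<omega>. \<bar>x \<omega>\<bar> powr r)"
    and mean: "expectation x = 0"
  shows integrable_powr_add_indep: "integrable M (\<lambda>\<omega>. \<bar>S \<omega> + x \<omega>\<bar> powr r)"
    and expectation_powr_add_indep: "expectation (\<lambda>\<omega>. \<bar>S \<omega> + x \<omega>\<bar> powr r) \<le>
      expectation (\<lambda>\<omega>. \<bar>S \<omega>\<bar> powr r) +
      C * (expectation (\<lambda>\<omega>. \<bar>S \<omega>\<bar> powr (r - 2)) * expectation (\<lambda>\<omega>. (x \<omega>)\<^sup>2)
        + expectation (\<lambda>\<omega>. \<bar>x \<omega>\<bar> powr r))"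
proof -
  have [measurable]: "S \<in> borel_measurable M" "x \<in> borel_measurable M"
    using indep_var_rv1[OF indep] indep_var_rv2[OF indep] by auto
  define g where "g s = \<bar>s\<bar> powr (r - 1) * sgn s" for s :: real
  have [measurable]: "g \<in> borel_measurable borel" unfolding g_def by measurable
  have "integrable M (\<lambda>\<omega>. \<bar>S \<omega>\<bar> powr (r - 1))"
    by (rule integrable_powr_le[OF _ S]) (use r in auto)
  then have gS: "integrable M (\<lambda>\<omega>. g (S \<omega>))"
    by (rule Bochner_Integration.integrable_bound) (auto simp: g_def abs_mult sgn_if)
  have S2: "integrable M (\<lambda>\<omega>. \<bar>S \<omega>\<bar> powr (r - 2))"
    by (rule integrable_powr_le[OF _ S]) (use r in auto)
  have x1: "integrable M x" and x2: "integrable M (\<lambda>\<omega>. (x \<omega>)\<^sup>2)"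
    using integrable_of_powr[OF _ x r] integrable_square_of_powr[OF _ x r] by auto
  have i1: "indep_var borel x borel (\<lambda>\<omega>. g (S \<omega>))"
    using indep_var_compose[OF indep, of "\<lambda>x. x" borel g borel] by (simp add: comp_def)
  have i2: "indep_var borel (\<lambda>\<omega>. (x \<omega>)\<^sup>2) borel (\<lambda>\<omega>. \<bar>S \<omega>\<bar> powr (r - 2))"
    using indep_var_compose[OF indep, of "\<lambda>x. x\<^sup>2" borel "\<lambda>s. \<bar>s\<bar> powr (r - 2)" borel]
    by (simp add: comp_def)
  have int1: "integrable M (\<lambda>\<omega>. g (S \<omega>) * x \<omega>)"
    and eq1: "expectation (\<lambda>\<omega>. g (S \<omega>) * x \<omega>) = 0"
    using indep_var_integrable[OF i1 x1 gS] indep_var_lebesgue_integral[OF i1 x1 gS] mean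
    by (auto simp: mult.commute)
  have int2: "integrable M (\<lambda>\<omega>. \<bar>S \<omega>\<bar> powr (r - 2) * (x \<omega>)\<^sup>2)"
    and eq2: "expectation (\<lambda>\<omega>. \<bar>S \<omega>\<bar> powr (r - 2) * (x \<omega>)\<^sup>2) =
      expectation (\<lambda>\<omega>. \<bar>S \<omega>\<bar> powr (r - 2)) * expectation (\<lambda>\<omega>. (x \<omega>)\<^sup>2)"
    using indep_var_integrable[OF i2 x2 S2] indep_var_lebesgue_integral[OF i2 x2 S2]
    by (auto simp: mult.commute)
  let ?U = "\<lambda>\<omega>. \<bar>S \<omega>\<bar> powr r + r * (g (S \<omega>) * x \<omega>) + C * (\<bar>S \<omega>\<bar> powr (r - 2) * (x \<omega>)\<^sup>2 + \<bar>x \<omega>\<bar> powr r)"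
  have U: "integrable M ?U" using S x int1 int2 by simp
  have le: "\<bar>S \<omega> + x \<omega>\<bar> powr r \<le> ?U \<omega>" for \<omega>
    using Taylor[of "S \<omega>" "x \<omega>"] by (simp add: g_def mult.assoc)
  show I: "integrable M (\<lambda>\<omega>. \<bar>S \<omega> + x \<omega>\<bar> powr r)"
  proof (rule Bochner_Integration.integrable_bound[OF U])
    have "norm (\<bar>S \<omega> + x \<omega>\<bar> powr r) \<le> norm (?U \<omega>)" for \<omega>
      using le[of \<omega>] by (simp add: abs_of_nonneg)
    then show "AE \<omega> in M. norm (\<bar>S \<omega> + x \<omega>\<bar> powr r) \<le> norm (?U \<omega>)" by simp
  qed simp
  have "expectation (\<lambda>\<omega>. \<bar>S \<omega> + x \<omega>\<bar> powr r) \<le> expectation ?U"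
    by (rule integral_mono[OF I U le])
  also have "\<dots> = expectation (\<lambda>\<omega>. \<bar>S \<omega>\<bar> powr r) +
      C * (expectation (\<lambda>\<omega>. \<bar>S \<omega>\<bar> powr (r - 2)) * expectation (\<lambda>\<omega>. (x \<omega>)\<^sup>2)
        + expectation (\<lambda>\<omega>. \<bar>x \<omega>\<bar> powr r))"
    using S x int1 int2 by (simp add: eq1 eq2)
  finally show "expectation (\<lambda>\<omega>. \<bar>S \<omega> + x \<omega>\<bar> powr r) \<le> expectation (\<lambda>\<omega>. \<bar>S \<omega>\<bar> powr r) +
      C * (expectation (\<lambda>\<omega>. \<bar>S \<omega>\<bar> powr (r - 2)) * expectation (\<lambda>\<omega>. (x \<omega>)\<^sup>2)
        + expectation (\<lambda>\<omega>. \<bar>x \<omega>\<bar> powr r))" .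
qed

text \<open>A crude Bernoulli inequality. With \<open>q = r / 2\<close> it says that the bound
  k^(r/2) grows enough from \<open>k\<close> to \<open>Suc k\<close> to pay for one more
  summand.\<close>

lemma powr_Suc_ge:
  fixes q :: real
  assumes "1 \<le> q" "0 < k"
  shows "real k powr q + real k powr (q - 1) \<le> real (Suc k) powr q"
proof -
  have "1 + 1 / real k \<le> (1 + 1 / real k) powr q"
    using powr_mono[of 1 q "1 + 1 / real k"] assms by simp
  then have "real k powr q * (1 + 1 / real k) \<le> real k powr q * (1 + 1 / real k) powr q"
    by (rule mult_left_mono) simp
  also have "\<dots> = (real k * (1 + 1 / real k)) powr q"
    using assms by (simp add: powr_mult)
  also have "real k * (1 + 1 / real k) = real (Suc k)" using assms by (simp add: field_simps)
  finally show ?thesis using assms by (simp add: distrib_left powr_diff)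
qed

text \<open>An inequality of Rosenthal type. The order of the quantifiers matters: \<open>B\<close>
  depends on \<open>r\<close>, \<open>v\<close> and \<open>m\<close> only, which makes everything
  built on it uniform over dimensions, coordinates and blocks.\<close>

lemma moment_sum_indep_bound:
  fixes r v m :: real
  assumes r: "2 \<le> r" and v: "0 \<le> v" and m: "0 \<le> m"
  obtains B where "B > 0"
    "\<And>(M :: 'a measure) (\<xi> :: 'i \<Rightarrow> 'a \<Rightarrow> real) I.
      prob_space M \<Longrightarrow> finite I \<Longrightarrow> prob_space.indep_vars M (\<lambda>_. borel) \<xi> I \<Longrightarrow>
      (\<And>i. i \<in> I \<Longrightarrow> integrable M (\<lambda>\<omega>. \<bar>\<xi> i \<omega>\<bar> powr r)) \<Longrightarrow>
      (\<And>i. i \<in> I \<Longrightarrow> (\<integral>\<omega>. \<xi> i \<omega> \<partial>M) = 0) \<Longrightarrow>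
      (\<And>i. i \<in> I \<Longrightarrow> (\<integral>\<omega>. (\<xi> i \<omega>)\<^sup>2 \<partial>M) \<le> v) \<Longrightarrow>
      (\<And>i. i \<in> I \<Longrightarrow> (\<integral>\<omega>. \<bar>\<xi> i \<omega>\<bar> powr r \<partial>M) \<le> m) \<Longrightarrow>
      integrable M (\<lambda>\<omega>. \<bar>\<Sum>i\<in>I. \<xi> i \<omega>\<bar> powr r) \<and>
      (\<integral>\<omega>. \<bar>\<Sum>i\<in>I. \<xi> i \<omega>\<bar> powr r \<partial>M) \<le> B * real (card I) powr (r / 2)"
proof -
  obtain C where C: "C > 0" and Taylor: "\<And>s x :: real. \<bar>s + x\<bar> powr r \<le>
      \<bar>s\<bar> powr r + r * (\<bar>s\<bar> powr (r - 1) * sgn s) * x + C * (\<bar>s\<bar> powr (r - 2) * x\<^sup>2 + \<bar>x\<bar> powr r)"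
    using powr_add_le_Taylor2[OF r] by blast
  \<comment> \<open>\<open>L\<close> is so large that the induction hypothesis, fed back through the
    moment of order \<open>r - 2\<close>, returns with a factor at most 1/2. \<open>B\<close> is so
    large that the remaining terms \<open>D\<close> fit into the other half and that a single
    summand is covered.\<close>
  define L where "L = 2 * C * v + 1"
  define D where "D = C * v * L powr (r / 2 - 1) + C * m"
  define B where "B = 2 * D + m + 1"
  have L: "L > 0" using C v by (simp add: L_def add_nonneg_pos)
  have CvL: "C * v / L \<le> 1 / 2" using L by (simp add: L_def field_simps)
  have "D \<ge> 0" using C v m by (simp add: D_def)
  then have B: "B > 0" "m \<le> B" "C * v * L powr (r / 2 - 1) + C * m \<le> B / 2"
    using m unfolding B_def D_def[symmetric] by auto
  \<comment> \<open>The induction over the number \<open>k\<close> of summands closes because the term \<open>\<bold>E\<bar>S\<^sub>k\<bar>\<^bsup>r-2\<^esup>\<close> is split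
    by Young's inequality at the natural scale \<open>\<surd>(Lk)\<close>.\<close>
  show thesis
  proof (rule that[OF B(1)])
    fix M :: "'a measure" and \<xi> :: "'i \<Rightarrow> 'a \<Rightarrow> real" and I
    assume "prob_space M"
    then interpret prob_space M .
    assume "finite I" and "indep_vars (\<lambda>_. borel) \<xi> I"
      "\<And>i. i \<in> I \<Longrightarrow> integrable M (\<lambda>\<omega>. \<bar>\<xi> i \<omega>\<bar> powr r)" "\<And>i. i \<in> I \<Longrightarrow> expectation (\<xi> i) = 0"
      "\<And>i. i \<in> I \<Longrightarrow> expectation (\<lambda>\<omega>. (\<xi> i \<omega>)\<^sup>2) \<le> v"
      "\<And>i. i \<in> I \<Longrightarrow> expectation (\<lambda>\<omega>. \<bar>\<xi> i \<omega>\<bar> powr r) \<le> m"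
    then show "integrable M (\<lambda>\<omega>. \<bar>\<Sum>i\<in>I. \<xi> i \<omega>\<bar> powr r) \<and>
      expectation (\<lambda>\<omega>. \<bar>\<Sum>i\<in>I. \<xi> i \<omega>\<bar> powr r) \<le> B * real (card I) powr (r / 2)"
    proof (induction I)
      case (insert i I)
      define S where "S \<omega> = (\<Sum>i\<in>I. \<xi> i \<omega>)" for \<omega>
      have [measurable]: "\<xi> j \<in> borel_measurable M" if "j \<in> insert i I" for j
        using insert.prems(1) that unfolding indep_vars_def by auto
      have [measurable]: "S \<in> borel_measurable M" unfolding S_def by measurable
      have IH: "integrable M (\<lambda>\<omega>. \<bar>S \<omega>\<bar> powr r)"
        "expectation (\<lambda>\<omega>. \<bar>S \<omega>\<bar> powr r) \<le> B * real (card I) powr (r / 2)"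
        using insert.IH[OF indep_vars_subset[OF insert.prems(1)]] insert.prems unfolding S_def by auto
      have ind: "indep_var borel (\<xi> i) borel S"
        unfolding S_def by (rule indep_vars_sum[OF insert.hyps(1,2) insert.prems(1)])
      note step = integrable_powr_add_indep[OF Taylor r ind IH(1) insert.prems(2,3)[of i], simplified]
        expectation_powr_add_indep[OF Taylor r ind IH(1) insert.prems(2,3)[of i], simplified]
      have sum_eq: "(\<Sum>j\<in>insert i I. \<xi> j \<omega>) = S \<omega> + \<xi> i \<omega>" for \<omega>
        using insert.hyps by (simp add: S_def)
      have "expectation (\<lambda>\<omega>. \<bar>S \<omega> + \<xi> i \<omega>\<bar> powr r) \<le> B * real (card (insert i I)) powr (r / 2)"
      proof (cases "I = {}")
        \<comment> \<open>The first summand is separate, because the scale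
          \<open>sqrt (L * k)\<close> degenerates at \<open>k = 0\<close>.\<close>
        case True
        then have "expectation (\<lambda>\<omega>. \<bar>S \<omega> + \<xi> i \<omega>\<bar> powr r) \<le> m"
          using insert.prems(5)[of i] by (simp add: S_def)
        then show ?thesis using True B(2) by simp
      next
        case False
        define k where "k = card I"
        have k: "k > 0" using False insert.hyps by (simp add: k_def card_gt_0_iff)
        have S2: "integrable M (\<lambda>\<omega>. \<bar>S \<omega>\<bar> powr (r - 2))"
          by (rule integrable_powr_le[OF _ IH(1)]) (use r in auto)
        have Lk: "0 < sqrt (L * k)" using L k by simp
        have "expectation (\<lambda>\<omega>. \<bar>S \<omega>\<bar> powr (r - 2)) \<le>
            expectation (\<lambda>\<omega>. sqrt (L * k) powr (r - 2) + \<bar>S \<omega>\<bar> powr r / (sqrt (L * k))\<^sup>2)"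
          using IH(1) S2 Lk r by (intro integral_mono powr_minus_two_le) auto
        also have "\<dots> = sqrt (L * k) powr (r - 2) + expectation (\<lambda>\<omega>. \<bar>S \<omega>\<bar> powr r) / (L * k)"
          using IH(1) L by (simp add: prob_space)
        also have "sqrt (L * k) powr (r - 2) = L powr (r / 2 - 1) * real k powr (r / 2 - 1)"
          using L by (simp add: powr_half_sqrt[symmetric] powr_powr powr_mult diff_divide_distrib)
        also have "expectation (\<lambda>\<omega>. \<bar>S \<omega>\<bar> powr r) / (L * k) \<le> B * real k powr (r / 2) / (L * k)"
          using IH(2) L k by (intro divide_right_mono) (auto simp: k_def)
        also have "B * real k powr (r / 2) / (L * k) = B / L * real k powr (r / 2 - 1)"
          using k by (simp add: powr_diff)
        finally have ES2: "expectation (\<lambda>\<omega>. \<bar>S \<omega>\<bar> powr (r - 2)) \<le>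
            (L powr (r / 2 - 1) + B / L) * real k powr (r / 2 - 1)"
          by (simp add: distrib_right)
        have "expectation (\<lambda>\<omega>. \<bar>S \<omega> + \<xi> i \<omega>\<bar> powr r) \<le> B * real k powr (r / 2) +
            C * ((L powr (r / 2 - 1) + B / L) * real k powr (r / 2 - 1) * v + m * real k powr (r / 2 - 1))"
        proof (rule order_trans[OF step(2)], intro add_mono mult_left_mono mult_mono)
          show "expectation (\<lambda>\<omega>. \<bar>\<xi> i \<omega>\<bar> powr r) \<le> m * real k powr (r / 2 - 1)"
          proof -
            have "1 \<le> real k powr (r / 2 - 1)" using k r by (intro ge_one_powr_ge_zero) auto
            then have "m * 1 \<le> m * real k powr (r / 2 - 1)" using m by (rule mult_left_mono)
            then show ?thesis using insert.prems(5)[of i] by simp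
          qed
        qed (use IH ES2 insert.prems C L B in \<open>auto simp: k_def\<close>)
        also have "\<dots> = B * real k powr (r / 2) + (B * (C * v / L) +
            (C * v * L powr (r / 2 - 1) + C * m)) * real k powr (r / 2 - 1)"
          by (simp add: algebra_simps)
        also have "\<dots> \<le> B * real k powr (r / 2) + (B * (1 / 2) + B / 2) * real k powr (r / 2 - 1)"
          using B CvL by (intro add_left_mono mult_right_mono add_mono mult_left_mono) auto
        also have "\<dots> = B * (real k powr (r / 2) + real k powr (r / 2 - 1))"
          by (simp add: algebra_simps)
        also have "\<dots> \<le> B * real (Suc k) powr (r / 2)"
          using B k r by (intro mult_left_mono powr_Suc_ge) auto
        finally show ?thesis using insert.hyps by (simp add: k_def)
      qed
      then show ?case using step(1) by (simp add: sum_eq)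
    qed simp
  qed
qed

text \<open>The Lindeberg argument: \<open>norm_prod_diff\<close> reduces the product to its
  factors, each of which, like \<open>exp (- x)\<close>, is compared with \<open>1 - x\<close>. The
  two errors are the remainder of the characteristic function and \<open>x\<^sup>2 / 2\<close>;
  summed over \<open>k\<close> factors with x = t^2 v / (2k), the latter gives t^4 v^2 / (8k). An
  explicit bound is kept in place of a limit, since it has to hold uniformly over coordinates and
  blocks.\<close>

lemma (in prob_space) char_normalized_sum_bound:
  fixes Y :: "'i \<Rightarrow> 'a \<Rightarrow> real"
  assumes I: "finite I" "card I = k" "0 < k"
    and indep: "indep_vars (\<lambda>_. borel) Y I"
    and int: "\<And>i. i \<in> I \<Longrightarrow> integrable M (Y i)" "\<And>i. i \<in> I \<Longrightarrow> integrable M (\<lambda>\<omega>. (Y i \<omega>)\<^sup>2)"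
    and mean: "\<And>i. i \<in> I \<Longrightarrow> expectation (Y i) = 0"
    and var: "\<And>i. i \<in> I \<Longrightarrow> expectation (\<lambda>\<omega>. (Y i \<omega>)\<^sup>2) = v"
    and Lindeberg: "\<And>i. i \<in> I \<Longrightarrow>
      expectation (\<lambda>\<omega>. min (6 * (Y i \<omega>)\<^sup>2) (\<bar>t / sqrt k\<bar> * \<bar>Y i \<omega>\<bar> ^ 3)) \<le> b"
  shows "cmod (char (distr M borel (\<lambda>\<omega>. \<Sum>i\<in>I. Y i \<omega>)) (t / sqrt k) - exp (- (t\<^sup>2 * v / 2)))
    \<le> t\<^sup>2 / 6 * b + t ^ 4 * v\<^sup>2 / (8 * k)"
proof -
  define s where "s = t / sqrt k"
  define x where "x = s\<^sup>2 * v / 2"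
  have s2: "s\<^sup>2 = t\<^sup>2 / k" by (simp add: s_def power_divide)
  have Ym [measurable]: "Y i \<in> borel_measurable M" if "i \<in> I" for i
    using int(1)[OF that] by simp
  obtain j where "j \<in> I" using I by fastforce
  then have "v \<ge> 0" using var[of j] by (metis Bochner_Integration.integral_nonneg zero_le_power2)
  then have x: "x \<ge> 0" by (simp add: x_def)
  let ?\<phi> = "\<lambda>i. char (distr M borel (Y i)) s"
  have term_bound: "cmod (?\<phi> i - exp (- x)) \<le> s\<^sup>2 / 6 * b + x\<^sup>2 / 2" if i: "i \<in> I" for i
  proof -
    have "cmod (?\<phi> i - (1 - s\<^sup>2 * v / 2)) \<le>
        s\<^sup>2 / 6 * expectation (\<lambda>\<omega>. min (6 * (Y i \<omega>)\<^sup>2) (\<bar>s\<bar> * \<bar>Y i \<omega>\<bar> ^ 3))"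
      using i by (intro char_approx3' refl) (auto simp: int mean var)
    also have "\<dots> \<le> s\<^sup>2 / 6 * b"
      using Lindeberg[OF i] unfolding s_def by (intro mult_left_mono) auto
    finally have 1: "cmod (?\<phi> i - of_real (1 - x)) \<le> s\<^sup>2 / 6 * b" by (simp add: x_def)
    have "cmod (of_real (1 - x) - of_real (exp (- x))) = \<bar>(1 - x) - exp (- x)\<bar>"
      unfolding of_real_diff[symmetric] by (simp only: norm_of_real)
    also have "\<dots> \<le> x\<^sup>2 / 2" using abs_exp_minus_Taylor2[OF x] by (simp add: abs_minus_commute)
    finally show ?thesis
      using norm_triangle_ineq[of "?\<phi> i - of_real (1 - x)" "of_real (1 - x) - of_real (exp (- x))"] 1
      by (simp add: exp_of_real)
  qed
  have "exp (- (t\<^sup>2 * v / 2)) = exp (- x) ^ k"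
    using I by (simp add: x_def s2 flip: exp_of_nat_mult)
  then have exp_eq: "complex_of_real (exp (- (t\<^sup>2 * v / 2))) = (\<Prod>i\<in>I. of_real (exp (- x)))"
    using I by simp
  have "cmod (char (distr M borel (\<lambda>\<omega>. \<Sum>i\<in>I. Y i \<omega>)) s - of_real (exp (- (t\<^sup>2 * v / 2))))
      = cmod ((\<Prod>i\<in>I. ?\<phi> i) - (\<Prod>i\<in>I. of_real (exp (- x))))"
    unfolding exp_eq char_distr_sum[OF indep] ..
  also have "\<dots> \<le> (\<Sum>i\<in>I. cmod (?\<phi> i - of_real (exp (- x))))"
  proof (rule norm_prod_diff)
    show "cmod (?\<phi> i) \<le> 1" if "i \<in> I" for i
      by (rule real_distribution.cmod_char_le_1) (use that in simp)
    show "cmod (of_real (exp (- x))) \<le> 1"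
      using x by (simp del: of_real_exp)
  qed
  also have "\<dots> \<le> (\<Sum>i\<in>I. s\<^sup>2 / 6 * b + x\<^sup>2 / 2)"
    using term_bound by (intro sum_mono) (simp add: exp_of_real)
  also have "\<dots> = t\<^sup>2 / 6 * b + t ^ 4 * v\<^sup>2 / (8 * k)"
  proof -
    have "(\<Sum>i\<in>I. s\<^sup>2 / 6 * b + x\<^sup>2 / 2) = k * (t\<^sup>2 / k / 6 * b + (t\<^sup>2 / k * v / 2)\<^sup>2 / 2)"
      using I by (simp add: s2 x_def)
    also have "\<dots> = t\<^sup>2 / 6 * b + t ^ 4 * v\<^sup>2 / (8 * k)"
      using I by (simp add: field_simps power2_eq_square power4_eq_xxxx)
    finally show ?thesis .
  qed
  finally show ?thesis by (simp add: s_def)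
qed

text \<open>The abstract core of a first-passage argument: \<open>A k\<close> stands for first
  passage at time \<open>k\<close>, \<open>B k\<close> for a small increment afterwards,
  \<open>C\<close> for a large final value. Each \<open>A k\<close> loses at most half its
  probability when intersected with \<open>B k\<close>, and the intersections are disjoint parts of
  \<open>C\<close>.\<close>

lemma (in prob_space) prob_Union_le_of_indep_events:
  assumes K: "finite K" and disj: "disjoint_family_on A K"
    and A: "\<And>k. k \<in> K \<Longrightarrow> A k \<in> events" and B: "\<And>k. k \<in> K \<Longrightarrow> B k \<in> events" and C: "C \<in> events"
    and indep: "\<And>k. k \<in> K \<Longrightarrow> prob (A k \<inter> B k) = prob (A k) * prob (B k)"
    and half: "\<And>k. k \<in> K \<Longrightarrow> 1 / 2 \<le> prob (B k)"
    and sub: "\<And>k. k \<in> K \<Longrightarrow> A k \<inter> B k \<subseteq> C"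
  shows "prob (\<Union>k\<in>K. A k) \<le> 2 * prob C"
proof -
  have "prob (\<Union>k\<in>K. A k) = (\<Sum>k\<in>K. prob (A k))"
    using A by (intro finite_measure_finite_Union K disj) auto
  also have "\<dots> \<le> (\<Sum>k\<in>K. 2 * prob (A k \<inter> B k))"
  proof (rule sum_mono)
    fix k assume "k \<in> K"
    then have "prob (A k) * (1 / 2) \<le> prob (A k) * prob (B k)"
      using half by (intro mult_left_mono) auto
    then show "prob (A k) \<le> 2 * prob (A k \<inter> B k)" using indep \<open>k \<in> K\<close> by simp
  qed
  also have "\<dots> = 2 * (\<Sum>k\<in>K. prob (A k \<inter> B k))" by (simp add: sum_distrib_left)
  also have "(\<Sum>k\<in>K. prob (A k \<inter> B k)) = prob (\<Union>k\<in>K. A k \<inter> B k)"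
  proof (rule finite_measure_finite_Union[symmetric, OF K])
    show "disjoint_family_on (\<lambda>k. A k \<inter> B k) K"
      using disj by (rule disjoint_family_on_bisimulation) auto
  qed (use A B in auto)
  also have "\<dots> \<le> prob C" using sub C by (intro finite_measure_mono) auto
  finally show ?thesis by simp
qed

lemma borel_measurable_PiM_vec:
  "l \<in> J \<Longrightarrow> i < d \<Longrightarrow> (\<lambda>x. x l i) \<in> borel_measurable (PiM J (\<lambda>_. borel_vec d))"
  by (rule measurable_compose[where f = "\<lambda>x. x l" and N = "borel_vec d"])
    (auto intro!: measurable_component_singleton)

lemma borel_measurable_lp_norm:
  assumes "\<And>i. i < d \<Longrightarrow> (\<lambda>\<omega>. f \<omega> i) \<in> borel_measurable M"
  shows "(\<lambda>\<omega>. lp_norm p d (f \<omega>)) \<in> borel_measurable M"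
  using assms unfolding lp_norm_def by measurable

text \<open>After the first passage above \<open>2 * \<epsilon>\<close>, the rest of the block is
  independent of the past and has norm at most \<open>\<epsilon>\<close> with probability at least
  1/2; in that case the whole block still has norm above \<open>\<epsilon>\<close>. This is why
  \<open>half\<close> speaks of all final pieces of the block.\<close>

lemma (in prob_space) Ottaviani_inequality:
  fixes X :: "nat \<Rightarrow> 'a \<Rightarrow> nat \<Rightarrow> real"
  assumes p: "1 \<le> p"
    and indep: "indep_vars (\<lambda>_. borel_vec d) X I" and I: "{a<..a + h} \<subseteq> I"
    and half: "\<And>k. k \<le> h \<Longrightarrow>
      prob {\<omega> \<in> space M. \<epsilon> < lp_norm p d (\<lambda>i. \<Sum>l\<in>{a + k<..a + h}. X l \<omega> i)} \<le> 1 / 2"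
  shows "prob {\<omega> \<in> space M. \<exists>k\<le>h. 2 * \<epsilon> < lp_norm p d (\<lambda>i. \<Sum>l\<in>{a<..a + k}. X l \<omega> i)}
    \<le> 2 * prob {\<omega> \<in> space M. \<epsilon> < lp_norm p d (\<lambda>i. \<Sum>l\<in>{a<..a + h}. X l \<omega> i)}"
proof -
  define q where "q J x = lp_norm p d (\<lambda>i. \<Sum>l\<in>J. x l i)" for J :: "nat set" and x :: "nat \<Rightarrow> nat \<Rightarrow> real"
  define D where "D J \<omega> = q J (\<lambda>l. X l \<omega>)" for J \<omega>
  have q_meas [measurable]: "q J \<in> borel_measurable (PiM J' (\<lambda>_. borel_vec d))" if "J \<subseteq> J'" for J J'
    unfolding q_def using that
    by (intro borel_measurable_lp_norm borel_measurable_sum borel_measurable_PiM_vec) auto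
  have X_meas: "X l \<in> measurable M (borel_vec d)" if "l \<in> I" for l
    using indep that unfolding indep_vars_def by auto
  have "(\<lambda>\<omega>. X l \<omega> i) \<in> borel_measurable M" if "l \<in> I" "i < d" for l i
    using measurable_compose[OF X_meas[OF that(1)] measurable_component_singleton[of i "{..<d}"]] that by auto
  then have D_meas: "D J \<in> borel_measurable M" if "J \<subseteq> I" for J
    unfolding D_def q_def using that by (intro borel_measurable_lp_norm borel_measurable_sum) auto
  have D_restrict: "D J \<omega> = q J (restrict (\<lambda>l. X l \<omega>) J')" if "J \<subseteq> J'" for J J' \<omega>
    unfolding D_def q_def using that by (intro lp_norm_cong sum.cong) auto
  \<comment> \<open>\<open>A k\<close>: the threshold \<open>2\<epsilon>\<close> is first exceeded at time \<open>a + k\<close>; this depends on the past of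
    \<open>a + k\<close> only.\<close>
  define A where "A k = {\<omega> \<in> space M. 2 * \<epsilon> < D {a<..a + k} \<omega> \<and> (\<forall>j\<in>{..<k}. D {a<..a + j} \<omega> \<le> 2 * \<epsilon>)}" for k
  define B where "B k = {\<omega> \<in> space M. D {a + k<..a + h} \<omega> \<le> \<epsilon>}" for k
  define C where "C = {\<omega> \<in> space M. \<epsilon> < D {a<..a + h} \<omega>}"
  have D_meas' [measurable]: "D {b<..c} \<in> borel_measurable M" if "a \<le> b" "c \<le> a + h" for b c
    using that I by (intro D_meas) force
  have "prob (\<Union>k\<in>{..h}. A k) \<le> 2 * prob C"
  proof (rule prob_Union_le_of_indep_events[where B = B])
    show "disjoint_family_on A {..h}"
      unfolding disjoint_family_on_def
    proof (intro ballI impI)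
      fix m n :: nat assume "m \<noteq> n"
      then consider "m < n" | "n < m" by linarith
      then show "A m \<inter> A n = {}" by cases (force simp: A_def)+
    qed
    show "A k \<in> events" if k: "k \<in> {..h}" for k
    proof -
      have [measurable]: "D {a<..a + j} \<in> borel_measurable M" if "j \<le> k" for j
        using that k by (intro D_meas') auto
      have "Measurable.pred M (\<lambda>\<omega>. \<forall>j\<in>{..<k}. D {a<..a + j} \<omega> \<le> 2 * \<epsilon>)"
        by (rule pred_intros_finite) (auto intro!: borel_measurable_pred_less)
      then show ?thesis unfolding A_def by measurable
    qed
    show "B k \<in> events" if "k \<in> {..h}" for k
      unfolding B_def using that by measurable
    show "C \<in> events" unfolding C_def by measurable
    show "prob (A k \<inter> B k) = prob (A k) * prob (B k)" if k: "k \<in> {..h}" for k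
    proof -
      let ?I1 = "{a<..a + k}" and ?I2 = "{a + k<..a + h}"
      let ?P1 = "PiM ?I1 (\<lambda>_. borel_vec d)" and ?P2 = "PiM ?I2 (\<lambda>_. borel_vec d)"
      \<comment> \<open>Both events are rewritten as preimages under the restrictions of the path to
        two disjoint sets of steps, which are independent random elements of product spaces.\<close>
      define A' where "A' = {x \<in> space ?P1. 2 * \<epsilon> < q ?I1 x \<and> (\<forall>j\<in>{..<k}. q {a<..a + j} x \<le> 2 * \<epsilon>)}"
      define B' where "B' = {x \<in> space ?P2. q ?I2 x \<le> \<epsilon>}"
      have ind: "indep_var ?P1 (\<lambda>\<omega>. restrict (\<lambda>l. X l \<omega>) ?I1) ?P2 (\<lambda>\<omega>. restrict (\<lambda>l. X l \<omega>) ?I2)"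
        using I k by (intro indep_var_restrict[OF indep]) auto
      have [measurable]: "q {a<..a + j} \<in> borel_measurable ?P1" if "j \<le> k" for j
        by (rule q_meas) (use that in auto)
      have sets: "A' \<in> sets ?P1" "B' \<in> sets ?P2"
      proof -
        have "Measurable.pred ?P1 (\<lambda>x. \<forall>j\<in>{..<k}. q {a<..a + j} x \<le> 2 * \<epsilon>)"
          by (rule pred_intros_finite) auto
        then show "A' \<in> sets ?P1" unfolding A'_def by measurable
        show "B' \<in> sets ?P2" unfolding B'_def by measurable
      qed
      have A_eq: "A k = (\<lambda>\<omega>. restrict (\<lambda>l. X l \<omega>) ?I1) -` A' \<inter> space M"
      proof -
        have "D {a<..a + j} \<omega> = q {a<..a + j} (restrict (\<lambda>l. X l \<omega>) ?I1)" if "j \<le> k" for j \<omega>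
          using that by (intro D_restrict) auto
        then show ?thesis
          using measurable_space[OF indep_var_rv1[OF ind]] by (auto simp: A_def A'_def)
      qed
      have B_eq: "B k = (\<lambda>\<omega>. restrict (\<lambda>l. X l \<omega>) ?I2) -` B' \<inter> space M"
        using measurable_space[OF indep_var_rv2[OF ind]] D_restrict[of ?I2 ?I2] by (auto simp: B_def B'_def)
      have "A k \<inter> B k = (\<lambda>\<omega>. (restrict (\<lambda>l. X l \<omega>) ?I1, restrict (\<lambda>l. X l \<omega>) ?I2)) -` (A' \<times> B') \<inter> space M"
        unfolding A_eq B_eq by auto
      then show ?thesis
        using indep_varD[OF ind sets] A_eq B_eq by simp
    qed
    show "1 / 2 \<le> prob (B k)" if "k \<in> {..h}" for k
    proof -
      have [measurable]: "D {a + k<..a + h} \<in> borel_measurable M" by (rule D_meas') auto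
      have "prob (space M - B k) \<le> 1 / 2"
      proof -
        have "space M - B k = {\<omega> \<in> space M. \<epsilon> < D {a + k<..a + h} \<omega>}" by (auto simp: B_def)
        then show ?thesis using half[of k] that by (simp add: D_def q_def)
      qed
      moreover have "B k \<in> events" unfolding B_def by measurable
      ultimately show ?thesis by (simp add: prob_compl)
    qed
    show "A k \<inter> B k \<subseteq> C" if k: "k \<in> {..h}" for k
    proof
      fix \<omega> assume \<omega>: "\<omega> \<in> A k \<inter> B k"
      have split: "(\<Sum>l\<in>{a<..a + k}. X l \<omega> i) = (\<Sum>l\<in>{a<..a + h}. X l \<omega> i) + - (\<Sum>l\<in>{a + k<..a + h}. X l \<omega> i)" for i
      proof -
        have "{a<..a + h} = {a<..a + k} \<union> {a + k<..a + h}" using k by auto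
        then show ?thesis by (simp add: sum.union_disjoint)
      qed
      have "D {a<..a + k} \<omega> \<le> D {a<..a + h} \<omega> + D {a + k<..a + h} \<omega>"
        unfolding D_def q_def split
        by (rule order_trans[OF lp_norm_triangle[OF p]]) (simp add: lp_norm_minus)
      then show "\<omega> \<in> C" using \<omega> by (auto simp: A_def B_def C_def)
    qed
  qed simp
  also have "(\<Union>k\<in>{..h}. A k) = {\<omega> \<in> space M. \<exists>k\<le>h. 2 * \<epsilon> < D {a<..a + k} \<omega>}"
  proof (intro equalityI subsetI)
    fix \<omega> assume "\<omega> \<in> {\<omega> \<in> space M. \<exists>k\<le>h. 2 * \<epsilon> < D {a<..a + k} \<omega>}"
    then obtain k where k: "\<omega> \<in> space M" "k \<le> h" "2 * \<epsilon> < D {a<..a + k} \<omega>" by blast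
    define m where "m = (LEAST k. 2 * \<epsilon> < D {a<..a + k} \<omega>)"
    have "2 * \<epsilon> < D {a<..a + m} \<omega>" unfolding m_def by (rule LeastI) (rule k)
    moreover have "\<forall>j\<in>{..<m}. D {a<..a + j} \<omega> \<le> 2 * \<epsilon>"
      unfolding m_def using not_less_Least by (auto simp: not_less[symmetric])
    moreover have "m \<le> k" unfolding m_def by (rule Least_le) (rule k)
    ultimately show "\<omega> \<in> (\<Union>k\<in>{..h}. A k)" using k by (auto simp: A_def)
  qed (auto simp: A_def)
  finally show ?thesis by (simp add: D_def q_def C_def)
qed

section \<open>Law of large numbers for uncorrelated coordinates\<close>

lemma norm_sum_iexp_square:
  "(cmod (\<Sum>i\<in>I. iexp (\<theta> i)))\<^sup>2 = (\<Sum>i\<in>I. \<Sum>j\<in>I. cos (\<theta> i - \<theta> j))"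
proof -
  have "(cmod (\<Sum>i\<in>I. iexp (\<theta> i)))\<^sup>2 = (\<Sum>i\<in>I. cos (\<theta> i))\<^sup>2 + (\<Sum>i\<in>I. sin (\<theta> i))\<^sup>2"
    by (simp add: cmod_power2 Re_exp Im_exp)
  also have "\<dots> = (\<Sum>i\<in>I. \<Sum>j\<in>I. cos (\<theta> i - \<theta> j))"
    by (simp add: power2_eq_square sum_product cos_diff sum.distrib)
  finally show ?thesis .
qed

lemma (in prob_space) expectation_le_sqrt:
  fixes f :: "'a \<Rightarrow> real"
  assumes "integrable M f" "integrable M (\<lambda>x. (f x)\<^sup>2)"
  shows "expectation f \<le> sqrt (expectation (\<lambda>x. (f x)\<^sup>2))"
  using variance_positive[of f] variance_eq[OF assms] by (intro real_le_rsqrt) simp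

lemma integrable_std_normal_powr:
  assumes "0 \<le> q"
  shows "integrable std_normal_distribution (\<lambda>x. \<bar>x\<bar> powr q)"
proof -
  interpret real_distribution std_normal_distribution by (rule real_dist_normal_dist)
  define k where "k = nat \<lceil>q\<rceil>"
  have "integrable std_normal_distribution (\<lambda>x. \<bar>x\<bar> powr real (2 * k))"
  proof (rule Bochner_Integration.integrable_bound)
    show "integrable std_normal_distribution (\<lambda>x. 1 + x ^ (2 * k))"
      using integrable_std_normal_distribution_moment[of "2 * k"] by simp
    have "\<bar>x\<bar> powr real (2 * k) \<le> 1 + x ^ (2 * k)" for x :: real
      by (cases "x = 0") (auto simp: powr_realpow power_even_abs simp del: of_nat_mult)
    then have "norm (\<bar>x\<bar> powr real (2 * k)) \<le> norm (1 + x ^ (2 * k))" for x :: real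
      by (simp add: abs_of_nonneg add_nonneg_nonneg del: of_nat_mult)
    then show "AE x in std_normal_distribution. norm (\<bar>x\<bar> powr real (2 * k)) \<le> norm (1 + x ^ (2 * k))"
      by simp
  qed simp
  then show ?thesis
    by (rule integrable_powr_le[rotated]) (use assms in \<open>auto simp: k_def, linarith\<close>)
qed

text \<open>
  \<open>Y d l i\<close> stands for \<open>\<xi>\<^bsub>l,i\<^esub> = d\<^bsup>1/p\<^esup> X\<^bsub>l,i\<^esub>\<close> in dimension \<open>d\<close>; steps \<open>l\<close> are numbered from 1,
  coordinates \<open>i\<close> from 0.
\<close>

locale uncorrelated_arrays =
  fixes M :: "nat \<Rightarrow> 'w measure" and Y :: "nat \<Rightarrow> nat \<Rightarrow> nat \<Rightarrow> 'w \<Rightarrow> real"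
    and \<mu> :: "real measure" and p :: real
  assumes p: "1 \<le> p"
    and \<mu>: "real_distribution \<mu>" and mean: "(\<integral>x. x \<partial>\<mu>) = 0"
    and moment: "integrable \<mu> (\<lambda>x. \<bar>x\<bar> powr (2 * p))"
    and prob_space_M: "\<And>d. 0 < d \<Longrightarrow> prob_space (M d)"
    and indep: "\<And>d. 0 < d \<Longrightarrow>
      prob_space.indep_vars (M d) (\<lambda>_. borel_vec d) (\<lambda>l \<omega>. \<lambda>i\<in>{..<d}. Y d l i \<omega>) {1..}"
    and distr_Y: "\<And>d l i. i < d \<Longrightarrow> 1 \<le> l \<Longrightarrow> distr (M d) borel (Y d l i) = \<mu>"
    and uncorr: "\<And>d l i j. i < d \<Longrightarrow> j < d \<Longrightarrow> i \<noteq> j \<Longrightarrow> 1 \<le> l \<Longrightarrow>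
      (\<integral>\<omega>. Y d l i \<omega> * Y d l j \<omega> \<partial>M d) = 0"
begin

interpretation \<mu>: real_distribution \<mu> by (rule \<mu>)

definition \<sigma> :: real where "\<sigma> = sqrt (\<integral>x. x\<^sup>2 \<partial>\<mu>)"

definition T :: "nat \<Rightarrow> nat \<Rightarrow> nat \<Rightarrow> nat \<Rightarrow> 'w \<Rightarrow> real" where
  "T d a k i \<omega> = (\<Sum>l\<in>{a<..a + k}. Y d l i \<omega>) / sqrt k"

definition W :: "nat \<Rightarrow> nat \<Rightarrow> nat \<Rightarrow> 'w \<Rightarrow> real" where
  "W d a k \<omega> = (\<Sum>i<d. \<bar>T d a k i \<omega>\<bar> powr p) / d"

lemma \<mu>_integrable: "integrable \<mu> (\<lambda>x. x)" "integrable \<mu> (\<lambda>x. x\<^sup>2)"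
  by (rule \<mu>.integrable_of_powr[OF _ moment] \<mu>.integrable_square_of_powr[OF _ moment]; use p in simp)+

lemma \<sigma>_nonneg: "0 \<le> \<sigma>" by (simp add: \<sigma>_def)

lemma \<sigma>_square: "\<sigma>\<^sup>2 = (\<integral>x. x\<^sup>2 \<partial>\<mu>)" by (simp add: \<sigma>_def)

lemma Y_measurable:
  assumes "i < d" "1 \<le> l"
  shows "Y d l i \<in> borel_measurable (M d)"
proof -
  interpret prob_space "M d" using prob_space_M assms by simp
  have "(\<lambda>\<omega>. \<lambda>i\<in>{..<d}. Y d l i \<omega>) \<in> measurable (M d) (borel_vec d)"
    using indep[of d] assms unfolding indep_vars_def by auto
  from measurable_compose[OF this measurable_component_singleton[of i "{..<d}"]] show ?thesis
    using assms by simp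
qed

lemma indep_Y:
  assumes d: "0 < d" and I: "I \<subseteq> {1..}" and g: "g \<in> borel_measurable (borel_vec d)"
  shows "prob_space.indep_vars (M d) (\<lambda>_. borel) (\<lambda>l \<omega>. g (\<lambda>i\<in>{..<d}. Y d l i \<omega>)) I"
proof -
  interpret prob_space "M d" using prob_space_M d by simp
  show ?thesis
    by (rule indep_vars_compose2[OF indep_vars_subset[OF indep[OF d] I]]) (rule g)
qed

lemma integral_Y:
  fixes f :: "real \<Rightarrow> 'b::{banach, second_countable_topology}"
  assumes "i < d" "1 \<le> l" "f \<in> borel_measurable borel"
  shows "(\<integral>\<omega>. f (Y d l i \<omega>) \<partial>M d) = (\<integral>x. f x \<partial>\<mu>)"
  using distr_Y[OF assms(1,2)] integral_distr[OF Y_measurable[OF assms(1,2)] assms(3)] by simp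

lemma integrable_Y:
  fixes f :: "real \<Rightarrow> 'b::{banach, second_countable_topology}"
  assumes "i < d" "1 \<le> l" "f \<in> borel_measurable borel"
  shows "integrable (M d) (\<lambda>\<omega>. f (Y d l i \<omega>)) \<longleftrightarrow> integrable \<mu> f"
  using distr_Y[OF assms(1,2)] integrable_distr_eq[OF Y_measurable[OF assms(1,2)] assms(3)] by simp

lemma T_measurable [measurable]: "i < d \<Longrightarrow> T d a k i \<in> borel_measurable (M d)"
  unfolding T_def by (intro borel_measurable_divide borel_measurable_sum Y_measurable) auto

text \<open>The moment of order \<open>2 * p\<close> of a sum of \<open>k\<close> steps is of order
  k^p, which the normalisation by \<open>sqrt k\<close> cancels exactly. The input bounds are
  moments of \<open>\<mu>\<close>, hence a single \<open>B\<close> for all coordinates and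
  blocks.\<close>

lemma T_moment:
  obtains B where "B > 0"
    "\<And>d a k i. i < d \<Longrightarrow> integrable (M d) (\<lambda>\<omega>. \<bar>T d a k i \<omega>\<bar> powr (2 * p))"
    "\<And>d a k i. i < d \<Longrightarrow> (\<integral>\<omega>. \<bar>T d a k i \<omega>\<bar> powr (2 * p) \<partial>M d) \<le> B"
proof -
  have "2 \<le> 2 * p" "0 \<le> \<sigma>\<^sup>2" "0 \<le> (\<integral>x. \<bar>x\<bar> powr (2 * p) \<partial>\<mu>)" using p by auto
  from moment_sum_indep_bound[OF this] obtain B where "B > 0" and
    B: "\<And>(M :: 'w measure) (\<xi> :: nat \<Rightarrow> 'w \<Rightarrow> real) I.
      prob_space M \<Longrightarrow> finite I \<Longrightarrow> prob_space.indep_vars M (\<lambda>_. borel) \<xi> I \<Longrightarrow>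
      (\<And>i. i \<in> I \<Longrightarrow> integrable M (\<lambda>\<omega>. \<bar>\<xi> i \<omega>\<bar> powr (2 * p))) \<Longrightarrow>
      (\<And>i. i \<in> I \<Longrightarrow> (\<integral>\<omega>. \<xi> i \<omega> \<partial>M) = 0) \<Longrightarrow>
      (\<And>i. i \<in> I \<Longrightarrow> (\<integral>\<omega>. (\<xi> i \<omega>)\<^sup>2 \<partial>M) \<le> \<sigma>\<^sup>2) \<Longrightarrow>
      (\<And>i. i \<in> I \<Longrightarrow> (\<integral>\<omega>. \<bar>\<xi> i \<omega>\<bar> powr (2 * p) \<partial>M) \<le> (\<integral>x. \<bar>x\<bar> powr (2 * p) \<partial>\<mu>)) \<Longrightarrow>
      integrable M (\<lambda>\<omega>. \<bar>\<Sum>i\<in>I. \<xi> i \<omega>\<bar> powr (2 * p)) \<and>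
      (\<integral>\<omega>. \<bar>\<Sum>i\<in>I. \<xi> i \<omega>\<bar> powr (2 * p) \<partial>M) \<le> B * real (card I) powr (2 * p / 2)"
    by blast
  have *: "integrable (M d) (\<lambda>\<omega>. \<bar>T d a k i \<omega>\<bar> powr (2 * p)) \<and>
      (\<integral>\<omega>. \<bar>T d a k i \<omega>\<bar> powr (2 * p) \<partial>M d) \<le> B" if i: "i < d" for d a k i
  proof -
    have "prob_space.indep_vars (M d) (\<lambda>_. borel) (\<lambda>l \<omega>. (\<lambda>i\<in>{..<d}. Y d l i \<omega>) i) {a<..a + k}"
      by (rule indep_Y) (use i in \<open>auto intro!: measurable_component_singleton\<close>)
    then have ind: "prob_space.indep_vars (M d) (\<lambda>_. borel) (\<lambda>l. Y d l i) {a<..a + k}"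
      using i by simp
    have S: "integrable (M d) (\<lambda>\<omega>. \<bar>\<Sum>l\<in>{a<..a + k}. Y d l i \<omega>\<bar> powr (2 * p)) \<and>
      (\<integral>\<omega>. \<bar>\<Sum>l\<in>{a<..a + k}. Y d l i \<omega>\<bar> powr (2 * p) \<partial>M d) \<le> B * real (card {a<..a + k}) powr (2 * p / 2)"
    proof (rule B[OF _ _ ind])
      show "prob_space (M d)" using i by (intro prob_space_M) auto
      fix l assume "l \<in> {a<..a + k}"
      then have l: "1 \<le> l" by auto
      show "integrable (M d) (\<lambda>\<omega>. \<bar>Y d l i \<omega>\<bar> powr (2 * p))"
        using integrable_Y[OF i l, of "\<lambda>x. \<bar>x\<bar> powr (2 * p)"] moment by simp
      show "(\<integral>\<omega>. Y d l i \<omega> \<partial>M d) = 0"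
        using integral_Y[OF i l, of "\<lambda>x. x"] mean by simp
      show "(\<integral>\<omega>. (Y d l i \<omega>)\<^sup>2 \<partial>M d) \<le> \<sigma>\<^sup>2"
        using integral_Y[OF i l, of "\<lambda>x. x\<^sup>2"] by (simp add: \<sigma>_square)
      show "(\<integral>\<omega>. \<bar>Y d l i \<omega>\<bar> powr (2 * p) \<partial>M d) \<le> (\<integral>x. \<bar>x\<bar> powr (2 * p) \<partial>\<mu>)"
        using integral_Y[OF i l, of "\<lambda>x. \<bar>x\<bar> powr (2 * p)"] by simp
    qed simp
    have T_eq: "\<bar>T d a k i \<omega>\<bar> powr (2 * p) = \<bar>\<Sum>l\<in>{a<..a + k}. Y d l i \<omega>\<bar> powr (2 * p) / real k powr p" for \<omega>
      by (simp add: T_def powr_divide powr_powr abs_divide powr_half_sqrt[symmetric])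
    have "(\<integral>\<omega>. \<bar>T d a k i \<omega>\<bar> powr (2 * p) \<partial>M d) \<le> B"
    \<comment> \<open>For an empty block \<open>T\<close> is 0, by the convention on division by
      zero.\<close>
    proof (cases "k = 0")
      case False
      then show ?thesis unfolding T_eq using S by (simp add: divide_le_eq)
    qed (use \<open>B > 0\<close> in \<open>simp add: T_def\<close>)
    then show ?thesis using S unfolding T_eq by simp
  qed
  show thesis by (rule that[OF \<open>B > 0\<close>]) (use * in auto)
qed

end

section \<open>Characteristic functions of a coordinate and of a difference of coordinates\<close>

context uncorrelated_arrays
begin

interpretation \<mu>: real_distribution \<mu> by (rule \<mu>)

text \<open>
  The factor 2 in front of \<open>x\<close> lets one function dominate the Lindeberg terms of both \<open>Y d l i\<close> and
  \<open>Y d l i - Y d l j\<close>, whatever the joint law of the two coordinates.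
\<close>

definition \<Lambda> :: "real \<Rightarrow> nat \<Rightarrow> real" where
  "\<Lambda> t k = (\<integral>x. min (6 * (2 * x)\<^sup>2) (\<bar>t / sqrt k\<bar> * \<bar>2 * x\<bar> ^ 3) \<partial>\<mu>)"

text \<open>The error in \<open>char_normalized_sum_bound\<close> for variance
  \<open>2 * \<sigma>\<^sup>2\<close> and Lindeberg term \<open>2 * \<Lambda> t k\<close>. These are
  the values for a difference of two coordinates, and they dominate those of a single
  coordinate.\<close>

definition \<beta> :: "real \<Rightarrow> nat \<Rightarrow> real" where
  "\<beta> t k = t\<^sup>2 / 6 * (2 * \<Lambda> t k) + t ^ 4 * (2 * \<sigma>\<^sup>2)\<^sup>2 / (8 * k)"

lemma integrable_\<Lambda>: "integrable \<mu> (\<lambda>x. min (6 * (2 * x)\<^sup>2) (\<bar>t / sqrt k\<bar> * \<bar>2 * x\<bar> ^ 3))"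
proof (rule Bochner_Integration.integrable_bound)
  show "integrable \<mu> (\<lambda>x. 24 * x\<^sup>2)" using \<mu>_integrable by simp
qed (auto simp: power_mult_distrib)

text \<open>For \<open>p = 1\<close> only second moments are given, so the cubic branch of the
  minimum need not be integrable without truncation. Dominated convergence is used instead, with the
  square branch, equal to \<open>24 * x\<^sup>2\<close>, as the majorant.\<close>

lemma \<beta>_tendsto: "(\<beta> t \<longlongrightarrow> 0) sequentially"
proof -
  have lim: "(\<lambda>k::nat. min (6 * (2 * x)\<^sup>2) (\<bar>t / sqrt k\<bar> * \<bar>2 * x\<bar> ^ 3)) \<longlonglongrightarrow> 0" for x
  proof -
    have "(\<lambda>k::nat. c / sqrt k) \<longlonglongrightarrow> 0" for c by real_asymp
    from this[of "\<bar>t\<bar> * \<bar>2 * x\<bar> ^ 3"]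
    have "(\<lambda>k::nat. \<bar>t / sqrt k\<bar> * \<bar>2 * x\<bar> ^ 3) \<longlonglongrightarrow> 0"
      by (simp add: abs_divide)
    then have "(\<lambda>k::nat. min (6 * (2 * x)\<^sup>2) (\<bar>t / sqrt k\<bar> * \<bar>2 * x\<bar> ^ 3)) \<longlonglongrightarrow> min (6 * (2 * x)\<^sup>2) 0"
      by (intro tendsto_intros)
    then show ?thesis by simp
  qed
  have 1: "(\<lambda>k. \<Lambda> t k) \<longlonglongrightarrow> (\<integral>x. 0 \<partial>\<mu>)"
    unfolding \<Lambda>_def
  proof (rule integral_dominated_convergence)
    show "integrable \<mu> (\<lambda>x. 24 * x\<^sup>2)" using \<mu>_integrable by simp
    show "AE x in \<mu>. (\<lambda>k. min (6 * (2 * x)\<^sup>2) (\<bar>t / sqrt (real k)\<bar> * \<bar>2 * x\<bar> ^ 3)) \<longlonglongrightarrow> 0"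
      using lim by simp
  qed (auto simp: power_mult_distrib)
  have 2: "(\<lambda>k::nat. t ^ 4 * (2 * \<sigma>\<^sup>2)\<^sup>2 / real (8 * k)) \<longlonglongrightarrow> 0" by real_asymp
  have "(\<lambda>k. \<beta> t k) \<longlonglongrightarrow> t\<^sup>2 / 6 * (2 * (\<integral>x. 0 \<partial>\<mu>)) + 0"
    unfolding \<beta>_def by (intro tendsto_add tendsto_mult tendsto_const 1 2)
  then show ?thesis by simp
qed

text \<open>\<open>g\<close> is a real functional of the whole step vector, so its values at
  different steps inherit independence. It will be a coordinate in one use and the difference of two
  coordinates in the other.\<close>

lemma cos_sum_bound:
  assumes d: "0 < d" and k: "0 < k" and g: "g \<in> borel_measurable (borel_vec d)"
    and Z: "\<And>l \<omega>. g (\<lambda>i\<in>{..<d}. Y d l i \<omega>) = Z l \<omega>"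
    and int: "\<And>l. 1 \<le> l \<Longrightarrow> integrable (M d) (Z l)" "\<And>l. 1 \<le> l \<Longrightarrow> integrable (M d) (\<lambda>\<omega>. (Z l \<omega>)\<^sup>2)"
    and mean: "\<And>l. 1 \<le> l \<Longrightarrow> (\<integral>\<omega>. Z l \<omega> \<partial>M d) = 0"
    and var: "\<And>l. 1 \<le> l \<Longrightarrow> (\<integral>\<omega>. (Z l \<omega>)\<^sup>2 \<partial>M d) = v" and v: "v \<le> 2 * \<sigma>\<^sup>2"
    and Lindeberg: "\<And>l. 1 \<le> l \<Longrightarrow>
      (\<integral>\<omega>. min (6 * (Z l \<omega>)\<^sup>2) (\<bar>t / sqrt k\<bar> * \<bar>Z l \<omega>\<bar> ^ 3) \<partial>M d) \<le> 2 * \<Lambda> t k"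
  shows "\<bar>(\<integral>\<omega>. cos (t * ((\<Sum>l\<in>{a<..a + k}. Z l \<omega>) / sqrt k)) \<partial>M d) - exp (- (t\<^sup>2 * v / 2))\<bar> \<le> \<beta> t k"
proof -
  interpret prob_space "M d" using prob_space_M d by simp
  have ind: "indep_vars (\<lambda>_. borel) Z {a<..a + k}"
  proof -
    have "{a<..a + k} \<subseteq> {1..}" by auto
    from indep_Y[OF d this g] show ?thesis unfolding Z .
  qed
  let ?S = "\<lambda>\<omega>. \<Sum>l\<in>{a<..a + k}. Z l \<omega>"
  let ?\<phi> = "char (distr (M d) borel ?S) (t / sqrt k)"
  have [measurable]: "?S \<in> borel_measurable (M d)"
    using int by (intro borel_measurable_sum) auto
  have "cmod (?\<phi> - exp (- (t\<^sup>2 * v / 2))) \<le> t\<^sup>2 / 6 * (2 * \<Lambda> t k) + t ^ 4 * v\<^sup>2 / (8 * k)"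
    by (rule char_normalized_sum_bound[OF _ _ k ind]; (rule int mean var Lindeberg)?; simp)
  also have "\<dots> \<le> \<beta> t k"
  proof -
    have "0 \<le> v" using var[of 1] by (metis Bochner_Integration.integral_nonneg zero_le_power2 order_refl)
    then show ?thesis
      unfolding \<beta>_def using v by (intro add_left_mono divide_right_mono mult_left_mono power_mono) auto
  qed
  finally have "\<bar>Re (?\<phi> - exp (- (t\<^sup>2 * v / 2)))\<bar> \<le> \<beta> t k"
    using abs_Re_le_cmod order_trans by blast
  moreover have "Re ?\<phi> = (\<integral>\<omega>. cos (t * (?S \<omega> / sqrt k)) \<partial>M d)"
  proof -
    have "?\<phi> = (CLINT \<omega>|M d. iexp (t / sqrt k * ?S \<omega>))"
      unfolding char_def by (rule integral_distr) auto
    also have "Re \<dots> = (\<integral>\<omega>. Re (iexp (t / sqrt k * ?S \<omega>)) \<partial>M d)"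
    proof (rule integral_Re[symmetric])
      define R where "R \<omega> = t / sqrt k * ?S \<omega>" for \<omega>
      have [measurable]: "R \<in> borel_measurable (M d)" unfolding R_def by measurable
      have "integrable (M d) (\<lambda>\<omega>. iexp (R \<omega>))" by (rule integrable_iexp) auto
      then show "integrable (M d) (\<lambda>\<omega>. iexp (t / sqrt k * ?S \<omega>))" by (simp only: R_def)
    qed
    finally show ?thesis by (simp add: Re_exp)
  qed
  moreover have "Re (exp (- (t\<^sup>2 * v / 2)) :: complex) = exp (- (t\<^sup>2 * v / 2))"
    using Re_complex_of_real[of "exp (- (t\<^sup>2 * v / 2))"] by (simp only: )
  ultimately show ?thesis by simp
qed

lemma
  assumes i: "i < d" and l: "1 \<le> l"
  shows integrable_Y1: "integrable (M d) (Y d l i)" and integrable_Y2: "integrable (M d) (\<lambda>\<omega>. (Y d l i \<omega>)\<^sup>2)"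
    and integral_Y1: "(\<integral>\<omega>. Y d l i \<omega> \<partial>M d) = 0" and integral_Y2: "(\<integral>\<omega>. (Y d l i \<omega>)\<^sup>2 \<partial>M d) = \<sigma>\<^sup>2"
proof -
  show "integrable (M d) (Y d l i)"
    by (rule iffD2[OF integrable_Y[OF i l, of "\<lambda>x. x"] \<mu>_integrable(1)]) simp
  show "integrable (M d) (\<lambda>\<omega>. (Y d l i \<omega>)\<^sup>2)"
    by (rule iffD2[OF integrable_Y[OF i l, of "\<lambda>x. x\<^sup>2"] \<mu>_integrable(2)]) simp
  show "(\<integral>\<omega>. Y d l i \<omega> \<partial>M d) = 0"
    unfolding mean[symmetric] by (rule integral_Y[OF i l]) simp
  show "(\<integral>\<omega>. (Y d l i \<omega>)\<^sup>2 \<partial>M d) = \<sigma>\<^sup>2"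
    unfolding \<sigma>_square by (rule integral_Y[OF i l]) simp
qed

lemma cos_T_bound:
  assumes i: "i < d" and k: "0 < k"
  shows "\<bar>(\<integral>\<omega>. cos (t * T d a k i \<omega>) \<partial>M d) - exp (- (t\<^sup>2 * \<sigma>\<^sup>2 / 2))\<bar> \<le> \<beta> t k"
  unfolding T_def
proof (rule cos_sum_bound[OF _ k])
  show "(\<lambda>x. x i) \<in> borel_measurable (borel_vec d)"
    using i by (intro measurable_component_singleton) auto
  fix l :: nat assume l: "1 \<le> l"
  show "integrable (M d) (Y d l i)" "integrable (M d) (\<lambda>\<omega>. (Y d l i \<omega>)\<^sup>2)"
    by (rule integrable_Y1[OF i l] integrable_Y2[OF i l])+
  show "(\<integral>\<omega>. Y d l i \<omega> \<partial>M d) = 0" "(\<integral>\<omega>. (Y d l i \<omega>)\<^sup>2 \<partial>M d) = \<sigma>\<^sup>2"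
    by (rule integral_Y1[OF i l] integral_Y2[OF i l])+
  have "(\<integral>\<omega>. min (6 * (Y d l i \<omega>)\<^sup>2) (\<bar>t / sqrt k\<bar> * \<bar>Y d l i \<omega>\<bar> ^ 3) \<partial>M d)
      = (\<integral>x. min (6 * x\<^sup>2) (\<bar>t / sqrt k\<bar> * \<bar>x\<bar> ^ 3) \<partial>\<mu>)"
    by (rule integral_Y[OF i l]) measurable
  also have "\<dots> \<le> \<Lambda> t k"
    unfolding \<Lambda>_def
  proof (rule integral_mono[OF _ integrable_\<Lambda>])
    show "integrable \<mu> (\<lambda>x. min (6 * x\<^sup>2) (\<bar>t / sqrt k\<bar> * \<bar>x\<bar> ^ 3))"
    proof (rule Bochner_Integration.integrable_bound)
      show "integrable \<mu> (\<lambda>x. 6 * x\<^sup>2)" using \<mu>_integrable by simp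
    qed auto
    show "min (6 * x\<^sup>2) (\<bar>t / sqrt k\<bar> * \<bar>x\<bar> ^ 3) \<le> min (6 * (2 * x)\<^sup>2) (\<bar>t / sqrt k\<bar> * \<bar>2 * x\<bar> ^ 3)" for x
    proof -
      have "\<bar>x\<bar> ^ 3 \<le> \<bar>2 * x\<bar> ^ 3" by (rule power_mono) auto
      then show ?thesis by (intro min.mono mult_left_mono) (auto simp: power_mult_distrib)
    qed
  qed
  also have "\<dots> \<le> 2 * \<Lambda> t k"
    using Bochner_Integration.integral_nonneg[of \<mu> "\<lambda>x. min (6 * (2 * x)\<^sup>2) (\<bar>t / sqrt k\<bar> * \<bar>2 * x\<bar> ^ 3)"]
    unfolding \<Lambda>_def by simp
  finally show "(\<integral>\<omega>. min (6 * (Y d l i \<omega>)\<^sup>2) (\<bar>t / sqrt k\<bar> * \<bar>Y d l i \<omega>\<bar> ^ 3) \<partial>M d) \<le> 2 * \<Lambda> t k" .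
qed (use i in auto)

text \<open>Uncorrelatedness enters through the cross term of the variance and nowhere else. The
  target is the square of the target in \<open>cos_T_bound\<close>, which is what lets the terms
  cancel in the second moment of an average centred at its limit.\<close>

lemma cos_T_diff_bound:
  assumes i: "i < d" and j: "j < d" and neq: "i \<noteq> j" and k: "0 < k"
  shows "\<bar>(\<integral>\<omega>. cos (t * (T d a k i \<omega> - T d a k j \<omega>)) \<partial>M d) - (exp (- (t\<^sup>2 * \<sigma>\<^sup>2 / 2)))\<^sup>2\<bar> \<le> \<beta> t k"
proof -
  have T_diff: "T d a k i \<omega> - T d a k j \<omega> = (\<Sum>l\<in>{a<..a + k}. Y d l i \<omega> - Y d l j \<omega>) / sqrt k" for \<omega>
    by (simp add: T_def sum_subtractf diff_divide_distrib)
  have exp_sq: "(exp (- (t\<^sup>2 * \<sigma>\<^sup>2 / 2)))\<^sup>2 = exp (- (t\<^sup>2 * (2 * \<sigma>\<^sup>2) / 2))"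
    by (simp flip: exp_of_nat_mult exp_double)
  show ?thesis
    unfolding T_diff exp_sq
  proof (rule cos_sum_bound[OF _ k])
    have [measurable]: "(\<lambda>x. x i) \<in> borel_measurable (borel_vec d)" "(\<lambda>x. x j) \<in> borel_measurable (borel_vec d)"
      using i j by (auto intro!: measurable_component_singleton)
    show "(\<lambda>x. x i - x j) \<in> borel_measurable (borel_vec d)" by measurable
    fix l :: nat assume l: "1 \<le> l"
    have Y2: "integrable (M d) (\<lambda>\<omega>. (Y d l m \<omega>)\<^sup>2)" if "m < d" for m
      using that l by (rule integrable_Y2)
    note [measurable] = Y_measurable[OF i l] Y_measurable[OF j l]
    have Yij: "integrable (M d) (\<lambda>\<omega>. Y d l i \<omega> * Y d l j \<omega>)"
    proof (rule Bochner_Integration.integrable_bound)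
      show "integrable (M d) (\<lambda>\<omega>. (Y d l i \<omega>)\<^sup>2 + (Y d l j \<omega>)\<^sup>2)" using Y2 i j by simp
      have "\<bar>a * b\<bar> \<le> a\<^sup>2 + b\<^sup>2" for a b :: real
        using sum_squares_bound[of "\<bar>a\<bar>" "\<bar>b\<bar>"] abs_ge_zero[of "a * b"]
        unfolding abs_mult power2_abs by linarith
      then show "AE \<omega> in M d. norm (Y d l i \<omega> * Y d l j \<omega>) \<le> norm ((Y d l i \<omega>)\<^sup>2 + (Y d l j \<omega>)\<^sup>2)" by simp
    qed measurable
    have sq: "(Y d l i \<omega> - Y d l j \<omega>)\<^sup>2 = (Y d l i \<omega>)\<^sup>2 + (Y d l j \<omega>)\<^sup>2 - 2 * (Y d l i \<omega> * Y d l j \<omega>)" for \<omega>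
      by (simp add: power2_eq_square algebra_simps)
    show "integrable (M d) (\<lambda>\<omega>. Y d l i \<omega> - Y d l j \<omega>)" using integrable_Y1 i j l by simp
    show "integrable (M d) (\<lambda>\<omega>. (Y d l i \<omega> - Y d l j \<omega>)\<^sup>2)" unfolding sq using Y2 Yij i j by simp
    show "(\<integral>\<omega>. Y d l i \<omega> - Y d l j \<omega> \<partial>M d) = 0" using integrable_Y1 integral_Y1 i j l by simp
    show "(\<integral>\<omega>. (Y d l i \<omega> - Y d l j \<omega>)\<^sup>2 \<partial>M d) = 2 * \<sigma>\<^sup>2"
      unfolding sq using Y2 Yij integral_Y2 i j l uncorr[OF i j neq l] by simp
    let ?h = "\<lambda>x. min (6 * (2 * x)\<^sup>2) (\<bar>t / sqrt k\<bar> * \<bar>2 * x\<bar> ^ 3)"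
    let ?h' = "\<lambda>x. min (6 * x\<^sup>2) (\<bar>t / sqrt k\<bar> * \<bar>x\<bar> ^ 3)"
    have hY: "integrable (M d) (\<lambda>\<omega>. ?h (Y d l m \<omega>))" "(\<integral>\<omega>. ?h (Y d l m \<omega>) \<partial>M d) = \<Lambda> t k" if "m < d" for m
      unfolding \<Lambda>_def
      by (rule iffD2[OF integrable_Y[OF that l, of ?h] integrable_\<Lambda>] integral_Y[OF that l, of ?h]; measurable)+
    have le: "?h' (Y d l i \<omega> - Y d l j \<omega>) \<le> ?h (Y d l i \<omega>) + ?h (Y d l j \<omega>)" for \<omega>
      by (rule min_square_cube_diff_le)
    have "(\<integral>\<omega>. ?h' (Y d l i \<omega> - Y d l j \<omega>) \<partial>M d) \<le> (\<integral>\<omega>. ?h (Y d l i \<omega>) + ?h (Y d l j \<omega>) \<partial>M d)"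
    proof (rule integral_mono[OF _ _ le])
      show i2: "integrable (M d) (\<lambda>\<omega>. ?h (Y d l i \<omega>) + ?h (Y d l j \<omega>))"
        by (rule Bochner_Integration.integrable_add[OF hY(1)[OF i] hY(1)[OF j]])
      have [measurable]: "Y d l i \<in> borel_measurable (M d)" "Y d l j \<in> borel_measurable (M d)"
        using Y_measurable i j l by auto
      have abs_mono: "\<bar>u\<bar> \<le> \<bar>v\<bar>" if "0 \<le> u" "u \<le> v" for u v :: real
        using that by simp
      have "norm (?h' (Y d l i \<omega> - Y d l j \<omega>)) \<le> norm (?h (Y d l i \<omega>) + ?h (Y d l j \<omega>))" for \<omega>
        unfolding real_norm_def by (rule abs_mono[OF _ le]) simp
      then show "integrable (M d) (\<lambda>\<omega>. ?h' (Y d l i \<omega> - Y d l j \<omega>))"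
        by (intro Bochner_Integration.integrable_bound[OF i2] AE_I2) measurable
    qed
    also have "\<dots> = \<Lambda> t k + \<Lambda> t k"
      by (simp only: Bochner_Integration.integral_add[OF hY(1)[OF i] hY(1)[OF j]] hY(2)[OF i] hY(2)[OF j])
    also have "\<dots> = 2 * \<Lambda> t k" by simp
    finally show "(\<integral>\<omega>. ?h' (Y d l i \<omega> - Y d l j \<omega>) \<partial>M d) \<le> 2 * \<Lambda> t k" .
  qed (use i j in auto)
qed

text \<open>
  Triples \<open>(d, a, k)\<close> encode the block \<open>{a<..a + k}\<close> of steps in dimension \<open>d\<close>; the filter demands large
  \<open>d\<close> and \<open>k\<close>, uniformly in \<open>a\<close>.
\<close>

definition large :: "(nat \<times> nat \<times> nat) filter" where
  "large = filtercomap (\<lambda>(d, a, k). min d k) at_top"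

lemma eventually_large: "eventually P large \<longleftrightarrow> (\<exists>K. \<forall>d a k. K \<le> d \<longrightarrow> K \<le> k \<longrightarrow> P (d, a, k))"
  unfolding large_def eventually_filtercomap_at_top_linorder by fastforce

lemma filterlim_large_fst: "filterlim (\<lambda>z. fst z) sequentially large"
  unfolding filterlim_at_top eventually_large by auto

lemma filterlim_large_snd: "filterlim (\<lambda>z. snd (snd z)) sequentially large"
  unfolding filterlim_at_top eventually_large by auto

text \<open>An expected modulus, hence subadditive in \<open>f\<close>, as a function of the triple,
  so that convergence uniform in \<open>a\<close> becomes a plain limit along
  \<open>large\<close>.\<close>

definition empirical_error :: "(real \<Rightarrow> complex) \<Rightarrow> nat \<times> nat \<times> nat \<Rightarrow> real" where
  "empirical_error f = (\<lambda>(d, a, k). \<integral>\<omega>. cmod ((\<Sum>i<d. f (T d a k i \<omega>)) / d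
     - (CLINT x|std_normal_distribution. f (\<sigma> * x))) \<partial>M d)"

text \<open>Boundedness and measurability are built in because they supply the integrability on
  which linearity rests. The class is shown to be closed under linear combinations only, not under
  products.\<close>

definition empirical_conv :: "(real \<Rightarrow> complex) \<Rightarrow> bool" where
  "empirical_conv f \<longleftrightarrow> f \<in> borel_measurable borel \<and> (\<exists>B. \<forall>x. cmod (f x) \<le> B) \<and> (empirical_error f \<longlongrightarrow> 0) large"

lemma empirical_conv_measurable: "empirical_conv f \<Longrightarrow> f \<in> borel_measurable borel"
  by (simp add: empirical_conv_def)

lemma integrable_bounded_normal:
  fixes f :: "real \<Rightarrow> complex"
  assumes [measurable]: "f \<in> borel_measurable borel" and B: "\<And>x. cmod (f x) \<le> B"
  shows "complex_integrable std_normal_distribution (\<lambda>x. f (\<sigma> * x))"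
proof -
  interpret real_distribution std_normal_distribution by (rule real_dist_normal_dist)
  show ?thesis by (rule integrable_const_bound[where B = B]) (auto simp: B)
qed

lemma integrable_empirical_error:
  assumes [measurable]: "f \<in> borel_measurable borel" and B: "\<And>x. cmod (f x) \<le> B" and d: "0 < d"
  shows "integrable (M d) (\<lambda>\<omega>. cmod ((\<Sum>i<d. f (T d a k i \<omega>)) / d - c))"
proof -
  interpret prob_space "M d" using prob_space_M d by simp
  have [measurable]: "(\<lambda>\<omega>. f (T d a k i \<omega>)) \<in> borel_measurable (M d)" if "i < d" for i
    using T_measurable[OF that] by measurable
  have "complex_integrable (M d) (\<lambda>\<omega>. (\<Sum>i<d. f (T d a k i \<omega>)) / d - c)"
  proof (intro Bochner_Integration.integrable_diff integrable_divide_zero Bochner_Integration.integrable_sum impI)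
    show "complex_integrable (M d) (\<lambda>\<omega>. f (T d a k i \<omega>))" if "i \<in> {..<d}" for i
      using that by (intro integrable_const_bound[where B = B]) (auto simp: B)
  qed simp
  then show ?thesis by (rule integrable_norm)
qed

lemma empirical_conv_add:
  assumes f: "empirical_conv f" and g: "empirical_conv g"
  shows "empirical_conv (\<lambda>x. f x + g x)"
proof -
  obtain B C where B: "\<And>x. cmod (f x) \<le> B" and C: "\<And>x. cmod (g x) \<le> C"
    using f g unfolding empirical_conv_def by blast
  note [measurable] = empirical_conv_measurable[OF f] empirical_conv_measurable[OF g]
  have bound: "empirical_error (\<lambda>x. f x + g x) (d, a, k) \<le> empirical_error f (d, a, k) + empirical_error g (d, a, k)" if d: "0 < d" for d a k
  proof -
    note I = integrable_empirical_error[OF _ B d] integrable_empirical_error[OF _ C d]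
    let ?cf = "CLINT x|std_normal_distribution. f (\<sigma> * x)" and ?cg = "CLINT x|std_normal_distribution. g (\<sigma> * x)"
    have FG: "cmod (f x + g x) \<le> B + C" for x
      using B[of x] C[of x] norm_triangle_ineq[of "f x" "g x"] by linarith
    have c: "(CLINT x|std_normal_distribution. f (\<sigma> * x) + g (\<sigma> * x)) = ?cf + ?cg"
      by (rule Bochner_Integration.integral_add) (auto intro: integrable_bounded_normal B C)
    have "empirical_error (\<lambda>x. f x + g x) (d, a, k) \<le> (\<integral>\<omega>. cmod ((\<Sum>i<d. f (T d a k i \<omega>)) / d - ?cf)
        + cmod ((\<Sum>i<d. g (T d a k i \<omega>)) / d - ?cg) \<partial>M d)"
      unfolding empirical_error_def prod.case c
    proof (rule integral_mono)
      show "integrable (M d) (\<lambda>\<omega>. cmod ((\<Sum>i<d. f (T d a k i \<omega>) + g (T d a k i \<omega>)) / d - (?cf + ?cg)))"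
        by (rule integrable_empirical_error[OF _ FG d]) measurable
      show "integrable (M d) (\<lambda>\<omega>. cmod ((\<Sum>i<d. f (T d a k i \<omega>)) / d - ?cf)
          + cmod ((\<Sum>i<d. g (T d a k i \<omega>)) / d - ?cg))"
        by (intro Bochner_Integration.integrable_add I) measurable
      show "cmod ((\<Sum>i<d. f (T d a k i \<omega>) + g (T d a k i \<omega>)) / d - (?cf + ?cg)) \<le>
          cmod ((\<Sum>i<d. f (T d a k i \<omega>)) / d - ?cf) + cmod ((\<Sum>i<d. g (T d a k i \<omega>)) / d - ?cg)" for \<omega>
        using norm_triangle_ineq[of "(\<Sum>i<d. f (T d a k i \<omega>)) / d - ?cf" "(\<Sum>i<d. g (T d a k i \<omega>)) / d - ?cg"]
        by (simp add: sum.distrib add_divide_distrib algebra_simps)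
    qed
    also have "\<dots> = empirical_error f (d, a, k) + empirical_error g (d, a, k)"
      unfolding empirical_error_def prod.case
      by (intro Bochner_Integration.integral_add I) measurable
    finally show ?thesis .
  qed
  have "(empirical_error (\<lambda>x. f x + g x) \<longlongrightarrow> 0) large"
  proof (rule tendsto_sandwich)
    show "eventually (\<lambda>z. 0 \<le> empirical_error (\<lambda>x. f x + g x) z) large"
      unfolding empirical_error_def by (intro always_eventually) (auto split: prod.split)
    show "eventually (\<lambda>z. empirical_error (\<lambda>x. f x + g x) z \<le> empirical_error f z + empirical_error g z) large"
      unfolding eventually_large using bound by (intro exI[of _ 1]) auto
    show "((\<lambda>z. empirical_error f z + empirical_error g z) \<longlongrightarrow> 0) large"
      using tendsto_add[of "empirical_error f" 0 large "empirical_error g" 0] f g unfolding empirical_conv_def by simp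
  qed simp
  moreover have "\<exists>B. \<forall>x. cmod (f x + g x) \<le> B"
    using norm_triangle_ineq order_trans add_mono[OF B C] by blast
  ultimately show ?thesis unfolding empirical_conv_def by auto
qed

lemma empirical_conv_mult_left:
  assumes f: "empirical_conv f"
  shows "empirical_conv (\<lambda>x. c * f x)"
proof -
  obtain B where B: "\<And>x. cmod (f x) \<le> B"
    using f unfolding empirical_conv_def by blast
  note [measurable] = empirical_conv_measurable[OF f]
  have "empirical_error (\<lambda>x. c * f x) z = cmod c * empirical_error f z" for z
  proof (cases z)
    case (fields d a k)
    let ?cf = "CLINT x|std_normal_distribution. f (\<sigma> * x)"
    have "(CLINT x|std_normal_distribution. c * f (\<sigma> * x)) = c * ?cf"
      by (rule integral_mult_right_zero)
    then have "cmod ((\<Sum>i<d. c * f (T d a k i \<omega>)) / d - (CLINT x|std_normal_distribution. c * f (\<sigma> * x))) =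
        cmod c * cmod ((\<Sum>i<d. f (T d a k i \<omega>)) / d - ?cf)" for \<omega>
      by (simp add: norm_mult[symmetric] sum_distrib_left[symmetric] right_diff_distrib)
    then show ?thesis unfolding fields empirical_error_def by simp
  qed
  then have eq: "empirical_error (\<lambda>x. c * f x) = (\<lambda>z. cmod c * empirical_error f z)" by (rule ext)
  have "(empirical_error (\<lambda>x. c * f x) \<longlongrightarrow> 0) large"
    unfolding eq using tendsto_mult_left[of "empirical_error f" 0 large "cmod c"] f unfolding empirical_conv_def by simp
  moreover have "\<exists>B. \<forall>x. cmod (c * f x) \<le> B"
    unfolding norm_mult using mult_left_mono[OF B norm_ge_zero] by blast
  ultimately show ?thesis unfolding empirical_conv_def by auto
qed

lemma empirical_conv_sum:
  assumes "\<And>i. i \<in> I \<Longrightarrow> empirical_conv (f i)"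
  shows "empirical_conv (\<lambda>x. \<Sum>i\<in>I. f i x)"
proof -
  have "empirical_conv (\<lambda>_. 0)"
    unfolding empirical_conv_def empirical_error_def by (auto intro!: exI[of _ 0] simp: case_prod_unfold)
  then show ?thesis
    using assms by (induction I rule: infinite_finite_induct) (auto intro: empirical_conv_add)
qed

text \<open>A second-moment computation. The diagonal pairs contribute \<open>1 / d\<close>, the
  other pairs at most \<open>\<beta> t k\<close>, and the cross term with the limit \<open>c\<close>
  at most \<open>2 * \<beta> t k\<close>, since \<open>c\<close> is at most 1; the terms in
  \<open>c\<^sup>2\<close> cancel.\<close>

lemma empirical_error_iexp_le:
  assumes d: "0 < d" and k: "0 < k"
  shows "empirical_error (\<lambda>x. iexp (t * x)) (d, a, k) \<le> sqrt (1 / d + 3 * \<beta> t k)"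
proof -
  interpret prob_space "M d" using prob_space_M d by simp
  define c where "c = exp (- (t\<^sup>2 * \<sigma>\<^sup>2 / 2))"
  have c: "0 \<le> c" "c \<le> 1" by (auto simp: c_def)
  define \<theta> where "\<theta> i \<omega> = t * T d a k i \<omega>" for i \<omega>
  define \<Phi> where "\<Phi> \<omega> = cmod ((\<Sum>i<d. iexp (\<theta> i \<omega>)) / d - complex_of_real c)" for \<omega>
  have [measurable]: "\<theta> i \<in> borel_measurable (M d)" if "i < d" for i
    using T_measurable[OF that] unfolding \<theta>_def by measurable
  have "char std_normal_distribution (t * \<sigma>) = complex_of_real c"
    by (simp add: char_std_normal_distribution c_def power_mult_distrib)
  then have lim: "(CLINT x|std_normal_distribution. iexp (t * (\<sigma> * x))) = complex_of_real c"
    by (simp add: char_def mult.assoc)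
  have \<Phi>_int: "integrable (M d) \<Phi>"
    unfolding \<Phi>_def \<theta>_def
    by (rule integrable_empirical_error[OF _ _ d, where B = 1 and f = "\<lambda>x. iexp (t * x)"]) auto
  have \<Phi>_sq: "(\<Phi> \<omega>)\<^sup>2 = (\<Sum>i<d. \<Sum>j<d. cos (\<theta> i \<omega> - \<theta> j \<omega>)) / d\<^sup>2
      - 2 * c * ((\<Sum>i<d. cos (\<theta> i \<omega>)) / d) + c\<^sup>2" for \<omega>
  proof -
    let ?z = "(\<Sum>i<d. iexp (\<theta> i \<omega>)) / d"
    have "(\<Phi> \<omega>)\<^sup>2 = (cmod ?z)\<^sup>2 - 2 * c * Re ?z + c\<^sup>2"
      unfolding \<Phi>_def cmod_power2 by (simp add: power2_eq_square algebra_simps)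
    moreover have "(cmod ?z)\<^sup>2 = (\<Sum>i<d. \<Sum>j<d. cos (\<theta> i \<omega> - \<theta> j \<omega>)) / d\<^sup>2"
      unfolding norm_sum_iexp_square[symmetric] by (simp add: norm_divide power_divide)
    moreover have "Re ?z = (\<Sum>i<d. cos (\<theta> i \<omega>)) / d"
      by (simp add: Re_divide_of_nat Re_exp)
    ultimately show ?thesis by (simp only:)
  qed
  have cos_int: "integrable (M d) (\<lambda>\<omega>. cos (\<theta> i \<omega>))" if "i < d" for i
    using that by (intro integrable_const_bound[where B = 1]) auto
  have cos_int2: "integrable (M d) (\<lambda>\<omega>. cos (\<theta> i \<omega> - \<theta> j \<omega>))" if "i < d" "j < d" for i j
    using that by (intro integrable_const_bound[where B = 1]) auto
  have \<beta>: "0 \<le> \<beta> t k" using cos_T_bound[OF d k, of t a] by linarith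
  have E1: "c - \<beta> t k \<le> expectation (\<lambda>\<omega>. cos (\<theta> i \<omega>))" if "i < d" for i
    using cos_T_bound[OF that k, of t a] by (simp add: \<theta>_def c_def abs_le_iff)
  have E2: "expectation (\<lambda>\<omega>. cos (\<theta> i \<omega> - \<theta> j \<omega>)) \<le> c\<^sup>2 + \<beta> t k + (if i = j then 1 else 0)"
    if "i < d" "j < d" for i j
  proof (cases "i = j")
    case True
    then show ?thesis using \<beta> by (simp add: prob_space)
  next
    case False
    then show ?thesis
      using cos_T_diff_bound[OF that False k, of t a]
      by (simp add: \<theta>_def c_def abs_le_iff right_diff_distrib)
  qed
  define A where "A \<omega> = (\<Sum>i<d. \<Sum>j<d. cos (\<theta> i \<omega> - \<theta> j \<omega>))" for \<omega>
  define B where "B \<omega> = (\<Sum>i<d. cos (\<theta> i \<omega>))" for \<omega>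
  have A: "integrable (M d) A" "expectation A = (\<Sum>i<d. \<Sum>j<d. expectation (\<lambda>\<omega>. cos (\<theta> i \<omega> - \<theta> j \<omega>)))"
    and B: "integrable (M d) B" "expectation B = (\<Sum>i<d. expectation (\<lambda>\<omega>. cos (\<theta> i \<omega>)))"
  proof -
    show "integrable (M d) A" "integrable (M d) B"
      unfolding A_def B_def
      by (intro Bochner_Integration.integrable_sum cos_int cos_int2; simp)+
    show "expectation B = (\<Sum>i<d. expectation (\<lambda>\<omega>. cos (\<theta> i \<omega>)))"
      unfolding B_def by (intro Bochner_Integration.integral_sum cos_int) simp
    have "expectation A = (\<Sum>i<d. expectation (\<lambda>\<omega>. \<Sum>j<d. cos (\<theta> i \<omega> - \<theta> j \<omega>)))"
      unfolding A_def by (intro Bochner_Integration.integral_sum Bochner_Integration.integrable_sum cos_int2) auto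
    also have "\<dots> = (\<Sum>i<d. \<Sum>j<d. expectation (\<lambda>\<omega>. cos (\<theta> i \<omega> - \<theta> j \<omega>)))"
      by (intro sum.cong refl Bochner_Integration.integral_sum cos_int2) auto
    finally show "expectation A = (\<Sum>i<d. \<Sum>j<d. expectation (\<lambda>\<omega>. cos (\<theta> i \<omega> - \<theta> j \<omega>)))" .
  qed
  note \<Phi>_sq = \<Phi>_sq[folded A_def B_def]
  have "expectation (\<lambda>\<omega>. (\<Phi> \<omega>)\<^sup>2) = (\<Sum>i<d. \<Sum>j<d. expectation (\<lambda>\<omega>. cos (\<theta> i \<omega> - \<theta> j \<omega>))) / d\<^sup>2
      - 2 * c * ((\<Sum>i<d. expectation (\<lambda>\<omega>. cos (\<theta> i \<omega>))) / d) + c\<^sup>2"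
    unfolding \<Phi>_sq A(2)[symmetric] B(2)[symmetric] using A(1) B(1) by (simp add: prob_space)
  also have "\<dots> \<le> (\<Sum>i<d. \<Sum>j<d. c\<^sup>2 + \<beta> t k + (if i = j then 1 else 0)) / d\<^sup>2
      - 2 * c * ((\<Sum>i<d. c - \<beta> t k) / d) + c\<^sup>2"
    using E1 E2 c by (intro add_right_mono diff_mono divide_right_mono mult_left_mono sum_mono) auto
  also have "(\<Sum>i<d. \<Sum>j<d. c\<^sup>2 + \<beta> t k + (if i = j then 1 else 0)) = d\<^sup>2 * (c\<^sup>2 + \<beta> t k) + d"
    by (simp add: sum.distrib power2_eq_square algebra_simps)
  also have "(d\<^sup>2 * (c\<^sup>2 + \<beta> t k) + d) / d\<^sup>2 - 2 * c * ((\<Sum>i<d. c - \<beta> t k) / d) + c\<^sup>2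
      = 1 / d + \<beta> t k + 2 * (c * \<beta> t k)"
  proof -
    have 1: "(\<Sum>i<d. c - \<beta> t k) / d = c - \<beta> t k" using d by simp
    have 2: "(d\<^sup>2 * (c\<^sup>2 + \<beta> t k) + d) / d\<^sup>2 = c\<^sup>2 + \<beta> t k + 1 / d"
      using d by (simp add: add_divide_distrib power2_eq_square)
    show ?thesis unfolding 1 2 by (simp add: power2_eq_square algebra_simps)
  qed
  also have "\<dots> \<le> 1 / d + 3 * \<beta> t k"
    using mult_right_mono[OF c(2) \<beta>] by simp
  finally have E\<Phi>: "expectation (\<lambda>\<omega>. (\<Phi> \<omega>)\<^sup>2) \<le> 1 / d + 3 * \<beta> t k" .
  have "empirical_error (\<lambda>x. iexp (t * x)) (d, a, k) = expectation \<Phi>"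
    unfolding empirical_error_def prod.case lim \<Phi>_def \<theta>_def ..
  also have "\<dots> \<le> sqrt (expectation (\<lambda>\<omega>. (\<Phi> \<omega>)\<^sup>2))"
  proof (rule expectation_le_sqrt[OF \<Phi>_int])
    show "integrable (M d) (\<lambda>\<omega>. (\<Phi> \<omega>)\<^sup>2)"
      unfolding \<Phi>_sq using A(1) B(1) by simp
  qed
  also have "\<dots> \<le> sqrt (1 / d + 3 * \<beta> t k)" using E\<Phi> by simp
  finally show ?thesis .
qed

lemma empirical_conv_iexp: "empirical_conv (\<lambda>x. iexp (t * x))"
proof -
  have "(empirical_error (\<lambda>x. iexp (t * x)) \<longlongrightarrow> 0) large"
  proof (rule tendsto_sandwich)
    show "eventually (\<lambda>z. 0 \<le> empirical_error (\<lambda>x. iexp (t * x)) z) large"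
      unfolding empirical_error_def by (intro always_eventually) (auto split: prod.split)
    show "eventually (\<lambda>z. empirical_error (\<lambda>x. iexp (t * x)) z \<le> sqrt (1 / fst z + 3 * \<beta> t (snd (snd z)))) large"
      unfolding eventually_large using empirical_error_iexp_le by (intro exI[of _ 1]) auto
    have "((\<lambda>z. 1 / real (fst z)) \<longlongrightarrow> 0) large"
      by (rule filterlim_compose[OF lim_1_over_n filterlim_large_fst])
    moreover have "((\<lambda>z. \<beta> t (snd (snd z))) \<longlongrightarrow> 0) large"
      by (rule filterlim_compose[OF \<beta>_tendsto filterlim_large_snd])
    ultimately have "((\<lambda>z. sqrt (1 / fst z + 3 * \<beta> t (snd (snd z)))) \<longlongrightarrow> sqrt (0 + 3 * 0)) large"
      by (intro tendsto_real_sqrt tendsto_add tendsto_mult tendsto_const)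
    then show "((\<lambda>z. sqrt (1 / fst z + 3 * \<beta> t (snd (snd z)))) \<longlongrightarrow> 0) large" by simp
  qed simp
  moreover have "(\<lambda>x. iexp (t * x)) \<in> borel_measurable borel"
    by (intro borel_measurable_continuous_onI continuous_intros)
  ultimately show ?thesis unfolding empirical_conv_def by (auto intro!: exI[of _ 1])
qed

lemma empirical_conv_cos_power: "empirical_conv (\<lambda>x. of_real (cos (b * x) ^ m) * iexp (t * x))"
proof (induction m arbitrary: t)
  case 0
  then show ?case using empirical_conv_iexp by simp
next
  case (Suc m)
  have eq: "complex_of_real (cos (b * x) ^ Suc m) * iexp (t * x) =
      1 / 2 * (of_real (cos (b * x) ^ m) * iexp ((t + b) * x))
      + 1 / 2 * (of_real (cos (b * x) ^ m) * iexp ((t - b) * x))" for x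
  proof -
    have 1: "complex_of_real (cos (b * x)) = (iexp (b * x) + iexp (- (b * x))) / 2"
      by (simp add: cos_exp_eq cos_of_real[symmetric] mult.commute)
    have 2: "iexp ((t + b) * x) = iexp (t * x) * iexp (b * x)"
      "iexp ((t - b) * x) = iexp (t * x) * iexp (- (b * x))"
      by (simp_all add: exp_add[symmetric] algebra_simps)
    have "(P + Q) / 2 * R * E = 1 / 2 * (R * (E * P)) + 1 / 2 * (R * (E * Q))" for P Q R E :: complex
      by (simp add: field_simps)
    then show ?thesis unfolding power_Suc of_real_mult[of "cos (b * x)"] 1 2 .
  qed
  show ?case unfolding eq by (intro empirical_conv_add empirical_conv_mult_left Suc)
qed

lemma empirical_conv_cos_polynomial: "empirical_conv (\<lambda>x. of_real (\<Sum>i\<le>m. c i * cos (b * x) ^ i))"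
proof -
  have "empirical_conv (\<lambda>x. \<Sum>i\<le>m. of_real (c i) * (of_real (cos (b * x) ^ i) * iexp (0 * x)))"
    by (intro empirical_conv_sum empirical_conv_mult_left empirical_conv_cos_power)
  then show ?thesis by simp
qed

section \<open>From cosine polynomials to p-th absolute powers\<close>

definition limit_moment :: real where
  "limit_moment = (\<integral>x. \<bar>\<sigma> * x\<bar> powr p \<partial>std_normal_distribution)"

lemma integrable_normal_powr: "0 \<le> q \<Longrightarrow> integrable std_normal_distribution (\<lambda>x. \<bar>\<sigma> * x\<bar> powr q)"
  using integrable_std_normal_powr[of q] by (simp add: abs_mult powr_mult)

lemma integrable_T_powr: "i < d \<Longrightarrow> integrable (M d) (\<lambda>\<omega>. \<bar>T d a k i \<omega>\<bar> powr p)"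
proof -
  assume i: "i < d"
  interpret prob_space "M d" using prob_space_M i by simp
  have "integrable (M d) (\<lambda>\<omega>. \<bar>T d a k i \<omega>\<bar> powr (2 * p))"
    by (rule T_moment) (use i in auto)
  from integrable_powr_le[OF T_measurable[OF i] this, of p] show ?thesis using p by simp
qed

lemma integrable_W: "integrable (M d) (W d a k)"
  unfolding W_def by (cases "d = 0") (auto intro!: integrable_T_powr integrable_divide_zero)

lemma W_nonneg: "0 \<le> W d a k \<omega>"
  unfolding W_def by (intro divide_nonneg_nonneg sum_nonneg) auto

text \<open>Needed for the blocks too short for \<open>W_converges\<close>; it therefore has to hold
  for every \<open>k\<close>.\<close>

lemma W_bounded: obtains B where "B > 0" "\<And>d a k. 0 < d \<Longrightarrow> (\<integral>\<omega>. \<bar>W d a k \<omega> - limit_moment\<bar> \<partial>M d) \<le> B"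
proof -
  obtain B where B: "B > 0" "\<And>d a k i. i < d \<Longrightarrow> integrable (M d) (\<lambda>\<omega>. \<bar>T d a k i \<omega>\<bar> powr (2 * p))"
    "\<And>d a k i. i < d \<Longrightarrow> (\<integral>\<omega>. \<bar>T d a k i \<omega>\<bar> powr (2 * p) \<partial>M d) \<le> B"
    using T_moment by blast
  have "(\<integral>\<omega>. \<bar>W d a k \<omega> - limit_moment\<bar> \<partial>M d) \<le> 1 + B + \<bar>limit_moment\<bar>" if d: "0 < d" for d a k
  proof -
    interpret prob_space "M d" using prob_space_M d by simp
    have T: "(\<integral>\<omega>. \<bar>T d a k i \<omega>\<bar> powr p \<partial>M d) \<le> 1 + B" if i: "i < d" for i
    proof -
      have "(\<integral>\<omega>. \<bar>T d a k i \<omega>\<bar> powr p \<partial>M d) \<le> (\<integral>\<omega>. 1 + \<bar>T d a k i \<omega>\<bar> powr (2 * p) \<partial>M d)"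
      proof (rule integral_mono[OF integrable_T_powr[OF i]])
        show "integrable (M d) (\<lambda>\<omega>. 1 + \<bar>T d a k i \<omega>\<bar> powr (2 * p))" using B(2)[OF i] by simp
        have "x powr p \<le> 1 + x powr (2 * p)" if "0 \<le> x" for x :: real
        proof -
          have "x powr (2 * p) = x powr p * x powr p" by (simp flip: powr_add)
          moreover have "y \<le> 1 + y * y" for y :: real
            using sum_squares_bound[of y 1] zero_le_square[of y] unfolding power2_eq_square by linarith
          ultimately show ?thesis by simp
        qed
        then show "\<bar>T d a k i \<omega>\<bar> powr p \<le> 1 + \<bar>T d a k i \<omega>\<bar> powr (2 * p)" for \<omega>
          by simp
      qed
      also have "\<dots> \<le> 1 + B" using B(2,3)[OF i] by (simp add: prob_space)
      finally show ?thesis .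
    qed
    have "(\<integral>\<omega>. \<bar>W d a k \<omega> - limit_moment\<bar> \<partial>M d) \<le> (\<integral>\<omega>. W d a k \<omega> + \<bar>limit_moment\<bar> \<partial>M d)"
    proof (rule integral_mono)
      show "\<bar>W d a k \<omega> - limit_moment\<bar> \<le> W d a k \<omega> + \<bar>limit_moment\<bar>" for \<omega>
        using W_nonneg[of d a k \<omega>] by linarith
    qed (auto intro!: integrable_W)
    also have "\<dots> = (\<Sum>i<d. \<integral>\<omega>. \<bar>T d a k i \<omega>\<bar> powr p \<partial>M d) / d + \<bar>limit_moment\<bar>"
    proof -
      have "expectation (W d a k) = (\<Sum>i<d. \<integral>\<omega>. \<bar>T d a k i \<omega>\<bar> powr p \<partial>M d) / d"
        unfolding W_def integral_divide_zero using integrable_T_powr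
        by (subst Bochner_Integration.integral_sum) auto
      then show ?thesis using integrable_W[of d a k] by (simp add: prob_space)
    qed
    also have "\<dots> \<le> (\<Sum>i<d. 1 + B) / d + \<bar>limit_moment\<bar>"
      using T by (intro add_right_mono divide_right_mono sum_mono) auto
    also have "\<dots> = 1 + B + \<bar>limit_moment\<bar>" using d by simp
    finally show ?thesis .
  qed
  moreover have "1 + B + \<bar>limit_moment\<bar> > 0" using B(1) by linarith
  ultimately show thesis using that by blast
qed

lemma W_converges:
  assumes \<delta>: "0 < \<delta>"
  obtains K where "\<And>d a k. K \<le> d \<Longrightarrow> K \<le> k \<Longrightarrow> (\<integral>\<omega>. \<bar>W d a k \<omega> - limit_moment\<bar> \<partial>M d) \<le> \<delta>"
proof -
  obtain B where B: "B > 0" "\<And>d a k i. i < d \<Longrightarrow> integrable (M d) (\<lambda>\<omega>. \<bar>T d a k i \<omega>\<bar> powr (2 * p))"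
    "\<And>d a k i. i < d \<Longrightarrow> (\<integral>\<omega>. \<bar>T d a k i \<omega>\<bar> powr (2 * p) \<partial>M d) \<le> B"
    using T_moment by blast
  define C where "C = (\<integral>x. \<bar>\<sigma> * x\<bar> powr (2 * p) \<partial>std_normal_distribution)"
  have C: "C \<ge> 0" by (simp add: C_def)
  \<comment> \<open>\<open>B\<close> and \<open>C\<close> bound the moments of order
    \<open>2 * p\<close> of \<open>T\<close> and of the normal limit, so this \<open>A\<close> makes
    the two truncation errors add up to \<open>\<delta> / 4\<close>. The two uniform approximation
    errors add up to another \<open>\<delta> / 4\<close>, as does the empirical error of the
    polynomial.\<close>
  define A where "A = ((B + C) * 4 / \<delta>) powr (1 / p)"
  have A: "A > 0" "A powr p = (B + C) * 4 / \<delta>"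
    using B(1) C \<delta> p by (simp_all add: A_def powr_powr)
  have BC: "B / A powr p + C / A powr p = \<delta> / 4"
  proof -
    have "x / (x * 4 / \<delta>) = \<delta> / 4" if "0 < x" for x using that by simp
    from this[of "B + C"] show ?thesis
      unfolding A(2) add_divide_distrib[symmetric] using B(1) C by simp
  qed
  obtain q :: "nat \<Rightarrow> real" and m where
    q: "\<And>x. \<bar>\<bar>x\<bar> powr p - (\<Sum>i\<le>m. q i * cos (pi / A * x) ^ i)\<bar> \<le> \<delta> / 8 + \<bar>x\<bar> powr (2 * p) / A powr p"
    using powr_cosine_approximation[of p A "\<delta> / 8"] p A(1) \<delta> by auto
  define Q where "Q x = (\<Sum>i\<le>m. q i * cos (pi / A * x) ^ i)" for x
  have Q: "\<bar>\<bar>x\<bar> powr p - Q x\<bar> \<le> \<delta> / 8 + \<bar>x\<bar> powr (2 * p) / A powr p" for x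
    using q unfolding Q_def .
  have empirical_conv: "empirical_conv (\<lambda>x. of_real (Q x))" unfolding Q_def by (rule empirical_conv_cos_polynomial)
  then obtain b where b: "\<And>x. cmod (of_real (Q x)) \<le> b" unfolding empirical_conv_def by blast
  have Q_meas [measurable]: "Q \<in> borel_measurable borel" unfolding Q_def by measurable
  have Qc_meas [measurable]: "(\<lambda>x. complex_of_real (Q x)) \<in> borel_measurable borel" by measurable
  define Qlim where "Qlim = (\<integral>x. Q (\<sigma> * x) \<partial>std_normal_distribution)"
  interpret \<gamma>: real_distribution std_normal_distribution by (rule real_dist_normal_dist)
  have limit_close: "\<bar>Qlim - limit_moment\<bar> \<le> \<delta> / 8 + C / A powr p"
  proof -
    have I: "integrable std_normal_distribution (\<lambda>x. Q (\<sigma> * x))"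
      by (rule \<gamma>.integrable_const_bound[where B = b]) (use b in auto)
    note J = integrable_normal_powr[of p] integrable_normal_powr[of "2 * p"]
    have "Qlim - limit_moment = (\<integral>x. Q (\<sigma> * x) - \<bar>\<sigma> * x\<bar> powr p \<partial>std_normal_distribution)"
      unfolding Qlim_def limit_moment_def using I J p by (intro Bochner_Integration.integral_diff[symmetric]) auto
    also have "\<bar>\<dots>\<bar> \<le> (\<integral>x. \<bar>Q (\<sigma> * x) - \<bar>\<sigma> * x\<bar> powr p\<bar> \<partial>std_normal_distribution)"
      by (rule integral_abs_bound)
    also have "\<dots> \<le> (\<integral>x. \<delta> / 8 + \<bar>\<sigma> * x\<bar> powr (2 * p) / A powr p \<partial>std_normal_distribution)"
    proof (rule integral_mono)
      show "integrable std_normal_distribution (\<lambda>x. \<bar>Q (\<sigma> * x) - \<bar>\<sigma> * x\<bar> powr p\<bar>)"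
        using I J p by (intro integrable_abs Bochner_Integration.integrable_diff) auto
      show "integrable std_normal_distribution (\<lambda>x. \<delta> / 8 + \<bar>\<sigma> * x\<bar> powr (2 * p) / A powr p)"
        using J p by (intro Bochner_Integration.integrable_add integrable_divide_zero) auto
      show "\<bar>Q (\<sigma> * x) - \<bar>\<sigma> * x\<bar> powr p\<bar> \<le> \<delta> / 8 + \<bar>\<sigma> * x\<bar> powr (2 * p) / A powr p" for x
        using Q[of "\<sigma> * x"] by (simp add: abs_minus_commute)
    qed
    also have "\<dots> = \<delta> / 8 + C / A powr p"
      using J p \<gamma>.prob_space by (subst Bochner_Integration.integral_add) (auto simp: C_def)
    finally show ?thesis .
  qed
  have "eventually (\<lambda>z. empirical_error (\<lambda>x. of_real (Q x)) z < \<delta> / 4) large"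
    using empirical_conv \<delta> order_tendstoD(2)[of _ 0 large "\<delta> / 4"] unfolding empirical_conv_def by auto
  then obtain K where K: "\<And>d a k. K \<le> d \<Longrightarrow> K \<le> k \<Longrightarrow> empirical_error (\<lambda>x. of_real (Q x)) (d, a, k) < \<delta> / 4"
    unfolding eventually_large by blast
  show thesis
  proof (rule that[of "max 1 K"])
    fix d a k assume "max 1 K \<le> d" and "max 1 K \<le> k"
    then have d: "0 < d" and dk: "K \<le> d" "K \<le> k" by auto
    interpret prob_space "M d" using prob_space_M d by simp
    let ?E = "\<lambda>\<omega>. cmod ((\<Sum>i<d. complex_of_real (Q (T d a k i \<omega>))) / d - of_real Qlim)"
    let ?U = "\<lambda>\<omega>. (\<Sum>i<d. \<delta> / 8 + \<bar>T d a k i \<omega>\<bar> powr (2 * p) / A powr p) / d"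
    have E_int: "integrable (M d) ?E"
      by (rule integrable_empirical_error[OF Qc_meas b d])
    have E_le: "expectation ?E \<le> \<delta> / 4"
      using K[OF dk, of a] unfolding empirical_error_def prod.case integral_complex_of_real Qlim_def by simp
    have Ui: "integrable (M d) (\<lambda>\<omega>. \<delta> / 8 + \<bar>T d a k i \<omega>\<bar> powr (2 * p) / A powr p)" if "i < d" for i
      using B(2)[OF that] by (intro Bochner_Integration.integrable_add integrable_divide_zero) auto
    then have U_int: "integrable (M d) ?U"
      by (intro integrable_divide_zero Bochner_Integration.integrable_sum) auto
    have "expectation ?U = (\<Sum>i<d. \<delta> / 8 + (\<integral>\<omega>. \<bar>T d a k i \<omega>\<bar> powr (2 * p) \<partial>M d) / A powr p) / d"
    proof -
      have "expectation ?U = (\<Sum>i<d. expectation (\<lambda>\<omega>. \<delta> / 8 + \<bar>T d a k i \<omega>\<bar> powr (2 * p) / A powr p)) / d"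
        using Ui by (simp only: integral_divide_zero) (subst Bochner_Integration.integral_sum; simp)
      also have "\<dots> = (\<Sum>i<d. \<delta> / 8 + (\<integral>\<omega>. \<bar>T d a k i \<omega>\<bar> powr (2 * p) \<partial>M d) / A powr p) / d"
        using B(2) by (intro arg_cong2[where f = "(/)"] sum.cong refl)
          (subst Bochner_Integration.integral_add; simp add: prob_space)
      finally show ?thesis .
    qed
    also have "\<dots> \<le> (\<Sum>i<d. \<delta> / 8 + B / A powr p) / d"
      using B(3) by (intro divide_right_mono sum_mono add_left_mono) auto
    also have "\<dots> = \<delta> / 8 + B / A powr p" using d by simp
    finally have U_le: "expectation ?U \<le> \<delta> / 8 + B / A powr p" .
    have "\<bar>W d a k \<omega> - limit_moment\<bar> \<le> ?U \<omega> + ?E \<omega> + (\<delta> / 8 + C / A powr p)" for \<omega>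
    proof -
      have E_eq: "?E \<omega> = \<bar>(\<Sum>i<d. Q (T d a k i \<omega>)) / d - Qlim\<bar>"
      proof -
        have "(\<Sum>i<d. complex_of_real (Q (T d a k i \<omega>))) / d - of_real Qlim =
            of_real ((\<Sum>i<d. Q (T d a k i \<omega>)) / d - Qlim)" by simp
        then show ?thesis by (simp only: norm_of_real)
      qed
      have "\<bar>W d a k \<omega> - (\<Sum>i<d. Q (T d a k i \<omega>)) / d\<bar> =
          \<bar>\<Sum>i<d. \<bar>T d a k i \<omega>\<bar> powr p - Q (T d a k i \<omega>)\<bar> / d"
        by (simp add: W_def sum_subtractf diff_divide_distrib[symmetric])
      also have "\<dots> \<le> (\<Sum>i<d. \<bar>\<bar>T d a k i \<omega>\<bar> powr p - Q (T d a k i \<omega>)\<bar>) / d"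
        by (intro divide_right_mono sum_abs) auto
      also have "\<dots> \<le> ?U \<omega>"
        by (intro divide_right_mono sum_mono Q) auto
      finally show ?thesis using E_eq limit_close by linarith
    qed
    then have "(\<integral>\<omega>. \<bar>W d a k \<omega> - limit_moment\<bar> \<partial>M d) \<le>
        expectation (\<lambda>\<omega>. ?U \<omega> + ?E \<omega> + (\<delta> / 8 + C / A powr p))"
      using U_int E_int integrable_W by (intro integral_mono) auto
    also have "\<dots> = expectation ?U + expectation ?E + (\<delta> / 8 + C / A powr p)"
      using U_int E_int by (simp add: prob_space)
    also have "\<dots> \<le> \<delta>" using U_le E_le BC \<delta> by linarith
    finally show "(\<integral>\<omega>. \<bar>W d a k \<omega> - limit_moment\<bar> \<partial>M d) \<le> \<delta>" .
  qed
qed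

end

section \<open>Uniform control of the increments\<close>

lemma sqrt_diff_le: "\<bar>sqrt x - sqrt y\<bar> \<le> sqrt \<bar>x - y\<bar>" if "0 \<le> x" "0 \<le> y"
proof -
  have *: "sqrt u \<le> sqrt v + sqrt \<bar>u - v\<bar>" if "0 \<le> u" "0 \<le> v" for u v :: real
  proof -
    have "sqrt u \<le> sqrt (v + \<bar>u - v\<bar>)" by simp
    also have "\<dots> \<le> sqrt v + sqrt \<bar>u - v\<bar>" using that by (intro sqrt_add_le_add_sqrt) auto
    finally show ?thesis .
  qed
  show ?thesis using *[OF that] *[OF that(2,1)] by (simp add: abs_le_iff abs_minus_commute)
qed

context uncorrelated_arrays
begin

text \<open>
  \<open>D d n a b\<close> is \<open>\<parallel>n\<^bsup>-1/2\<^esup> (S\<^sub>b - S\<^sub>a)\<parallel>\<^sub>p\<close>.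
\<close>

definition D :: "nat \<Rightarrow> nat \<Rightarrow> nat \<Rightarrow> nat \<Rightarrow> 'w \<Rightarrow> real" where
  "D d n a b \<omega> = lp_norm p d (\<lambda>i. \<Sum>l\<in>{a<..b}. Y d l i \<omega>) / (sqrt n * d powr (1 / p))"

definition limit_scale :: real where
  "limit_scale = limit_moment powr (1 / p)"

lemma limit_moment_nonneg: "0 \<le> limit_moment"
  by (simp add: limit_moment_def)

lemma limit_scale_nonneg: "0 \<le> limit_scale"
  by (simp add: limit_scale_def)

lemma limit_scale_powr: "limit_scale powr p = limit_moment"
  using p limit_moment_nonneg by (simp add: limit_scale_def powr_powr)

lemma D_nonneg: "0 \<le> D d n a b \<omega>"
  by (simp add: D_def)

lemma D_measurable [measurable]: "D d n a b \<in> borel_measurable (M d)"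
  unfolding D_def
  by (intro borel_measurable_divide borel_measurable_lp_norm borel_measurable_sum Y_measurable) auto

lemma D_powr: "D d n a (a + k) \<omega> powr p = (k / n) powr (p / 2) * W d a k \<omega>"
proof -
  have "D d n a (a + k) \<omega> powr p = (\<Sum>i<d. \<bar>\<Sum>l\<in>{a<..a + k}. Y d l i \<omega>\<bar> powr p) / (n powr (p / 2) * d)"
    using p by (simp add: D_def powr_divide powr_mult powr_powr lp_norm_powr powr_half_sqrt[symmetric])
  also have "\<dots> = (k / n) powr (p / 2) * W d a k \<omega>"
  proof (cases "k = 0")
    case False
    then show ?thesis using p
      by (simp add: W_def T_def powr_divide abs_divide powr_powr powr_half_sqrt[symmetric]
          sum_divide_distrib[symmetric])
  qed (use p in simp)
  finally show ?thesis .
qed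

text \<open>Markov's inequality for the p-th power, at level
  \<open>q = \<delta> * \<epsilon> powr p\<close>. For \<open>k\<close> at least \<open>K0\<close>
  the law of large numbers bounds the expectation; for smaller \<open>k\<close> the factor
  (k/n)^(p/2) does, because \<open>n\<close> is large compared with \<open>K0\<close>. No bound ties
  \<open>a\<close> to \<open>n\<close>.\<close>

lemma D_deviation:
  assumes \<epsilon>: "0 < \<epsilon>" and \<delta>: "0 < \<delta>"
  obtains K where "\<And>d n a k. K \<le> d \<Longrightarrow> K \<le> n \<Longrightarrow> k \<le> n \<Longrightarrow>
    measure (M d) {\<omega> \<in> space (M d). \<epsilon> < \<bar>D d n a (a + k) \<omega> - limit_scale * sqrt (k / n)\<bar>} \<le> \<delta>"
proof -
  define q where "q = \<delta> * \<epsilon> powr p"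
  have q: "q > 0" using \<epsilon> \<delta> by (simp add: q_def)
  obtain K0 where K0: "\<And>d a k. K0 \<le> d \<Longrightarrow> K0 \<le> k \<Longrightarrow> (\<integral>\<omega>. \<bar>W d a k \<omega> - limit_moment\<bar> \<partial>M d) \<le> q"
    using W_converges[OF q] by blast
  obtain B where B: "B > 0" "\<And>d a k. 0 < d \<Longrightarrow> (\<integral>\<omega>. \<bar>W d a k \<omega> - limit_moment\<bar> \<partial>M d) \<le> B"
    using W_bounded by blast
  \<comment> \<open>The ratio k/n below which the factor (k/n)^(p/2) brings the bound
    \<open>B\<close> down to \<open>q\<close>.\<close>
  define s where "s = (q / B) powr (2 / p)"
  have s: "s > 0" "s powr (p / 2) = q / B" using q B p by (simp_all add: s_def powr_powr)
  define K where "K = Suc (max K0 (nat \<lceil>K0 / s\<rceil>))"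
  show thesis
  proof (rule that[of K])
    fix d n a k assume "K \<le> d" "K \<le> n" and k: "k \<le> n"
    then have d: "0 < d" "K0 \<le> d" and n: "0 < n" "K0 / s \<le> n"
      unfolding K_def by (auto simp: Suc_le_eq) linarith
    interpret prob_space "M d" using prob_space_M d by simp
    let ?u = "\<lambda>\<omega>. (k / n) powr (p / 2) * \<bar>W d a k \<omega> - limit_moment\<bar>"
    have u_int: "integrable (M d) ?u" using integrable_W[of d a k] by simp
    have u_le: "expectation ?u \<le> q"
    proof (cases "K0 \<le> k")
      case True
      have "(k / n) powr (p / 2) \<le> 1" using k n p by (intro powr_le1) auto
      then have "expectation ?u \<le> 1 * expectation (\<lambda>\<omega>. \<bar>W d a k \<omega> - limit_moment\<bar>)"
        unfolding integral_mult_right_zero by (intro mult_right_mono) auto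
      then show ?thesis using K0[OF d(2) True, of a] by simp
    next
      case False
      have "k / n \<le> K0 / n" using False by (intro divide_right_mono) auto
      also have "\<dots> \<le> s" using n s by (simp add: field_simps)
      finally have "(k / n) powr (p / 2) \<le> q / B" unfolding s(2)[symmetric] using p by (intro powr_mono2) auto
      then have "expectation ?u \<le> q / B * B"
        unfolding integral_mult_right_zero using B(2)[OF d(1), of a k] B(1) q by (intro mult_mono) auto
      then show ?thesis using B(1) by simp
    qed
    have "prob {\<omega> \<in> space (M d). \<epsilon> < \<bar>D d n a (a + k) \<omega> - limit_scale * sqrt (k / n)\<bar>}
        \<le> prob {\<omega> \<in> space (M d). \<epsilon> powr p \<le> ?u \<omega>}"
    proof (rule finite_measure_mono)
      show "{\<omega> \<in> space (M d). \<epsilon> powr p \<le> ?u \<omega>} \<in> events"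
        using borel_measurable_integrable[OF u_int] by measurable
      show "{\<omega> \<in> space (M d). \<epsilon> < \<bar>D d n a (a + k) \<omega> - limit_scale * sqrt (k / n)\<bar>}
        \<subseteq> {\<omega> \<in> space (M d). \<epsilon> powr p \<le> ?u \<omega>}"
      proof (safe)
        fix \<omega> assume "\<epsilon> < \<bar>D d n a (a + k) \<omega> - limit_scale * sqrt (k / n)\<bar>"
        then have "\<epsilon> powr p \<le> \<bar>D d n a (a + k) \<omega> - limit_scale * sqrt (k / n)\<bar> powr p"
          using \<epsilon> p by (intro powr_mono2) auto
        also have "\<dots> \<le> \<bar>D d n a (a + k) \<omega> powr p - (limit_scale * sqrt (k / n)) powr p\<bar>"
          using p D_nonneg limit_scale_nonneg by (intro powr_abs_diff_le) auto
        also have "(limit_scale * sqrt (k / n)) powr p = (k / n) powr (p / 2) * limit_moment"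
          by (simp add: powr_mult limit_scale_powr powr_half_sqrt[symmetric] powr_powr)
        also have "\<bar>D d n a (a + k) \<omega> powr p - (k / n) powr (p / 2) * limit_moment\<bar> = ?u \<omega>"
          unfolding D_powr right_diff_distrib[symmetric] abs_mult by simp
        finally show "\<epsilon> powr p \<le> ?u \<omega>" .
      qed
    qed
    also have "\<dots> \<le> expectation ?u / \<epsilon> powr p"
      by (rule integral_Markov_inequality_measure[where A = "{}"]) (use u_int \<epsilon> in auto)
    also have "\<dots> \<le> \<delta>" using u_le \<epsilon> by (simp add: q_def divide_le_eq)
    finally show "prob {\<omega> \<in> space (M d). \<epsilon> < \<bar>D d n a (a + k) \<omega> - limit_scale * sqrt (k / n)\<bar>} \<le> \<delta>" .
  qed
qed

lemma D_maximal:
  assumes d: "0 < d" and n: "0 < n"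
    and half: "\<And>k. k \<le> h \<Longrightarrow> measure (M d) {\<omega> \<in> space (M d). \<epsilon> < D d n (a + k) (a + h) \<omega>} \<le> 1 / 2"
  shows "measure (M d) {\<omega> \<in> space (M d). \<exists>k\<le>h. 2 * \<epsilon> < D d n a (a + k) \<omega>}
    \<le> 2 * measure (M d) {\<omega> \<in> space (M d). \<epsilon> < D d n a (a + h) \<omega>}"
proof -
  interpret prob_space "M d" using prob_space_M d by simp
  define s where "s = sqrt n * d powr (1 / p)"
  have s: "s > 0" using d n by (simp add: s_def)
  have scale: "e < D d n b c \<omega> \<longleftrightarrow>
      e * s < lp_norm p d (\<lambda>i. \<Sum>l\<in>{b<..c}. (\<lambda>i\<in>{..<d}. Y d l i \<omega>) i)" for e b c \<omega>
  proof -
    have "lp_norm p d (\<lambda>i. \<Sum>l\<in>{b<..c}. (\<lambda>i\<in>{..<d}. Y d l i \<omega>) i) = D d n b c \<omega> * s"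
      unfolding D_def s_def[symmetric] using s by (simp add: cong: lp_norm_cong)
    then show ?thesis using s by simp
  qed
  have "prob {\<omega> \<in> space (M d). \<exists>k\<le>h. 2 * (\<epsilon> * s) < lp_norm p d (\<lambda>i. \<Sum>l\<in>{a<..a + k}. (\<lambda>i\<in>{..<d}. Y d l i \<omega>) i)}
    \<le> 2 * prob {\<omega> \<in> space (M d). \<epsilon> * s < lp_norm p d (\<lambda>i. \<Sum>l\<in>{a<..a + h}. (\<lambda>i\<in>{..<d}. Y d l i \<omega>) i)}"
  proof (rule Ottaviani_inequality[OF p indep[OF d]])
    show "{a<..a + h} \<subseteq> {1..}" by auto
    show "prob {\<omega> \<in> space (M d). \<epsilon> * s < lp_norm p d (\<lambda>i. \<Sum>l\<in>{a + k<..a + h}. (\<lambda>i\<in>{..<d}. Y d l i \<omega>) i)} \<le> 1 / 2"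
      if "k \<le> h" for k
      unfolding scale[symmetric] by (rule half[OF that])
  qed
  then show ?thesis unfolding scale by (simp only: mult.assoc)
qed

text \<open>Cutting the block from \<open>a'\<close> to \<open>b\<close> at \<open>a\<close> and at
  \<open>b'\<close> gives two decompositions of the same sum. No order between \<open>a\<close> and
  \<open>b'\<close> is imposed, because \<open>a\<close> and \<open>b\<close> may lie in the same
  cell of the grid.\<close>

lemma D_triangle:
  assumes "a' \<le> a" "b' \<le> b" "a' \<le> b'" "a \<le> b"
  shows "\<bar>D d n a b \<omega> - D d n a' b' \<omega>\<bar> \<le> D d n a' a \<omega> + D d n b' b \<omega>"
proof -
  define s where "s = sqrt n * d powr (1 / p)"
  have s: "s \<ge> 0" by (simp add: s_def)
  define V where "V a b i = (\<Sum>l\<in>{a<..b}. Y d l i \<omega>)" for a b i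
  have add: "V u w i = V u v i + V v w i" if "u \<le> v" "v \<le> w" for u v w i
  proof -
    have "{u<..w} = {u<..v} \<union> {v<..w}" using that by auto
    then show ?thesis unfolding V_def by (simp add: sum.union_disjoint)
  qed
  let ?N = "lp_norm p d"
  have eq: "V a b i + V a' a i = V a' b' i + V b' b i" for i
    using add[of a' a b i] add[of a' b' b i] assms by simp
  have "V a b i = V a' b' i + (V b' b i + - V a' a i)" "V a' b' i = V a b i + (V a' a i + - V b' b i)" for i
    using eq[of i] by simp_all
  then have 1: "V a b = (\<lambda>i. V a' b' i + (V b' b i + - V a' a i))"
    and 2: "V a' b' = (\<lambda>i. V a b i + (V a' a i + - V b' b i))" by blast+
  have "?N (V a b) \<le> ?N (V a' b') + (?N (V b' b) + ?N (V a' a))"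
    by (subst 1) (intro order_trans[OF lp_norm_triangle[OF p]] add_left_mono
        order_trans[OF lp_norm_triangle[OF p]], simp add: lp_norm_minus)
  moreover have "?N (V a' b') \<le> ?N (V a b) + (?N (V a' a) + ?N (V b' b))"
    by (subst 2) (intro order_trans[OF lp_norm_triangle[OF p]] add_left_mono
        order_trans[OF lp_norm_triangle[OF p]], simp add: lp_norm_minus)
  ultimately have "\<bar>?N (V a b) - ?N (V a' b')\<bar> \<le> ?N (V a' a) + ?N (V b' b)" by linarith
  then have "\<bar>?N (V a b) - ?N (V a' b')\<bar> / s \<le> (?N (V a' a) + ?N (V b' b)) / s"
    using s by (rule divide_right_mono)
  then show ?thesis
    using s unfolding D_def V_def s_def[symmetric]
    by (simp add: diff_divide_distrib[symmetric] add_divide_distrib)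
qed

text \<open>The number of grid times depends on the tolerance but not on \<open>n\<close>, so a
  union bound over pairs of grid times is affordable. The exceptional event is delivered as a
  measurable set \<open>E\<close>, so that later sets need only be included in it.\<close>

lemma D_uniform_deviation:
  assumes \<eta>: "0 < \<eta>" and \<delta>: "0 < \<delta>"
  obtains K where "\<And>d n. K \<le> d \<Longrightarrow> K \<le> n \<Longrightarrow>
    \<exists>E\<in>sets (M d). measure (M d) E \<le> \<delta> \<and>
      (\<forall>\<omega>\<in>space (M d) - E. \<forall>b\<le>n. \<forall>a\<le>b. \<bar>D d n a b \<omega> - limit_scale * sqrt (real (b - a) / n)\<bar> \<le> \<eta>)"
proof -
  \<comment> \<open>The ten parts: one for the pair of grid times, four for each of the two
    increments inside a cell, and one for moving the limit to the grid.\<close>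
  define \<epsilon> where "\<epsilon> = \<eta> / 10"
  have \<epsilon>: "\<epsilon> > 0" using \<eta> by (simp add: \<epsilon>_def)
  \<comment> \<open>Chosen so that \<open>limit_scale * sqrt (2 / m)\<close> is at most
    \<open>\<epsilon>\<close>; being at least 2 guarantees that a cell fits into \<open>n\<close>
    steps.\<close>
  define m where "m = nat \<lceil>2 * limit_scale\<^sup>2 / \<epsilon>\<^sup>2\<rceil> + 2"
  have m: "2 * limit_scale\<^sup>2 / \<epsilon>\<^sup>2 \<le> m" "m \<ge> 2" unfolding m_def by linarith+
  \<comment> \<open>The union bound counts one \<open>\<delta>'\<close> for each of the (m+1)^2
    pairs of grid times and, by the maximal inequality, two for each of the m+1 cells. The cap 1/2
    on \<open>\<delta>'\<close> is the hypothesis of that inequality.\<close>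
  define G where "G = real ((m + 1)\<^sup>2 + 2 * (m + 1))"
  have G: "0 < G" by (simp add: G_def add_pos_nonneg)
  define \<delta>' where "\<delta>' = min (1 / 2) (\<delta> / G)"
  have \<delta>': "0 < \<delta>'" "\<delta>' \<le> 1 / 2" "\<delta>' \<le> \<delta> / G"
    using \<delta> G min.cobounded1[of "1 / 2" "\<delta> / G"] min.cobounded2[of "1 / 2" "\<delta> / G"]
    by (simp_all only: \<delta>'_def min_less_iff_conj divide_pos_pos zero_less_one zero_less_numeral)
  have \<delta>'_le: "G * \<delta>' \<le> \<delta>" using \<delta>'(3) G by (simp add: pos_le_divide_eq mult.commute)
  obtain K where K: "\<And>d n a k. K \<le> d \<Longrightarrow> K \<le> n \<Longrightarrow> k \<le> n \<Longrightarrow>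
    measure (M d) {\<omega> \<in> space (M d). \<epsilon> < \<bar>D d n a (a + k) \<omega> - limit_scale * sqrt (k / n)\<bar>} \<le> \<delta>'"
    using D_deviation[OF \<epsilon> \<delta>'(1)] by blast
  show thesis
  proof (rule that[of "max K m"])
    fix d n assume "max K m \<le> d" "max K m \<le> n"
    then have d: "0 < d" "K \<le> d" and n: "0 < n" "K \<le> n" "m \<le> n" using m by auto
    interpret prob_space "M d" using prob_space_M d by simp
    \<comment> \<open>Adding 1 gives n < h * m, so the grid indices up to time \<open>n\<close> do
      not exceed \<open>m\<close>; since \<open>m\<close> is at most \<open>n\<close>, it at most
      doubles the mesh n/m.\<close>
    define h where "h = n div m + 1"
    have "real (m * (n div m)) \<le> real n" unfolding of_nat_le_iff by simp
    then have "real (n div m) \<le> n / m" using m by (simp add: pos_le_divide_eq mult.commute)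
    then have h_le: "h \<le> 2 * real n / m" using n m by (simp add: h_def field_simps)
    have h_n: "h \<le> n"
    proof -
      have "n div m \<le> n div 2" using m by (intro div_le_mono2) auto
      then show ?thesis using n m by (simp add: h_def)
    qed
    have h_m: "n div h \<le> m"
    proof -
      have "n < h * m" unfolding h_def using m
        by (metis Suc_eq_plus1 dividend_less_div_times less_le_trans mult_Suc pos2)
      then show ?thesis by (simp add: less_mult_imp_div_less less_imp_le mult.commute)
    qed
    have small: "limit_scale * sqrt (k / n) \<le> \<epsilon>" if "k \<le> h" for k
    proof -
      have "k / n \<le> 2 / m"
      proof -
        have "real k \<le> 2 * real n / m" using that h_le by linarith
        then show ?thesis using n m by (simp add: field_simps)
      qed
      then have "limit_scale * sqrt (k / n) \<le> limit_scale * sqrt (2 / m)"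
        using limit_scale_nonneg by (intro mult_left_mono) auto
      also have "\<dots> = sqrt (2 * limit_scale\<^sup>2 / m)"
        using limit_scale_nonneg by (simp add: real_sqrt_mult real_sqrt_divide)
      also have "\<dots> \<le> sqrt (\<epsilon>\<^sup>2)"
        using m \<epsilon> by (intro real_sqrt_le_mono) (simp add: field_simps)
      finally show ?thesis using \<epsilon> by simp
    qed
    have tail: "prob {\<omega> \<in> space (M d). 2 * \<epsilon> < D d n a (a + k) \<omega>} \<le> \<delta>'" if "k \<le> h" for a k
    proof -
      have "prob {\<omega> \<in> space (M d). 2 * \<epsilon> < D d n a (a + k) \<omega>} \<le>
          prob {\<omega> \<in> space (M d). \<epsilon> < \<bar>D d n a (a + k) \<omega> - limit_scale * sqrt (k / n)\<bar>}"
      proof (rule finite_measure_mono)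
        show "{\<omega> \<in> space (M d). 2 * \<epsilon> < D d n a (a + k) \<omega>} \<subseteq>
          {\<omega> \<in> space (M d). \<epsilon> < \<bar>D d n a (a + k) \<omega> - limit_scale * sqrt (k / n)\<bar>}"
          using small[OF that] by auto
      qed measurable
      also have "\<dots> \<le> \<delta>'" using that h_n d n by (intro K) auto
      finally show ?thesis .
    qed
    \<comment> \<open>The conditions on \<open>i\<close> and \<open>j\<close> sit inside the event,
      so that irrelevant pairs give the empty set and the index set is a full square. In
      \<open>E2\<close> the last cell may run past time \<open>n\<close>; this is covered because
      the tail bound holds for every starting time. Its threshold is twice the
      \<open>2 * \<epsilon>\<close> of the tail bound, as Ottaviani's inequality demands.\<close>
    define E1 where "E1 z = (case z of (i, j) \<Rightarrow> {\<omega> \<in> space (M d). i \<le> j \<and> j * h \<le> n \<and>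
      \<epsilon> < \<bar>D d n (i * h) (j * h) \<omega> - limit_scale * sqrt (real ((j - i) * h) / n)\<bar>})" for z :: "nat \<times> nat"
    define E2 where "E2 i = {\<omega> \<in> space (M d). \<exists>k\<le>h. 2 * (2 * \<epsilon>) < D d n (i * h) (i * h + k) \<omega>}" for i
    have E1_sets: "E1 z \<in> events" for z unfolding E1_def by (cases z) simp
    have E2_sets: "E2 z \<in> events" for z
    proof -
      have "E2 z = (\<Union>k\<in>{..h}. {\<omega> \<in> space (M d). 2 * (2 * \<epsilon>) < D d n (z * h) (z * h + k) \<omega>})"
        by (auto simp: E2_def)
      then show ?thesis by simp
    qed
    have E1_le: "prob (E1 z) \<le> \<delta>'" for z
    proof (cases z)
      case (Pair i j)
      show ?thesis
      proof (cases "i \<le> j \<and> j * h \<le> n")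
        case True
        then have "i * h + (j - i) * h = j * h" by (simp add: add_mult_distrib[symmetric])
        moreover have "(j - i) * h \<le> n" using True by (metis diff_le_self le_trans mult_le_mono1)
        ultimately show ?thesis
          using K[OF d(2) n(2), of "(j - i) * h" "i * h"] True by (simp add: E1_def Pair)
      qed (use \<delta>' in \<open>auto simp: E1_def Pair\<close>)
    qed
    have E2_le: "prob (E2 i) \<le> 2 * \<delta>'" for i
    proof -
      have "prob (E2 i) \<le> 2 * prob {\<omega> \<in> space (M d). 2 * \<epsilon> < D d n (i * h) (i * h + h) \<omega>}"
        unfolding E2_def
      proof (rule D_maximal[OF d(1) n(1)])
        fix k assume k: "k \<le> h"
        have "prob {\<omega> \<in> space (M d). 2 * \<epsilon> < D d n (i * h + k) (i * h + k + (h - k)) \<omega>} \<le> \<delta>'"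
          by (rule tail) simp
        then show "prob {\<omega> \<in> space (M d). 2 * \<epsilon> < D d n (i * h + k) (i * h + h) \<omega>} \<le> 1 / 2"
          using k \<delta>' by simp
      qed
      also have "\<dots> \<le> 2 * \<delta>'" using tail[of h "i * h"] by simp
      finally show ?thesis .
    qed
    define E where "E = (\<Union>z\<in>{..m} \<times> {..m}. E1 z) \<union> (\<Union>i\<in>{..m}. E2 i)"
    have "prob E \<le> \<delta>"
    proof -
      have "prob E \<le> prob (\<Union>z\<in>{..m} \<times> {..m}. E1 z) + prob (\<Union>i\<in>{..m}. E2 i)"
        unfolding E_def using E1_sets E2_sets by (intro measure_Un_le) auto
      also have "\<dots> \<le> (\<Sum>z\<in>{..m} \<times> {..m}. prob (E1 z)) + (\<Sum>i\<in>{..m}. prob (E2 i))"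
        using E1_sets E2_sets by (intro add_mono measure_UNION_le) auto
      also have "\<dots> \<le> (\<Sum>z\<in>{..m} \<times> {..m}. \<delta>') + (\<Sum>i\<in>{..m}. 2 * \<delta>')"
        using E1_le E2_le by (intro add_mono sum_mono) auto
      also have "\<dots> = G * \<delta>'"
        by (simp add: G_def power2_eq_square algebra_simps)
      finally show ?thesis using \<delta>'_le by simp
    qed
    moreover have "\<bar>D d n a b \<omega> - limit_scale * sqrt (real (b - a) / n)\<bar> \<le> \<eta>"
      if \<omega>: "\<omega> \<in> space (M d) - E" and ab: "b \<le> n" "a \<le> b" for \<omega> a b
    proof -
      define i j where "i = a div h" and "j = b div h"
      have hpos: "0 < h" by (simp add: h_def)
      have a: "a = i * h + a mod h" and b: "b = j * h + b mod h" by (simp_all add: i_def j_def)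
      have am: "a mod h \<le> h" "b mod h \<le> h" using hpos by (simp_all add: less_imp_le)
      have ij: "i \<le> j" "j \<le> m" "j * h \<le> n" "i \<le> m"
      proof -
        show "i \<le> j" unfolding i_def j_def using ab by (intro div_le_mono)
        have "j \<le> n div h" unfolding j_def using ab by (intro div_le_mono)
        then show "j \<le> m" using h_m by simp
        then show "i \<le> m" using \<open>i \<le> j\<close> by simp
        show "j * h \<le> n" using b ab by linarith
      qed
      have D1: "\<bar>D d n (i * h) (j * h) \<omega> - limit_scale * sqrt (real ((j - i) * h) / n)\<bar> \<le> \<epsilon>"
        using \<omega> ij by (force simp: E_def E1_def not_less)
      have D2: "D d n (i * h) a \<omega> \<le> 4 * \<epsilon>"
      proof -
        have "\<omega> \<notin> E2 i" using \<omega> ij by (auto simp: E_def)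
        then have "\<not> 2 * (2 * \<epsilon>) < D d n (i * h) (i * h + a mod h) \<omega>" using \<omega> am unfolding E2_def by blast
        then show ?thesis using a by simp
      qed
      have D3: "D d n (j * h) b \<omega> \<le> 4 * \<epsilon>"
      proof -
        have "\<omega> \<notin> E2 j" using \<omega> ij by (auto simp: E_def)
        then have "\<not> 2 * (2 * \<epsilon>) < D d n (j * h) (j * h + b mod h) \<omega>" using \<omega> am unfolding E2_def by blast
        then show ?thesis using b by simp
      qed
      have D4: "\<bar>D d n a b \<omega> - D d n (i * h) (j * h) \<omega>\<bar> \<le> D d n (i * h) a \<omega> + D d n (j * h) b \<omega>"
        using a b ij ab by (intro D_triangle) (auto intro: mult_le_mono1)
      have "\<bar>limit_scale * sqrt (real (b - a) / n) - limit_scale * sqrt (real ((j - i) * h) / n)\<bar>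
          = limit_scale * \<bar>sqrt (real (b - a) / n) - sqrt (real ((j - i) * h) / n)\<bar>"
        using limit_scale_nonneg by (simp add: right_diff_distrib[symmetric] abs_mult)
      also have "\<dots> \<le> limit_scale * sqrt (h / n)"
      proof (intro mult_left_mono limit_scale_nonneg)
        have "\<bar>real (b - a) - real ((j - i) * h)\<bar> \<le> h"
        proof -
          have "real b = real (j * h) + real (b mod h)" "real a = real (i * h) + real (a mod h)"
            using a b by (metis of_nat_add)+
          moreover have "real ((j - i) * h) = real (j * h) - real (i * h)"
            using ij by (simp add: diff_mult_distrib of_nat_diff left_diff_distrib)
          ultimately show ?thesis using am ab by (simp add: of_nat_diff)
        qed
        then have "\<bar>real (b - a) / n - real ((j - i) * h) / n\<bar> \<le> h / n"
          unfolding diff_divide_distrib[symmetric] abs_divide by (simp add: divide_right_mono)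
        then show "\<bar>sqrt (real (b - a) / n) - sqrt (real ((j - i) * h) / n)\<bar> \<le> sqrt (h / n)"
          by (intro order_trans[OF sqrt_diff_le] real_sqrt_le_mono) auto
      qed
      also have "\<dots> \<le> \<epsilon>" by (rule small) simp
      finally show ?thesis using D1 D2 D3 D4 unfolding \<epsilon>_def by linarith
    qed
    moreover have "E \<in> events" unfolding E_def using E1_sets E2_sets by auto
    ultimately show "\<exists>E\<in>events. prob E \<le> \<delta> \<and>
      (\<forall>\<omega>\<in>space (M d) - E. \<forall>b\<le>n. \<forall>a\<le>b. \<bar>D d n a b \<omega> - limit_scale * sqrt (real (b - a) / n)\<bar> \<le> \<eta>)"
      by blast
  qed
qed

end

section \<open>Convergence to the snowflake\<close>

lemma Metric_space_sqrt_dist: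
  fixes c :: real and S :: "real set"
  assumes "0 < c"
  shows "Metric_space S (\<lambda>t s. sqrt \<bar>t - s\<bar> * c)"
proof
  show "sqrt \<bar>x - z\<bar> * c \<le> sqrt \<bar>x - y\<bar> * c + sqrt \<bar>y - z\<bar> * c" for x y z
  proof -
    have "sqrt \<bar>x - z\<bar> \<le> sqrt (\<bar>x - y\<bar> + \<bar>y - z\<bar>)" by simp
    also have "\<dots> \<le> sqrt \<bar>x - y\<bar> + sqrt \<bar>y - z\<bar>" by (intro sqrt_add_le_add_sqrt) auto
    finally show ?thesis
      using assms by (simp add: distrib_right[symmetric] mult_right_mono)
  qed
qed (use assms in \<open>auto simp: abs_minus_commute\<close>)

text \<open>Times differing by at most \<open>2 / n\<close> in their gaps cost at most
  \<open>c * sqrt (2 / n)\<close>, since the square root is Holder continuous of order 1/2. The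
  distortion is bounded by the full value and not by twice it, so a factor 2 is given away.\<close>

lemma gromov_hausdorff_dist_snowflake_le:
  fixes v :: "nat \<Rightarrow> nat \<Rightarrow> real"
  assumes p: "1 \<le> p" and n: "0 < n" and c: "0 < c" and \<eta>: "0 < \<eta>"
    and v: "\<And>k. v k \<in> extensional {..<d}"
    and close: "\<And>a b. a \<le> b \<Longrightarrow> b \<le> n \<Longrightarrow> \<bar>lp_dist p d (v a) (v b) - c * sqrt (real (b - a) / n)\<bar> \<le> \<eta>"
  shows "gromov_hausdorff_dist (v ` {0..n}) (lp_dist p d) {0..1::real} (\<lambda>t s. sqrt \<bar>t - s\<bar> * c)
    \<le> ereal (\<eta> + c * sqrt (2 / n))"
proof -
  \<comment> \<open>The tolerance \<open>1 / n\<close> is the mesh of the times k/n, which makes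
    both projections of \<open>R\<close> surjective.\<close>
  define R where "R = {(v k, t) | k t. k \<le> n \<and> t \<in> {0..1::real} \<and> \<bar>t - k / n\<bar> \<le> 1 / n}"
  have RI: "(v k, t) \<in> R" if "k \<le> n" "t \<in> {0..1}" "\<bar>t - k / n\<bar> \<le> 1 / n" for k t
    using that unfolding R_def by blast
  have RD: "\<exists>k\<le>n. x = v k \<and> t \<in> {0..1} \<and> \<bar>t - k / n\<bar> \<le> 1 / n" if "(x, t) \<in> R" for x t
    using that unfolding R_def by blast
  show ?thesis
  proof (rule gromov_hausdorff_dist_le_correspondence)
    show "Metric_space (v ` {0..n}) (lp_dist p d)"
      by (rule Metric_space_lp_dist[OF p]) (use v in auto)
    show "Metric_space {0..1::real} (\<lambda>t s. sqrt \<bar>t - s\<bar> * c)"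
      by (rule Metric_space_sqrt_dist[OF c])
    show "fst ` R = v ` {0..n}"
    proof (intro equalityI subsetI)
      fix x assume "x \<in> v ` {0..n}"
      then obtain k where k: "k \<le> n" "x = v k" by auto
      have "(x, real k / n) \<in> R" unfolding k(2) by (rule RI) (use k n in auto)
      then show "x \<in> fst ` R" by (rule rev_image_eqI) simp
    next
      fix x assume "x \<in> fst ` R"
      then obtain t where "(x, t) \<in> R" by auto
      from RD[OF this] show "x \<in> v ` {0..n}" by auto
    qed
    show "snd ` R = {0..1}"
    proof (intro equalityI subsetI)
      fix t :: real assume t: "t \<in> {0..1}"
      define k where "k = nat \<lfloor>t * n\<rfloor>"
      have k: "real k \<le> t * n" "t * n \<le> real k + 1"
      proof -
        have "0 \<le> t * n" using t by simp
        then show "real k \<le> t * n" "t * n \<le> real k + 1" unfolding k_def by linarith+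
      qed
      have "k \<le> n"
      proof -
        have "t * n \<le> 1 * real n" using t by (intro mult_right_mono) auto
        then show ?thesis using k(1) by linarith
      qed
      moreover have "\<bar>t - k / n\<bar> \<le> 1 / n"
      proof -
        have "t - k / n = (t * n - k) / n" using n by (simp add: diff_divide_distrib)
        moreover have "\<bar>t * n - k\<bar> \<le> 1" using k by linarith
        ultimately show ?thesis using n by (simp add: abs_divide divide_right_mono)
      qed
      ultimately have "(v k, t) \<in> R" using t by (intro RI)
      then show "t \<in> snd ` R" by (rule rev_image_eqI) simp
    next
      fix t assume "t \<in> snd ` R"
      then obtain x where "(x, t) \<in> R" by auto
      from RD[OF this] show "t \<in> {0..1}" by auto
    qed
    show "v ` {0..n} \<noteq> {}" by simp
    show "0 < \<eta> + c * sqrt (2 / n)" using \<eta> c by (simp add: add_pos_nonneg)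
    show "\<bar>lp_dist p d x x' - sqrt \<bar>y - y'\<bar> * c\<bar> \<le> 2 * (\<eta> + c * sqrt (2 / n))"
      if xy: "(x, y) \<in> R" "(x', y') \<in> R" for x y x' y'
    proof -
      obtain k where k: "x = v k" "k \<le> n" "\<bar>y - k / n\<bar> \<le> 1 / n" using RD[OF xy(1)] by blast
      obtain l where l: "x' = v l" "l \<le> n" "\<bar>y' - l / n\<bar> \<le> 1 / n" using RD[OF xy(2)] by blast
      have 1: "\<bar>lp_dist p d x x' - c * sqrt (\<bar>k / n - l / n\<bar>)\<bar> \<le> \<eta>"
      proof (cases "k \<le> l")
        case True
        have "\<bar>k / n - l / n\<bar> = real (l - k) / n"
          using True n by (simp add: diff_divide_distrib[symmetric] abs_divide of_nat_diff)
        then show ?thesis using close[OF True l(2)] k(1) l(1) by simp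
      next
        case False
        have "\<bar>k / n - l / n\<bar> = real (k - l) / n"
          using False n by (simp add: diff_divide_distrib[symmetric] abs_divide of_nat_diff)
        then show ?thesis using close[of l k] False k l by (simp add: lp_dist_commute)
      qed
      have "\<bar>\<bar>k / n - l / n\<bar> - \<bar>y - y'\<bar>\<bar> \<le> 1 / n + 1 / n" using k(3) l(3) by linarith
      also have "\<dots> = 2 / n" by simp
      finally have "\<bar>sqrt \<bar>k / n - l / n\<bar> - sqrt \<bar>y - y'\<bar>\<bar> \<le> sqrt (2 / n)"
        by (intro order_trans[OF sqrt_diff_le] real_sqrt_le_mono) auto
      then have "c * \<bar>sqrt \<bar>k / n - l / n\<bar> - sqrt \<bar>y - y'\<bar>\<bar> \<le> c * sqrt (2 / n)"
        using c by (intro mult_left_mono) auto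
      moreover have "\<bar>c * sqrt \<bar>k / n - l / n\<bar> - sqrt \<bar>y - y'\<bar> * c\<bar> =
          c * \<bar>sqrt \<bar>k / n - l / n\<bar> - sqrt \<bar>y - y'\<bar>\<bar>"
        unfolding mult.commute[of _ c] right_diff_distrib[symmetric] abs_mult using c by simp
      ultimately have "\<bar>c * sqrt \<bar>k / n - l / n\<bar> - sqrt \<bar>y - y'\<bar> * c\<bar> \<le> c * sqrt (2 / n)" by (simp only:)
      moreover have "0 \<le> c * sqrt (2 / n)" using c by simp
      moreover have "\<bar>u - w\<bar> \<le> 2 * (\<eta> + f)" if "\<bar>u - z\<bar> \<le> \<eta>" "\<bar>z - w\<bar> \<le> f" "0 \<le> f" for u z w f
        using that \<eta> unfolding abs_le_iff by argo
      ultimately show ?thesis using 1 by blast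
    qed
  qed
qed

text \<open>Makes the limiting scale positive, so that the limit is a metric space. If the moment
  vanished, the normal variable would be 0 almost surely, against its second moment.\<close>

lemma abs_normal_moment_pos:
  assumes "0 < p"
  shows "0 < abs_normal_moment p"
proof -
  have "abs_normal_moment p \<noteq> 0"
  proof
    assume "abs_normal_moment p = 0"
    then have "AE x in std_normal_distribution. \<bar>x\<bar> powr p = 0"
      unfolding abs_normal_moment_def using integrable_std_normal_powr[of p] assms
      by (subst (asm) integral_nonneg_eq_0_iff_AE) auto
    then have "AE x in std_normal_distribution. x ^ (2 * 1) = 0" by eventually_elim auto
    then have "(\<integral>x. x ^ (2 * 1) \<partial>std_normal_distribution) = 0"
      by (rule integral_eq_zero_AE)
    then show False using std_normal_distribution_even_moments(1)[of 1] by (simp add: fact_numeral)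
  qed
  moreover have "0 \<le> abs_normal_moment p" by (simp add: abs_normal_moment_def)
  ultimately show ?thesis by simp
qed

context uncorrelated_arrays
begin

lemma limit_moment_eq: "limit_moment = \<sigma> powr p * abs_normal_moment p"
  using \<sigma>_nonneg by (simp add: limit_moment_def abs_normal_moment_def abs_mult powr_mult)

lemma limit_scale_eq: "limit_scale = \<sigma> * abs_normal_moment p powr (1 / p)"
  using \<sigma>_nonneg p by (simp add: limit_scale_def limit_moment_eq powr_mult powr_powr)

end

theorem theorem1p1:
  fixes p \<sigma> :: real
    and dim :: "nat \<Rightarrow> nat"
    and N :: "'v measure" and \<xi> :: "'v \<Rightarrow> real"
    and M :: "nat \<Rightarrow> 'w measure"
    and X :: "nat \<Rightarrow> nat \<Rightarrow> 'w \<Rightarrow> nat \<Rightarrow> real"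
    and \<xi>s :: "nat \<Rightarrow> nat \<Rightarrow> 'w \<Rightarrow> real"
  assumes p: "1 \<le> p"
    and dim_pos: "\<And>n. dim n > 0"
    and dim_lim: "filterlim dim at_top sequentially"
    and N: "prob_space N"
    and \<xi>_rv: "\<xi> \<in> borel_measurable N"
    and centered: "integrable N \<xi>" "(\<integral>\<omega>. \<xi> \<omega> \<partial>N) = 0"
    and nontrivial: "\<not> (AE \<omega> in N. \<xi> \<omega> = 0)"
    and moment: "integrable N (\<lambda>\<omega>. \<bar>\<xi> \<omega>\<bar> powr (2 * p))"
    and \<sigma>: "\<sigma> \<ge> 0" "\<sigma>\<^sup>2 = (\<integral>\<omega>. (\<xi> \<omega>)\<^sup>2 \<partial>N)"
    and M: "\<And>d. d > 0 \<Longrightarrow> prob_space (M d)"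
    and X_indep: "\<And>d. d > 0 \<Longrightarrow> prob_space.indep_vars (M d) (\<lambda>_. borel_vec d) (X d) {1..}"
    and X_ident: "\<And>d k. d > 0 \<Longrightarrow> k \<ge> 1 \<Longrightarrow>
      distr (M d) (borel_vec d) (X d k) = distr (M d) (borel_vec d) (X d 1)"
    and X_1: "\<And>d \<omega>. d > 0 \<Longrightarrow> \<omega> \<in> space (M d) \<Longrightarrow>
      X d 1 \<omega> = (\<lambda>i\<in>{..<d}. real d powr (-1 / p) * \<xi>s d i \<omega>)"
    and \<xi>s_rv: "\<And>d i. i < d \<Longrightarrow> \<xi>s d i \<in> borel_measurable (M d)"
    and \<xi>s_distr: "\<And>d i. i < d \<Longrightarrow> distr (M d) borel (\<xi>s d i) = distr N borel \<xi>"
    and \<xi>s_uncorr: "\<And>d i j. i < d \<Longrightarrow> j < d \<Longrightarrow> i \<noteq> j \<Longrightarrow> covariance (M d) (\<xi>s d i) (\<xi>s d j) = 0"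
  shows "tendsto_0_in_prob (\<lambda>n. M (dim n))
    (\<lambda>n \<omega>. gromov_hausdorff_dist
       (scaled_walk_range (dim n) (X (dim n)) n \<omega>) (lp_dist p (dim n))
       {0..1::real} (\<lambda>t s. sqrt \<bar>t - s\<bar> * \<sigma> * abs_normal_moment p powr (1 / p)))"
proof -
  define Y where "Y d l i \<omega> = real d powr (1 / p) * X d l \<omega> i" for d l i \<omega>
  define \<mu> where "\<mu> = distr N borel \<xi>"
  have X_meas: "X d l \<in> measurable (M d) (borel_vec d)" if "0 < d" "1 \<le> l" for d l
  proof -
    interpret prob_space "M d" using M that by simp
    show ?thesis using X_indep[OF that(1)] that unfolding indep_vars_def by auto
  qed
  have X_coord: "(\<lambda>\<omega>. X d l \<omega> i) \<in> borel_measurable (M d)" if "i < d" "1 \<le> l" for d l i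
    by (rule measurable_compose[OF X_meas measurable_component_singleton]) (use that in auto)
  have Y1: "Y d 1 i \<omega> = \<xi>s d i \<omega>" if "i < d" "\<omega> \<in> space (M d)" for d i \<omega>
  proof -
    have "d > 0" using that by simp
    from X_1[OF this that(2)] show ?thesis
      using that \<open>d > 0\<close> by (simp add: Y_def mult.assoc[symmetric] powr_add[symmetric])
  qed
  have coord: "(\<lambda>x. real d powr (1 / p) * x i) \<in> borel_measurable (borel_vec d)" if "i < d" for i d
    by (intro borel_measurable_times borel_measurable_const measurable_component_singleton) (use that in auto)
  have \<xi>s_mean: "(\<integral>\<omega>. \<xi>s d i \<omega> \<partial>M d) = 0" if "i < d" for d i
  proof -
    have "(\<integral>\<omega>. \<xi>s d i \<omega> \<partial>M d) = (\<integral>x. x \<partial>distr (M d) borel (\<xi>s d i))"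
      by (rule integral_distr[symmetric, OF \<xi>s_rv[OF that]]) simp
    also have "\<dots> = (\<integral>\<omega>. \<xi> \<omega> \<partial>N)"
      unfolding \<xi>s_distr[OF that] by (rule integral_distr[OF \<xi>_rv]) simp
    finally show ?thesis using centered by simp
  qed
  interpret A: uncorrelated_arrays M Y \<mu> p
  proof (rule uncorrelated_arrays.intro)
    show "1 \<le> p" by (rule p)
    interpret N: prob_space N by (rule N)
    show "real_distribution \<mu>" unfolding \<mu>_def by (rule N.real_distribution_distr[OF \<xi>_rv])
    show "(\<integral>x. x \<partial>\<mu>) = 0"
      unfolding \<mu>_def centered(2)[symmetric] by (rule integral_distr[OF \<xi>_rv]) simp
    show "integrable \<mu> (\<lambda>x. \<bar>x\<bar> powr (2 * p))"
      unfolding \<mu>_def by (subst integrable_distr_eq[OF \<xi>_rv]) (use moment in auto)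
    show "prob_space (M d)" if "0 < d" for d by (rule M[OF that])
    show "prob_space.indep_vars (M d) (\<lambda>_. borel_vec d) (\<lambda>l \<omega>. \<lambda>i\<in>{..<d}. Y d l i \<omega>) {1..}" if "0 < d" for d
    proof -
      interpret prob_space "M d" by (rule M[OF that])
      have "(\<lambda>x. \<lambda>i\<in>{..<d}. real d powr (1 / p) * x i) \<in> measurable (borel_vec d) (borel_vec d)"
        by (rule measurable_restrict) (use coord in auto)
      from indep_vars_compose2[OF X_indep[OF that] this] show ?thesis unfolding Y_def .
    qed
    show "distr (M d) borel (Y d l i) = \<mu>" if i: "i < d" and l: "1 \<le> l" for d l i
    proof -
      have d: "0 < d" using i by simp
      \<comment> \<open>Only the first step is tied to \<open>\<xi>s\<close>, and
        \<open>X_ident\<close> compares laws of whole vectors. Pushing the law forward to a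
        coordinate, and below integrating a product of two coordinates against it, carries the
        information over to every step.\<close>
      have push: "distr (M d) borel (Y d l i) =
          distr (distr (M d) (borel_vec d) (X d l)) borel (\<lambda>x. real d powr (1 / p) * x i)" if "1 \<le> l" for l
        unfolding Y_def using distr_distr[OF coord[OF i] X_meas[OF d that]] by (simp add: comp_def)
      have "distr (M d) borel (Y d l i) = distr (M d) borel (Y d 1 i)"
        using push[OF l] push[of 1] X_ident[OF d l] by simp
      also have "\<dots> = distr (M d) borel (\<xi>s d i)"
        by (rule distr_cong) (use Y1 i in auto)
      finally show ?thesis unfolding \<mu>_def \<xi>s_distr[OF i] .
    qed
    show "(\<integral>\<omega>. Y d l i \<omega> * Y d l j \<omega> \<partial>M d) = 0"
      if i: "i < d" and j: "j < d" and neq: "i \<noteq> j" and l: "1 \<le> l" for d l i j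
    proof -
      have d: "0 < d" using i by simp
      let ?g = "\<lambda>x. (real d powr (1 / p) * x i) * (real d powr (1 / p) * x j)"
      have g: "?g \<in> borel_measurable (borel_vec d)"
        by (intro borel_measurable_times[OF coord[OF i] coord[OF j]])
      have push: "(\<integral>\<omega>. Y d l i \<omega> * Y d l j \<omega> \<partial>M d) = (\<integral>x. ?g x \<partial>distr (M d) (borel_vec d) (X d l))"
        if "1 \<le> l" for l
        unfolding Y_def by (rule integral_distr[symmetric, OF X_meas[OF d that] g])
      have "(\<integral>\<omega>. Y d l i \<omega> * Y d l j \<omega> \<partial>M d) = (\<integral>\<omega>. Y d 1 i \<omega> * Y d 1 j \<omega> \<partial>M d)"
        using push[OF l] push[of 1] X_ident[OF d l] by simp
      also have "\<dots> = (\<integral>\<omega>. \<xi>s d i \<omega> * \<xi>s d j \<omega> \<partial>M d)"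
        by (rule Bochner_Integration.integral_cong) (use Y1 i j in auto)
      also have "\<dots> = 0"
        using \<xi>s_uncorr[OF i j neq] unfolding covariance_def \<xi>s_mean[OF i] \<xi>s_mean[OF j] by simp
      finally show ?thesis .
    qed
  qed
  have \<sigma>_eq: "A.\<sigma> = \<sigma>"
  proof -
    have "(\<integral>x. x\<^sup>2 \<partial>\<mu>) = \<sigma>\<^sup>2" unfolding \<mu>_def \<sigma>(2) by (rule integral_distr[OF \<xi>_rv]) simp
    then show ?thesis unfolding A.\<sigma>_def using \<sigma>(1) by simp
  qed
  define c where "c = \<sigma> * abs_normal_moment p powr (1 / p)"
  have c_eq: "A.limit_scale = c" unfolding A.limit_scale_eq \<sigma>_eq c_def ..
  \<comment> \<open>Nontriviality of \<open>\<xi>\<close> is used here: with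
    \<open>\<sigma> = 0\<close> the limiting distance would vanish identically and would not be a
    metric on the unit interval.\<close>
  have "0 < \<sigma>"
  proof (rule ccontr)
    assume "\<not> 0 < \<sigma>"
    then have "(\<integral>\<omega>. (\<xi> \<omega>)\<^sup>2 \<partial>N) = 0" using \<sigma> by simp
    moreover have "integrable N (\<lambda>\<omega>. (\<xi> \<omega>)\<^sup>2)"
    proof -
      interpret prob_space N by (rule N)
      show ?thesis by (rule integrable_square_of_powr[OF \<xi>_rv moment]) (use p in simp)
    qed
    ultimately have "AE \<omega> in N. (\<xi> \<omega>)\<^sup>2 = 0"
      by (subst (asm) integral_nonneg_eq_0_iff_AE) auto
    then show False using nontrivial by simp
  qed
  then have c: "0 < c" using abs_normal_moment_pos[of p] p by (simp add: c_def)
  have metric: "(\<lambda>t s. sqrt \<bar>t - s\<bar> * \<sigma> * abs_normal_moment p powr (1 / p)) = (\<lambda>t s::real. sqrt \<bar>t - s\<bar> * c)"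
    by (simp add: c_def mult.assoc)
  define v where "v d n \<omega> k i = real n powr (-1 / 2) * partial_sum d (X d) k \<omega> i" for d n \<omega> k i
  have range_eq: "scaled_walk_range d (X d) n \<omega> = (\<lambda>k. restrict (v d n \<omega> k) {..<d}) ` {0..n}" for d n \<omega>
    unfolding scaled_walk_range_def v_def by simp
  have dist_eq: "lp_dist p d (restrict (v d n \<omega> a) {..<d}) (restrict (v d n \<omega> b) {..<d}) = A.D d n a b \<omega>"
    if ab: "a \<le> b" and d: "0 < d" and n: "0 < n" for d n \<omega> a b
  proof -
    have incr: "(\<Sum>l=1..a. X d l \<omega> i) - (\<Sum>l=1..b. X d l \<omega> i) = - (\<Sum>l\<in>{a<..b}. X d l \<omega> i)" for i
    proof -
      have "{1..b} = {1..a} \<union> {a<..b}" using ab by auto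
      then have "(\<Sum>l=1..b. X d l \<omega> i) = (\<Sum>l=1..a. X d l \<omega> i) + (\<Sum>l\<in>{a<..b}. X d l \<omega> i)"
        by (simp only:) (rule sum.union_disjoint; auto)
      then show ?thesis by simp
    qed
    have "lp_dist p d (restrict (v d n \<omega> a) {..<d}) (restrict (v d n \<omega> b) {..<d})
        = lp_norm p d (\<lambda>i. - (real n powr (-1 / 2)) * (\<Sum>l\<in>{a<..b}. X d l \<omega> i))"
      unfolding lp_dist_def
      by (rule lp_norm_cong) (simp add: v_def partial_sum_def right_diff_distrib[symmetric] incr del: One_nat_def)
    also have "\<dots> = real n powr (-1 / 2) * lp_norm p d (\<lambda>i. \<Sum>l\<in>{a<..b}. X d l \<omega> i)"
      using p by (subst lp_norm_mult) auto
    also have "\<dots> = A.D d n a b \<omega>"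
    proof -
      have "lp_norm p d (\<lambda>i. \<Sum>l\<in>{a<..b}. Y d l i \<omega>) =
          real d powr (1 / p) * lp_norm p d (\<lambda>i. \<Sum>l\<in>{a<..b}. X d l \<omega> i)"
        unfolding Y_def sum_distrib_left[symmetric] using p by (subst lp_norm_mult) auto
      moreover have "real n powr (-1 / 2) = 1 / sqrt n"
        using n by (simp add: powr_minus_divide powr_half_sqrt)
      ultimately show ?thesis using d by (simp add: A.D_def)
    qed
    finally show ?thesis .
  qed
  show ?thesis
    unfolding tendsto_0_in_prob_def metric range_eq
  proof (intro conjI allI impI)
    fix n
    show "(\<lambda>\<omega>. gromov_hausdorff_dist ((\<lambda>k. restrict (v (dim n) n \<omega> k) {..<dim n}) ` {0..n}) (lp_dist p (dim n))
        {0..1} (\<lambda>t s. sqrt \<bar>t - s\<bar> * c)) \<in> borel_measurable (M (dim n))"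
    proof (rule borel_measurable_gromov_hausdorff_dist[OF p Metric_space_sqrt_dist[OF c]])
      fix k i
      show "(\<lambda>\<omega>. v (dim n) n \<omega> k i) \<in> borel_measurable (M (dim n))"
      \<comment> \<open>Outside the index range \<open>partial_sum\<close> takes the value
        \<open>undefined\<close>, which does not depend on the outcome, so \<open>v\<close> is
        measurable there as well.\<close>
      proof (cases "i < dim n")
        case True
        then show ?thesis unfolding v_def partial_sum_def
          using X_coord[of i "dim n"] by (auto intro!: borel_measurable_times borel_measurable_sum)
      qed (simp add: v_def partial_sum_def)
    qed
  next
    fix \<epsilon> :: real assume \<epsilon>: "0 < \<epsilon>"
    let ?G = "\<lambda>n \<omega>. gromov_hausdorff_dist ((\<lambda>k. restrict (v (dim n) n \<omega> k) {..<dim n}) ` {0..n}) (lp_dist p (dim n))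
        {0..1} (\<lambda>t s. sqrt \<bar>t - s\<bar> * c)"
    show "(\<lambda>n. measure (M (dim n)) {\<omega> \<in> space (M (dim n)). ereal \<epsilon> < ?G n \<omega>}) \<longlonglongrightarrow> 0"
    proof (rule tendstoI)
      fix \<delta> :: real assume \<delta>: "0 < \<delta>"
      obtain K where K: "\<And>d n. K \<le> d \<Longrightarrow> K \<le> n \<Longrightarrow>
        \<exists>E\<in>sets (M d). measure (M d) E \<le> \<delta> / 2 \<and>
          (\<forall>\<omega>\<in>space (M d) - E. \<forall>b\<le>n. \<forall>a\<le>b. \<bar>A.D d n a b \<omega> - A.limit_scale * sqrt (real (b - a) / n)\<bar> \<le> \<epsilon> / 2)"
        using A.D_uniform_deviation[of "\<epsilon> / 2" "\<delta> / 2"] \<epsilon> \<delta> by auto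
      have "(\<lambda>n. c * sqrt (2 / real n)) \<longlonglongrightarrow> 0" by real_asymp
      then have "eventually (\<lambda>n. c * sqrt (2 / real n) < \<epsilon> / 2) sequentially"
        using \<epsilon> by (intro order_tendstoD) auto
      moreover have "eventually (\<lambda>n. K \<le> dim n) sequentially"
        using dim_lim unfolding filterlim_at_top by blast
      moreover have "eventually (\<lambda>n. max 1 K \<le> n) sequentially" by (rule eventually_ge_at_top)
      ultimately show "eventually (\<lambda>n. dist (measure (M (dim n)) {\<omega> \<in> space (M (dim n)). ereal \<epsilon> < ?G n \<omega>}) 0 < \<delta>) sequentially"
      proof eventually_elim
        case (elim n)
        interpret prob_space "M (dim n)" by (rule M[OF dim_pos])
        obtain E where E: "E \<in> events" "prob E \<le> \<delta> / 2"
          and good: "\<And>\<omega> a b. \<omega> \<in> space (M (dim n)) - E \<Longrightarrow> b \<le> n \<Longrightarrow> a \<le> b \<Longrightarrow>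
            \<bar>A.D (dim n) n a b \<omega> - c * sqrt (real (b - a) / n)\<bar> \<le> \<epsilon> / 2"
          using K[of "dim n" n] elim unfolding c_eq by auto
        \<comment> \<open>One half of the tolerance is the uniform deviation of the increments
          outside \<open>E\<close>, the other half the discretisation error
          \<open>c * sqrt (2 / n)\<close>.\<close>
        have "{\<omega> \<in> space (M (dim n)). ereal \<epsilon> < ?G n \<omega>} \<subseteq> E"
        proof (rule ccontr)
          assume "\<not> ?thesis"
          then obtain \<omega> where \<omega>: "\<omega> \<in> space (M (dim n)) - E" "ereal \<epsilon> < ?G n \<omega>" by blast
          have "?G n \<omega> \<le> ereal (\<epsilon> / 2 + c * sqrt (2 / n))"
          proof (rule gromov_hausdorff_dist_snowflake_le[OF p _ c])
            show "\<bar>lp_dist p (dim n) (restrict (v (dim n) n \<omega> a) {..<dim n}) (restrict (v (dim n) n \<omega> b) {..<dim n})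
              - c * sqrt (real (b - a) / n)\<bar> \<le> \<epsilon> / 2" if "a \<le> b" "b \<le> n" for a b
              using good[OF \<omega>(1) that(2,1)] dist_eq[OF that(1) dim_pos, of n n \<omega>] elim by simp
          qed (use elim \<epsilon> in auto)
          also have "\<dots> \<le> ereal \<epsilon>" using elim by simp
          finally show False using \<omega>(2) by simp
        qed
        then have "prob {\<omega> \<in> space (M (dim n)). ereal \<epsilon> < ?G n \<omega>} \<le> prob E"
          using E(1) by (rule finite_measure_mono)
        then show ?case using E(2) \<delta> by simp
      qed
    qed
  qed
qed

end
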